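(* Let $m \geq 1$ be a real number, let $s,k$ be natural numbers with $s \geq k(k+1)$, and let $\epsilon>0$ be sufficiently small (in terms of $s$ and $k$). Suppose that $A$ is a finite, well-spaced subset of $\mathbb{R}$ such that $|A|$ is sufficiently large (in terms of $\epsilon$, $k$, $m$, $s$) and $X_A \leq |A|^m$. Let $\alpha \leq 1$ be any positive real number such that \[ \log{\alpha^{-1}} \leq \frac{\epsilon k(k+1)}{43200}\log{|A|} \quad \text{and} \quad J_{s,k}(A) = \alpha |A|^{2s-k(k+1)/2}. \] Then there exists $A' \subseteq A$ with $|A'| \geq \alpha^{\epsilon/4}|A|^{1-\epsilon k^2}$ such that for all $l \in \mathbb{N}$, \[ |l\mathscr{A'}| \leq \alpha^{-(1+2\epsilon(l+k^2))}|A'|^{\frac{k(k+1)}{2}(1+\epsilon(l+k^2))}, \] where $\mathscr{A'} = \{(a,a^2,\dots,a^k) : a \in A'\}$.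
   Context: For a finite set $A\subseteq\mathbb{R}$ and natural numbers $s,k$, $J_{s,k}(A)$ denotes the number of solutions $(x_1,\dots,x_s,y_1,\dots,y_s)\in A^{2s}$ of the system $\sum_{i=1}^s x_i^j = \sum_{i=1}^s y_i^j$ for $1\le j\le k$. The diameter of $A$ is $X_A = |\sup A - \inf A|$. A finite set $A\subseteq \mathbb{R}$ is well-spaced if $|A\cap (j,j+1]|\le 1$ for all integers $j\in[\inf A - 1,\sup A]$. For a set $\mathscr{B}\subseteq\mathbb{R}^k$ and $l\in\mathbb{N}$, $l\mathscr{B} = \{b_1+\dots+b_l : b_i\in\mathscr{B}\}$ is the $l$-fold sumset. *)

theory Defs
  imports "HOL-Analysis.Analysis" "HOL-Library.FuncSet" "HOL-Library.Function_Algebras"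
begin

definition vinogradov_solutions ::
    "nat \<Rightarrow> nat \<Rightarrow> real set \<Rightarrow> ((nat \<Rightarrow> real) \<times> (nat \<Rightarrow> real)) set" where
  "vinogradov_solutions s k A =
     {(x, y). x \<in> {1..s} \<rightarrow>\<^sub>E A \<and> y \<in> {1..s} \<rightarrow>\<^sub>E A \<and>
        (\<forall>j\<in>{1..k}. (\<Sum>i=1..s. x i ^ j) = (\<Sum>i=1..s. y i ^ j))}"

definition vinogradov_J :: "nat \<Rightarrow> nat \<Rightarrow> real set \<Rightarrow> nat" where
  "vinogradov_J s k A = card (vinogradov_solutions s k A)"

definition real_diam :: "real set \<Rightarrow> real" where
  "real_diam A = \<bar>Sup A - Inf A\<bar>"

definition well_spaced :: "real set \<Rightarrow> bool" where
  "well_spaced A \<longleftrightarrow> finite A \<and>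
     (\<forall>j::int. Inf A - 1 \<le> of_int j \<and> of_int j \<le> Sup A \<longrightarrow>
        card (A \<inter> {of_int j <.. of_int j + 1}) \<le> 1)"

(* A vector of R^k is represented by a function on nat that vanishes outside the
   coordinates 1..k; addition of vectors is pointwise addition of functions. *)
definition moment_point :: "nat \<Rightarrow> real \<Rightarrow> (nat \<Rightarrow> real)" where
  "moment_point k a = (\<lambda>j. if j \<in> {1..k} then a ^ j else 0)"

definition fold_sumset :: "nat \<Rightarrow> 'a::comm_monoid_add set \<Rightarrow> 'a set" where
  "fold_sumset l B = {(\<Sum>i=1..l. b i) | b. \<forall>i\<in>{1..l}. b i \<in> B}"

end

theory Submission
  imports Defs
begin

text \<open>
  Write \<open>d = k (k + 1) / 2\<close>. Since \<open>s \<ge> 2 d\<close> and \<open>\<alpha>\<close> is close to \<open>1\<close>, the sums of \<open>d\<close> points of the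
  curve have almost maximal additive energy, up to a translation obtained by fixing the other
  \<open>s - 2 d\<close> pairs of variables; the bound \<open>J\<^sub>d(A) \<le> |A|\<^bsup>d + \<delta>\<^esup>\<close> says that these sums have few
  representations on average. A Balog-Szemeredi-Gowers argument gives dense families of \<open>d\<close>-tuples
  whose sums have small sumset, Petridis' form of the Pluennecke inequality controls the iterated
  sumsets, and fixing \<open>d - 1\<close> of the \<open>d\<close> coordinates yields \<open>A'\<close>.

  The bound for \<open>J\<^sub>d(A)\<close> is \<open>\<ell>\<^sup>2\<close>-decoupling for the moment curve, proved along the lines of Guo, Li, Yung
  and Zorin-Kranich. All integrals are finite sums: after simultaneous Diophantine
  approximation the characters live on \<open>\<int>/N\<close>. The statement is proved for all curves whose
  derivative is \<open>w(u) (1, u, \<dots>, u\<^bsup>k - 1\<^esup>)\<close> with a weight \<open>w\<close> bounded above and below, and for all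
  measures whose Fourier coefficients vanish outside a small neighbourhood of the origin. This class
  is closed under rescaling and under multiplying the measure by a power of the exponential sum over
  a distant interval, which lowers the degree.
\<close>

section \<open>Inequalities for weighted finite sums\<close>

text \<open>A single dyadic scale 2^n above the diameter is needed, and it may be as large as |A|^m;
  decoupling loses 2^(\<eta> n), so \<eta> has to be small in terms of \<delta> and m, and the
  threshold for |A| depends on m. The improvement of \<eta> comes from moments over two distant
  intervals of lengths 2^-a and 2^-b. Interpolation and decoupling of lower degree trade b for a
  finer scale of at most k b; the total gain over all degrees l grows by a fixed amount each round,
  so after boundedly many rounds some gain outweighs the cost 2^(3b) of returning to intervals of
  length 1/4. Every drop in degree changes the constants of the system from c and K to c / 4^k and K
  + k (k + 1), which is why the induction on k is over all c and K. The origin of 43200: with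
  \<delta> = \<epsilon> d / 21600, both 1 / \<alpha> and the excess factor \<rho> of J_d(A) over
  |A|^d are at most |A|^\<delta>. They enter the sumset constant to the twelfth power, its numerical
  part is allowed as much again, and the resulting exponent 48 \<delta> = \<epsilon> d / 450 is well
  below the tolerated \<epsilon> d.\<close>

text \<open>Hoelder's inequality with exponents q / (q - 1) and q, cleared of roots:
  \<open>z\<close> is the geometric mean of q - 1 copies of \<open>X\<close> and one of
  \<open>Y\<close>, given by an equation so that all powers stay natural.\<close>

lemma Holder_sum_power:
  fixes \<nu> X Y z :: "'a \<Rightarrow> real"
  assumes "finite A" and "q \<ge> 1"
    and nonneg: "\<And>a. a \<in> A \<Longrightarrow> \<nu> a \<ge> 0 \<and> X a \<ge> 0 \<and> Y a \<ge> 0 \<and> z a \<ge> 0"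
    and eq: "\<And>a. a \<in> A \<Longrightarrow> z a ^ q = X a ^ (q - 1) * Y a"
  shows "(\<Sum>a\<in>A. \<nu> a * z a) ^ q \<le> (\<Sum>a\<in>A. \<nu> a * X a) ^ (q - 1) * (\<Sum>a\<in>A. \<nu> a * Y a)"
proof -
  define SX where "SX = (\<Sum>a\<in>A. \<nu> a * X a)"
  define SY where "SY = (\<Sum>a\<in>A. \<nu> a * Y a)"
  have SX0: "SX \<ge> 0" and SY0: "SY \<ge> 0"
    unfolding SX_def SY_def using nonneg by (auto intro!: sum_nonneg)
  consider "q = 1" | "SX = 0" "q > 1" | "SY = 0" "q > 1" | "SX > 0" "SY > 0" "q > 1"
    using SX0 SY0 assms(2) by linarith
  then have "(\<Sum>a\<in>A. \<nu> a * z a) ^ q \<le> SX ^ (q - 1) * SY"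
  proof cases
    case 1
    then show ?thesis using eq unfolding SY_def by simp
  next
    case 2
    have "\<nu> a * z a = 0" if "a \<in> A" for a
    proof -
      have "\<nu> a * X a = 0"
        using 2 that nonneg assms(1) unfolding SX_def by (subst (asm) sum_nonneg_eq_0_iff) auto
      then show ?thesis using eq[OF that] 2 by (auto simp: power_0_left split: if_splits)
    qed
    then have "(\<Sum>a\<in>A. \<nu> a * z a) = 0" by (intro sum.neutral) blast
    then show ?thesis using 2 SX0 SY0 assms(2) by (simp add: power_0_left)
  next
    case 3
    have "\<nu> a * z a = 0" if "a \<in> A" for a
    proof -
      have "\<nu> a * Y a = 0"
        using 3 that nonneg assms(1) unfolding SY_def by (subst (asm) sum_nonneg_eq_0_iff) auto
      then show ?thesis using eq[OF that] 3 by auto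
    qed
    then have "(\<Sum>a\<in>A. \<nu> a * z a) = 0" by (intro sum.neutral) blast
    then show ?thesis using 3 SX0 assms(2) by (simp add: power_0_left)
  next
    case 4
    define \<tau> where "\<tau> = root q (SX ^ (q - 1) * SY)"
    have \<tau>q: "\<tau> ^ q = SX ^ (q - 1) * SY" and \<tau>0: "\<tau> > 0"
      unfolding \<tau>_def using 4 by (auto simp: real_root_pow_pos2)
    have pt: "real q * (z a / \<tau>) \<le> real (q - 1) * (X a / SX) + Y a / SY" if a: "a \<in> A" for a
    proof (cases "X a = 0")
      case True
      then have "z a = 0" using eq[OF a] 4 by (simp add: power_0_left)
      then show ?thesis using True nonneg[OF a] 4 by simp
    next
      case False
      define u where "u = X a / SX"
      define w where "w = z a / \<tau>"
      have u: "u > 0" unfolding u_def using False nonneg[OF a] 4 by simp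
      have w: "w \<ge> 0" unfolding w_def using nonneg[OF a] \<tau>0 by simp
      have uw: "u ^ (q - 1) * (Y a / SY) = w ^ q"
        unfolding u_def w_def power_divide \<tau>q eq[OF a] by simp
      \<comment> \<open>Bernoulli for (w / u)^q, multiplied by u, is the weighted
        arithmetic-geometric mean inequality q w \<le> (q - 1) u + w^q / u^(q - 1).\<close>
      have "1 + real q * (w / u - 1) \<le> (1 + (w / u - 1)) ^ q"
        by (rule Bernoulli_inequality) (use u w in simp)
      also have "\<dots> = w ^ q / u ^ q" by (simp add: power_divide)
      also have "\<dots> = (Y a / SY) / u"
        using u assms(2) unfolding uw[symmetric] by (cases q) (auto simp: field_simps)
      finally have "1 + real q * (w / u - 1) \<le> (Y a / SY) / u" .
      then have "(1 + real q * (w / u - 1)) * u \<le> (Y a / SY)"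
        unfolding pos_le_divide_eq[OF u] .
      moreover have "(1 + real q * (w / u - 1)) * u = u + real q * (w - u)"
        using u by (simp add: field_simps)
      ultimately have "u + real q * (w - u) \<le> Y a / SY" by simp
      moreover have "real (q - 1) = real q - 1" using 4 by simp
      ultimately show ?thesis unfolding u_def[symmetric] w_def[symmetric]
        by (simp add: algebra_simps)
    qed
    have "real q * ((\<Sum>a\<in>A. \<nu> a * z a) / \<tau>) = (\<Sum>a\<in>A. \<nu> a * (real q * (z a / \<tau>)))"
      by (simp add: sum_divide_distrib sum_distrib_left mult.left_commute)
    also have "\<dots> \<le> (\<Sum>a\<in>A. \<nu> a * (real (q - 1) * (X a / SX) + Y a / SY))"
      using pt nonneg by (intro sum_mono mult_left_mono) auto
    also have "\<dots> = real (q - 1) * (SX / SX) + SY / SY"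
      unfolding SX_def SY_def sum_divide_distrib sum_distrib_left
      by (simp add: sum.distrib distrib_left mult.left_commute)
    also have "\<dots> = real q" using 4 by simp
    finally have "real q * ((\<Sum>a\<in>A. \<nu> a * z a) / \<tau>) \<le> real q * 1" by simp
    then have "(\<Sum>a\<in>A. \<nu> a * z a) / \<tau> \<le> 1"
      by (rule mult_left_le_imp_le) (use 4 in simp)
    then have "(\<Sum>a\<in>A. \<nu> a * z a) \<le> \<tau>" using \<tau>0 by simp
    moreover have "(\<Sum>a\<in>A. \<nu> a * z a) \<ge> 0" using nonneg by (intro sum_nonneg) auto
    ultimately show ?thesis unfolding \<tau>q[symmetric] by (intro power_mono)
  qed
  then show ?thesis unfolding SX_def SY_def .
qed

text \<open>Minkowski's inequality with \<open>b\<close> and \<open>c\<close> in the role of the two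
  norms. Dividing f by b and g by c reduces it to convexity of t^d at the weights b / (b + c) and c
  / (b + c); a vanishing norm forces its function to vanish wherever the measure is positive and is
  treated apart.\<close>

lemma Minkowski_two_power:
  fixes \<nu> f g :: "'a \<Rightarrow> real"
  assumes "finite A" and d: "d \<ge> 1"
    and nonneg: "\<And>a. a \<in> A \<Longrightarrow> \<nu> a \<ge> 0 \<and> f a \<ge> 0 \<and> g a \<ge> 0"
    and "b \<ge> 0" "c \<ge> 0"
    and f: "(\<Sum>a\<in>A. \<nu> a * f a ^ d) \<le> b ^ d" and g: "(\<Sum>a\<in>A. \<nu> a * g a ^ d) \<le> c ^ d"
  shows "(\<Sum>a\<in>A. \<nu> a * (f a + g a) ^ d) \<le> (b + c) ^ d"
proof -
  have zero: "\<nu> a = 0 \<or> h a = 0" if "(\<Sum>a\<in>A. \<nu> a * h a ^ d) \<le> 0" "a \<in> A"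
    "\<And>a. a \<in> A \<Longrightarrow> h a \<ge> 0" for a and h :: "'a \<Rightarrow> real"
  proof -
    have "(\<Sum>a\<in>A. \<nu> a * h a ^ d) = 0"
      using that nonneg by (intro antisym sum_nonneg) auto
    then have "\<nu> a * h a ^ d = 0"
      using that nonneg assms(1) by (subst (asm) sum_nonneg_eq_0_iff) auto
    then show ?thesis by auto
  qed
  consider "b = 0" | "c = 0" | "b > 0" "c > 0" using assms by linarith
  then show ?thesis
  proof cases
    case 1
    have "(\<Sum>a\<in>A. \<nu> a * (f a + g a) ^ d) = (\<Sum>a\<in>A. \<nu> a * g a ^ d)"
    proof (intro sum.cong refl)
      fix a assume a: "a \<in> A"
      have "\<nu> a = 0 \<or> f a = 0" using zero[of f] f 1 d nonneg a by (simp add: power_0_left)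
      then show "\<nu> a * (f a + g a) ^ d = \<nu> a * g a ^ d" by auto
    qed
    then show ?thesis using g 1 by simp
  next
    case 2
    have "(\<Sum>a\<in>A. \<nu> a * (f a + g a) ^ d) = (\<Sum>a\<in>A. \<nu> a * f a ^ d)"
    proof (intro sum.cong refl)
      fix a assume a: "a \<in> A"
      have "\<nu> a = 0 \<or> g a = 0" using zero[of g] g 2 d nonneg a by (simp add: power_0_left)
      then show "\<nu> a * (f a + g a) ^ d = \<nu> a * f a ^ d" by auto
    qed
    then show ?thesis using f 2 by simp
  next
    case 3
    define s where "s = b + c"
    have s: "s > 0" unfolding s_def using 3 by simp
    have pt: "(f a + g a) ^ d \<le> s ^ d * ((b / s) * (f a / b) ^ d + (c / s) * (g a / c) ^ d)"
      if a: "a \<in> A" for a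
    proof -
      have "((b / s) * (f a / b) + (c / s) * (g a / c)) ^ d
          \<le> (b / s) * (f a / b) ^ d + (c / s) * (g a / c) ^ d"
      proof -
        have cv: "convex_on {0::real..} (\<lambda>x. x ^ d)"
          using convex_on_subset[OF convex_power_even subset_UNIV] convex_power_odd
          by (cases "even d") auto
        have "b / s + c / s = (b + c) / s" by (simp add: add_divide_distrib)
        then have "b / s + c / s = 1" using s unfolding s_def by simp
        then show ?thesis
          using cv 3 s nonneg[OF a] unfolding convex_on_def real_scaleR_def
          by (meson atLeast_iff divide_nonneg_nonneg less_imp_le)
      qed
      moreover have eq: "(b / s) * (f a / b) + (c / s) * (g a / c) = (f a + g a) / s"
        using 3 s by (simp add: add_divide_distrib)
      ultimately have "((f a + g a) / s) ^ d \<le> (b / s) * (f a / b) ^ d + (c / s) * (g a / c) ^ d"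
        by (simp only: eq)
      then have "s ^ d * ((f a + g a) / s) ^ d \<le> s ^ d * ((b / s) * (f a / b) ^ d + (c / s) * (g a / c) ^ d)"
        using s by (intro mult_left_mono) auto
      then show ?thesis using s by (simp add: power_divide)
    qed
    have "(\<Sum>a\<in>A. \<nu> a * (f a + g a) ^ d)
        \<le> (\<Sum>a\<in>A. \<nu> a * (s ^ d * ((b / s) * (f a / b) ^ d + (c / s) * (g a / c) ^ d)))"
      using pt nonneg by (intro sum_mono mult_left_mono) auto
    also have "\<dots> = s ^ d * ((b / s) * ((\<Sum>a\<in>A. \<nu> a * f a ^ d) / b ^ d)
        + (c / s) * ((\<Sum>a\<in>A. \<nu> a * g a ^ d) / c ^ d))"
      unfolding sum_divide_distrib sum_distrib_left sum.distrib[symmetric] power_divide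
      by (intro sum.cong refl) (simp add: algebra_simps)
    also have "\<dots> \<le> s ^ d * ((b / s) * 1 + (c / s) * 1)"
      using 3 s f g by (intro mult_left_mono add_mono) (auto simp: divide_le_eq_1)
    also have "\<dots> = s ^ d * ((b + c) / s)" by (simp add: add_divide_distrib)
    also have "\<dots> = s ^ d" using s unfolding s_def by simp
    finally show ?thesis unfolding s_def .
  qed
qed

lemma Minkowski_sum_power:
  fixes \<nu> :: "'a \<Rightarrow> real" and g :: "'i \<Rightarrow> 'a \<Rightarrow> complex"
  assumes "finite A" and d: "d \<ge> 1" and \<nu>: "\<And>a. a \<in> A \<Longrightarrow> \<nu> a \<ge> 0" and "finite I"
    and b: "\<And>i. i \<in> I \<Longrightarrow> b i \<ge> 0 \<and> (\<Sum>a\<in>A. \<nu> a * cmod (g i a) ^ d) \<le> b i ^ d"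
  shows "(\<Sum>a\<in>A. \<nu> a * cmod (\<Sum>i\<in>I. g i a) ^ d) \<le> (\<Sum>i\<in>I. b i) ^ d"
  using \<open>finite I\<close> b
proof (induction I rule: finite_induct)
  case empty
  then show ?case using d by (simp add: power_0_left)
next
  case (insert i I)
  have "(\<Sum>a\<in>A. \<nu> a * cmod (\<Sum>i\<in>insert i I. g i a) ^ d)
      \<le> (\<Sum>a\<in>A. \<nu> a * (cmod (g i a) + cmod (\<Sum>i\<in>I. g i a)) ^ d)"
    using insert \<nu> by (intro sum_mono mult_left_mono power_mono) (auto intro: norm_triangle_ineq)
  also have "\<dots> \<le> (b i + (\<Sum>i\<in>I. b i)) ^ d"
    using insert \<nu> assms(1) d by (intro Minkowski_two_power) (auto intro!: sum_nonneg)
  finally show ?case using insert by simp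
qed

section \<open>Exponential sums along weighted moment curves\<close>

text \<open>This is 1 + ... + k, the homogeneous dimension of the moment curve; twice this number is
  the critical exponent of its decoupling inequality.\<close>

definition moment_degree :: "nat \<Rightarrow> nat" where
  "moment_degree k = k * (k + 1) div 2"

definition moment :: "'w set \<Rightarrow> ('w \<Rightarrow> real) \<Rightarrow> nat \<Rightarrow> ('w \<Rightarrow> complex) \<Rightarrow> real" where
  "moment \<Omega> \<nu> q f = (\<Sum>\<omega>\<in>\<Omega>. \<nu> \<omega> * cmod (f \<omega>) ^ q)"

definition expsum :: "('a \<Rightarrow> 'w \<Rightarrow> complex) \<Rightarrow> 'a set \<Rightarrow> 'w \<Rightarrow> complex" where
  "expsum e S \<omega> = (\<Sum>t\<in>S. e t \<omega>)"

definition cell :: "('a \<Rightarrow> real) \<Rightarrow> 'a set \<Rightarrow> nat \<Rightarrow> int \<Rightarrow> 'a set" where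
  "cell x S n i = {t \<in> S. \<lfloor>2 ^ n * x t\<rfloor> = i}"

text \<open>\<open>moment\<close> with exponent 2d is the 2d-th power of a norm, so its power 1/d is
  the squared norm: this is the square sum on the right of an l^2 decoupling inequality at scale
  2^-n.\<close>

definition sqsum :: "'w set \<Rightarrow> ('w \<Rightarrow> real) \<Rightarrow> ('a \<Rightarrow> real) \<Rightarrow> ('a \<Rightarrow> 'w \<Rightarrow> complex)
    \<Rightarrow> nat \<Rightarrow> nat \<Rightarrow> 'a set \<Rightarrow> real" where
  "sqsum \<Omega> \<nu> x e d n S =
     (\<Sum>i\<in>{0..<2 ^ n}. moment \<Omega> \<nu> (2 * d) (expsum e (cell x S n i)) powr (1 / real d))"

text \<open>
  The function \<open>e t\<close> plays the role of the character at the point of parameter \<open>x t\<close>. For the polynomials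
  \<open>q(u) = \<Prod>(u - \<xi>)\<close> of degree below \<open>k\<close>, the function \<open>\<Phi> \<xi>s\<close> is a primitive of \<open>w q\<close>; a correlation of
  characters may be nonzero only if the corresponding sums of these primitives agree up to
  \<open>K 2\<^bsup>-nk\<^esup>\<close>. Products of linear factors with roots in the unit interval are used instead of powers
  of \<open>u\<close> because affine rescaling maps them to themselves with no loss of constants.
\<close>

definition vsystem :: "nat \<Rightarrow> real \<Rightarrow> real \<Rightarrow> nat \<Rightarrow> 'w set \<Rightarrow> ('w \<Rightarrow> real) \<Rightarrow> 'a set
    \<Rightarrow> ('a \<Rightarrow> real) \<Rightarrow> ('a \<Rightarrow> 'w \<Rightarrow> complex) \<Rightarrow> bool" where
  "vsystem k c K n \<Omega> \<nu> S x e \<longleftrightarrow>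
     finite \<Omega> \<and> (\<forall>\<omega>\<in>\<Omega>. \<nu> \<omega> \<ge> 0) \<and> finite S \<and> (\<forall>t\<in>S. 0 \<le> x t \<and> x t < 1) \<and>
     (\<exists>w \<Phi>. (\<forall>u\<in>{0..1::real}. c \<le> w u \<and> w u \<le> 1) \<and>
        (\<forall>\<xi>s. length \<xi>s < k \<and> set \<xi>s \<subseteq> {0..1} \<longrightarrow>
          (\<forall>u\<in>{0..1}. (\<Phi> \<xi>s has_real_derivative (w u * (\<Prod>\<xi>\<leftarrow>\<xi>s. u - \<xi>))) (at u))) \<and>
        (\<forall>ts ts' \<xi>s. length ts = length ts' \<and> length ts \<le> moment_degree k \<and>
            set ts \<subseteq> S \<and> set ts' \<subseteq> S \<and> length \<xi>s < k \<and> set \<xi>s \<subseteq> {0..1} \<and>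
            (\<Sum>\<omega>\<in>\<Omega>. complex_of_real (\<nu> \<omega>) * ((\<Prod>t\<leftarrow>ts. e t \<omega>) * cnj (\<Prod>t\<leftarrow>ts'. e t \<omega>))) \<noteq> 0
          \<longrightarrow> \<bar>(\<Sum>t\<leftarrow>ts. \<Phi> \<xi>s (x t)) - (\<Sum>t\<leftarrow>ts'. \<Phi> \<xi>s (x t))\<bar> \<le> K * (1 / 2) ^ (n * k)))"

text \<open>\<open>B\<close> is the square of the usual decoupling constant, the inequality between
  squared norms being raised to the power \<open>moment_degree k\<close>. A definition cannot
  quantify over types, so the carriers are fixed as sets of naturals and of reals; reweighting the
  measure and restricting the index set stay within them.\<close>

definition decoupling :: "nat \<Rightarrow> real \<Rightarrow> real \<Rightarrow> nat \<Rightarrow> real \<Rightarrow> bool" where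
  "decoupling k c K n B \<longleftrightarrow>
     (\<forall>\<Omega> \<nu> S x e. vsystem k c K n (\<Omega> :: nat set) \<nu> (S :: real set) x e \<longrightarrow>
        moment \<Omega> \<nu> (2 * moment_degree k) (expsum e S)
          \<le> (B * sqsum \<Omega> \<nu> x e (moment_degree k) n S) ^ moment_degree k)"

lemma moment_nonneg: "(\<And>\<omega>. \<omega> \<in> \<Omega> \<Longrightarrow> \<nu> \<omega> \<ge> 0) \<Longrightarrow> moment \<Omega> \<nu> q f \<ge> 0"
  unfolding moment_def by (auto intro!: sum_nonneg)

lemma sqsum_nonneg: "sqsum \<Omega> \<nu> x e d n S \<ge> 0"
  unfolding sqsum_def by (auto intro!: sum_nonneg)

lemma moment_degree_pos: "k \<ge> 1 \<Longrightarrow> moment_degree k \<ge> 1"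
  unfolding moment_degree_def by (cases k) auto

lemma moment_degree_double: "2 * moment_degree k = k * (k + 1)"
  unfolding moment_degree_def by simp

lemma moment_degree_mono: "l \<le> k \<Longrightarrow> moment_degree l \<le> moment_degree k"
  unfolding moment_degree_def by (intro div_le_mono mult_le_mono) auto

section \<open>Dyadic cells\<close>

lemma floor_power2_mult:
  assumes "a \<le> n"
  shows "\<lfloor>2 ^ a * (y::real)\<rfloor> = \<lfloor>2 ^ n * y\<rfloor> div 2 ^ (n - a)"
proof -
  have "2 ^ a * y = (2 ^ n * y) / real_of_int (2 ^ (n - a))"
    using assms by (simp add: power_diff[of "2::real"] field_simps)
  then show ?thesis using floor_divide_real_eq_div[of "2 ^ (n - a)" "2 ^ n * y"] by simp
qed

lemma cell_subset: "cell x S n i \<subseteq> S"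
  unfolding cell_def by auto

lemma cell_cell:
  assumes "a \<le> n"
  shows "cell x (cell x S a i) n j = (if j div 2 ^ (n - a) = i then cell x S n j else {})"
  unfolding cell_def using floor_power2_mult[OF assms] by auto

lemma floor_power2_range:
  assumes "0 \<le> (y::real)" "y < 1"
  shows "\<lfloor>2 ^ n * y\<rfloor> \<in> {0..<2 ^ n}"
proof -
  have "2 ^ n * y < 2 ^ n" using assms by simp
  then have "2 ^ n * y < real_of_int (2 ^ n)" by simp
  then have "\<lfloor>2 ^ n * y\<rfloor> < 2 ^ n" by (simp only: floor_less_iff)
  then show ?thesis using assms by simp
qed

lemma expsum_cells:
  assumes "finite S" "\<And>t. t \<in> S \<Longrightarrow> 0 \<le> x t \<and> x t < 1"
  shows "expsum e S \<omega> = (\<Sum>i\<in>{0..<2 ^ n}. expsum e (cell x S n i) \<omega>)"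
proof -
  have "(\<Sum>i\<in>{0..<2 ^ n}. sum (\<lambda>t. e t \<omega>) {t \<in> S. \<lfloor>2 ^ n * x t\<rfloor> = i}) = sum (\<lambda>t. e t \<omega>) S"
    by (rule sum.group) (use assms floor_power2_range in \<open>auto simp: image_subset_iff\<close>)
  then show ?thesis unfolding expsum_def cell_def by simp
qed

lemma expsum_empty [simp]: "expsum e {} = (\<lambda>_. 0)"
  unfolding expsum_def by simp

lemma moment_zero [simp]: "q > 0 \<Longrightarrow> moment \<Omega> \<nu> q (\<lambda>_. 0) = 0"
  unfolding moment_def by (simp add: power_0_left)

lemma int_div_less_bound: "(j::int) < a * b \<Longrightarrow> 0 < b \<Longrightarrow> j div b < a"
  by (smt (verit) nonzero_mult_div_cancel_right zdiv_mono1 mult_le_cancel_right1 pos_imp_zdiv_neg_iff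
    div_mult_mod_eq pos_mod_sign mult_right_mono)

text \<open>Each fine cell lies in exactly one coarse cell, so square sums are additive. This is
  what lets local estimates be summed without loss.\<close>

lemma sqsum_cells:
  assumes "a \<le> n" "d \<ge> 1"
  shows "sqsum \<Omega> \<nu> x e d n S = (\<Sum>i\<in>{0..<2 ^ a}. sqsum \<Omega> \<nu> x e d n (cell x S a i))"
proof -
  define h where "h j = moment \<Omega> \<nu> (2 * d) (expsum e (cell x S n j)) powr (1 / real d)" for j
  have 1: "moment \<Omega> \<nu> (2 * d) (expsum e (cell x (cell x S a i) n j)) powr (1 / real d)
      = (if j div 2 ^ (n - a) = i then h j else 0)" for i j
    unfolding h_def cell_cell[OF assms(1)] using assms(2) by auto
  have r: "j div 2 ^ (n - a) \<in> {0..<2 ^ a}" if "j \<in> {0..<2 ^ n}" for j :: int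
  proof -
    have "(2::int) ^ n = 2 ^ a * 2 ^ (n - a)" using assms(1) by (simp flip: power_add)
    then have "j div 2 ^ (n - a) < 2 ^ a" using that by (intro int_div_less_bound) auto
    then show ?thesis using that by (simp add: pos_imp_zdiv_nonneg_iff)
  qed
  have "(\<Sum>i\<in>{0..<2 ^ a}. sqsum \<Omega> \<nu> x e d n (cell x S a i))
      = (\<Sum>i\<in>{0..<2 ^ a}. \<Sum>j\<in>{0..<2 ^ n}. if j div 2 ^ (n - a) = i then h j else 0)"
    unfolding sqsum_def 1 ..
  also have "\<dots> = (\<Sum>j\<in>{0..<2 ^ n}. \<Sum>i\<in>{0..<2 ^ a}. if j div 2 ^ (n - a) = i then h j else 0)"
    by (rule sum.swap)
  also have "\<dots> = (\<Sum>j\<in>{0..<2 ^ n}. h j)"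
    using r by (intro sum.cong refl) (simp add: sum.delta')
  finally show ?thesis unfolding sqsum_def h_def by simp
qed

lemma vsystemE:
  assumes "vsystem k c K n \<Omega> \<nu> S x e"
  obtains w \<Phi> where "finite \<Omega>" "\<And>\<omega>. \<omega> \<in> \<Omega> \<Longrightarrow> \<nu> \<omega> \<ge> 0" "finite S"
    "\<And>t. t \<in> S \<Longrightarrow> 0 \<le> x t \<and> x t < 1"
    "\<And>u. u \<in> {0..1::real} \<Longrightarrow> c \<le> w u \<and> w u \<le> 1"
    "\<And>\<xi>s u. length \<xi>s < k \<Longrightarrow> set \<xi>s \<subseteq> {0..1} \<Longrightarrow> u \<in> {0..1} \<Longrightarrow>
          (\<Phi> \<xi>s has_real_derivative (w u * (\<Prod>\<xi>\<leftarrow>\<xi>s. u - \<xi>))) (at u)"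
    "\<And>ts ts' \<xi>s. length ts = length ts' \<Longrightarrow> length ts \<le> moment_degree k \<Longrightarrow>
            set ts \<subseteq> S \<Longrightarrow> set ts' \<subseteq> S \<Longrightarrow> length \<xi>s < k \<Longrightarrow> set \<xi>s \<subseteq> {0..1} \<Longrightarrow>
            (\<Sum>\<omega>\<in>\<Omega>. complex_of_real (\<nu> \<omega>) * ((\<Prod>t\<leftarrow>ts. e t \<omega>) * cnj (\<Prod>t\<leftarrow>ts'. e t \<omega>))) \<noteq> 0
          \<Longrightarrow> \<bar>(\<Sum>t\<leftarrow>ts. \<Phi> \<xi>s (x t)) - (\<Sum>t\<leftarrow>ts'. \<Phi> \<xi>s (x t))\<bar> \<le> K * (1 / 2) ^ (n * k)"
  using assms unfolding vsystem_def
  apply (elim conjE exE)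
  subgoal premises prems for w \<Phi>
    using prems(2-) by (intro prems(1)[of w \<Phi>]) simp_all
  done

lemma vsystemI:
  assumes "finite \<Omega>" "\<And>\<omega>. \<omega> \<in> \<Omega> \<Longrightarrow> \<nu> \<omega> \<ge> 0" "finite S"
    "\<And>t. t \<in> S \<Longrightarrow> 0 \<le> x t \<and> x t < 1"
    "\<And>u. u \<in> {0..1::real} \<Longrightarrow> c \<le> w u \<and> w u \<le> 1"
    "\<And>\<xi>s u. length \<xi>s < k \<Longrightarrow> set \<xi>s \<subseteq> {0..1} \<Longrightarrow> u \<in> {0..1} \<Longrightarrow>
          (\<Phi> \<xi>s has_real_derivative (w u * (\<Prod>\<xi>\<leftarrow>\<xi>s. u - \<xi>))) (at u)"
    "\<And>ts ts' \<xi>s. length ts = length ts' \<Longrightarrow> length ts \<le> moment_degree k \<Longrightarrow>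
            set ts \<subseteq> S \<Longrightarrow> set ts' \<subseteq> S \<Longrightarrow> length \<xi>s < k \<Longrightarrow> set \<xi>s \<subseteq> {0..1} \<Longrightarrow>
            (\<Sum>\<omega>\<in>\<Omega>. complex_of_real (\<nu> \<omega>) * ((\<Prod>t\<leftarrow>ts. e t \<omega>) * cnj (\<Prod>t\<leftarrow>ts'. e t \<omega>))) \<noteq> 0
          \<Longrightarrow> \<bar>(\<Sum>t\<leftarrow>ts. \<Phi> \<xi>s (x t)) - (\<Sum>t\<leftarrow>ts'. \<Phi> \<xi>s (x t))\<bar> \<le> K * (1 / 2) ^ (n * k)"
  shows "vsystem k c K n \<Omega> \<nu> S x e"
  unfolding vsystem_def using assms
  by (intro conjI exI[of _ w] exI[of _ \<Phi>]) simp_all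

section \<open>Affine rescaling\<close>

lemma prod_list_shift_scale:
  "(\<Prod>\<eta>\<leftarrow>\<eta>s. (u + r) / 2 ^ a - (\<eta> + r) / 2 ^ a) = (\<Prod>\<eta>\<leftarrow>\<eta>s. u - \<eta>) / (2::real) ^ (a * length \<eta>s)"
  by (induction \<eta>s) (auto simp: power_add field_simps)

text \<open>The factor \<open>2 ^ (a * (length \<eta>s + 1))\<close> undoes one power of 2^-a for
  every linear factor and one more from the chain rule.\<close>

lemma rescaled_primitive:
  fixes \<Psi> :: "real \<Rightarrow> real"
  assumes "(\<Psi> has_real_derivative v * (\<Prod>\<eta>\<leftarrow>\<eta>s. (u + r) / 2 ^ a - (\<eta> + r) / 2 ^ a)) (at ((u + r) / 2 ^ a))"
  shows "((\<lambda>u. 2 ^ (a * (length \<eta>s + 1)) * \<Psi> ((u + r) / 2 ^ a)) has_real_derivative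
    v * (\<Prod>\<eta>\<leftarrow>\<eta>s. u - \<eta>)) (at u)"
proof -
  have 1: "((\<lambda>u. (u + r) / 2 ^ a) has_real_derivative 1 / 2 ^ a) (at u)"
    by (auto intro!: derivative_eq_intros)
  have "((\<lambda>u. 2 ^ (a * (length \<eta>s + 1)) * \<Psi> ((u + r) / 2 ^ a)) has_real_derivative
    2 ^ (a * (length \<eta>s + 1)) * ((v * (\<Prod>\<eta>\<leftarrow>\<eta>s. (u + r) / 2 ^ a - (\<eta> + r) / 2 ^ a)) * (1 / 2 ^ a))) (at u)"
    by (intro DERIV_cmult DERIV_chain2[OF assms 1])
  moreover have "2 ^ (a * (length \<eta>s + 1)) * ((v * (\<Prod>\<eta>\<leftarrow>\<eta>s. (u + r) / 2 ^ a - (\<eta> + r) / 2 ^ a)) * (1 / 2 ^ a))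
      = v * (\<Prod>\<eta>\<leftarrow>\<eta>s. u - \<eta>)"
    unfolding prod_list_shift_scale by (simp add: power_add)
  ultimately show ?thesis by simp
qed

lemma rescale_unit_interval:
  assumes "0 \<le> r" "r + 1 \<le> (2::real) ^ a" "u \<in> {0..1}"
  shows "(u + r) / 2 ^ a \<in> {0..1}"
  using assms by (auto simp: divide_le_eq_1)

text \<open>Stretching an interval of length 2^-a to unit length multiplies a primitive by at most
  2^(ak), since fewer than k roots occur; this is exactly the ratio of the tolerances at n - a and
  n, so \<open>c\<close> and \<open>K\<close> survive unchanged. The endpoint \<open>r\<close> is
  real because half-integral values are needed for pairs of adjacent dyadic intervals.\<close>

lemma vsystem_rescale:
  assumes sys: "vsystem k c K n \<Omega> \<nu> S x e" and an: "a \<le> n"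
    and r: "0 \<le> r" "r + 1 \<le> 2 ^ a" and S': "S' \<subseteq> S"
    and x: "\<And>t. t \<in> S' \<Longrightarrow> r \<le> 2 ^ a * x t \<and> 2 ^ a * x t < r + 1" and K: "K \<ge> 0"
  shows "vsystem k c K (n - a) \<Omega> \<nu> S' (\<lambda>t. 2 ^ a * x t - r) e"
proof (rule vsystemE[OF sys])
  fix w :: "real \<Rightarrow> real" and \<Phi> :: "real list \<Rightarrow> real \<Rightarrow> real"
  assume fin: "finite \<Omega>" "\<And>\<omega>. \<omega> \<in> \<Omega> \<Longrightarrow> \<nu> \<omega> \<ge> 0" "finite S"
    and x01: "\<And>t. t \<in> S \<Longrightarrow> 0 \<le> x t \<and> x t < 1"
    and w: "\<And>u. u \<in> {0..1::real} \<Longrightarrow> c \<le> w u \<and> w u \<le> 1"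
    and \<Phi>: "\<And>\<xi>s u. length \<xi>s < k \<Longrightarrow> set \<xi>s \<subseteq> {0..1} \<Longrightarrow> u \<in> {0..1} \<Longrightarrow>
          (\<Phi> \<xi>s has_real_derivative (w u * (\<Prod>\<xi>\<leftarrow>\<xi>s. u - \<xi>))) (at u)"
    and orth: "\<And>ts ts' \<xi>s. length ts = length ts' \<Longrightarrow> length ts \<le> moment_degree k \<Longrightarrow>
            set ts \<subseteq> S \<Longrightarrow> set ts' \<subseteq> S \<Longrightarrow> length \<xi>s < k \<Longrightarrow> set \<xi>s \<subseteq> {0..1} \<Longrightarrow>
            (\<Sum>\<omega>\<in>\<Omega>. complex_of_real (\<nu> \<omega>) * ((\<Prod>t\<leftarrow>ts. e t \<omega>) * cnj (\<Prod>t\<leftarrow>ts'. e t \<omega>))) \<noteq> 0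
          \<Longrightarrow> \<bar>(\<Sum>t\<leftarrow>ts. \<Phi> \<xi>s (x t)) - (\<Sum>t\<leftarrow>ts'. \<Phi> \<xi>s (x t))\<bar> \<le> K * (1 / 2) ^ (n * k)"
  note unit = rescale_unit_interval[OF r]
  let ?m = "\<lambda>\<eta>s. map (\<lambda>\<eta>. (\<eta> + r) / 2 ^ a) \<eta>s"
  define \<Phi>' where "\<Phi>' \<eta>s u = 2 ^ (a * (length \<eta>s + 1)) * \<Phi> (?m \<eta>s) ((u + r) / 2 ^ a)" for \<eta>s u
  have m: "set (?m \<eta>s) \<subseteq> {0..1}" if "set \<eta>s \<subseteq> {0..1}" for \<eta>s
    using that unit by auto
  have "(\<Phi>' \<eta>s has_real_derivative w ((u + r) / 2 ^ a) * (\<Prod>\<eta>\<leftarrow>\<eta>s. u - \<eta>)) (at u)"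
    if "length \<eta>s < k" "set \<eta>s \<subseteq> {0..1}" "u \<in> {0..1}" for \<eta>s u
    unfolding \<Phi>'_def
    by (rule rescaled_primitive)
       (use \<Phi>[of "?m \<eta>s" "(u + r) / 2 ^ a"] that m unit in \<open>simp add: o_def\<close>)
  moreover have "\<bar>(\<Sum>t\<leftarrow>ts. \<Phi>' \<eta>s (2 ^ a * x t - r)) - (\<Sum>t\<leftarrow>ts'. \<Phi>' \<eta>s (2 ^ a * x t - r))\<bar>
      \<le> K * (1 / 2) ^ ((n - a) * k)"
    if "length ts = length ts'" "length ts \<le> moment_degree k" "set ts \<subseteq> S'" "set ts' \<subseteq> S'"
      "length \<eta>s < k" "set \<eta>s \<subseteq> {0..1}"
      "(\<Sum>\<omega>\<in>\<Omega>. complex_of_real (\<nu> \<omega>) * ((\<Prod>t\<leftarrow>ts. e t \<omega>) * cnj (\<Prod>t\<leftarrow>ts'. e t \<omega>))) \<noteq> 0"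
    for ts ts' \<eta>s
  proof -
    have "\<bar>(\<Sum>t\<leftarrow>ts. \<Phi> (?m \<eta>s) (x t)) - (\<Sum>t\<leftarrow>ts'. \<Phi> (?m \<eta>s) (x t))\<bar> \<le> K * (1 / 2) ^ (n * k)"
      using that S' m by (intro orth) auto
    then have "2 ^ (a * (length \<eta>s + 1)) * \<bar>(\<Sum>t\<leftarrow>ts. \<Phi> (?m \<eta>s) (x t)) - (\<Sum>t\<leftarrow>ts'. \<Phi> (?m \<eta>s) (x t))\<bar>
        \<le> 2 ^ (a * k) * (K * (1 / 2) ^ (n * k))"
      using that(5) K by (intro mult_mono power_increasing mult_le_mono) auto
    also have "n * k = (n - a) * k + a * k" using an by (simp flip: add_mult_distrib)
    then have "2 ^ (a * k) * (K * (1 / 2) ^ (n * k)) = K * (1 / 2) ^ ((n - a) * k)"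
      by (simp add: power_add field_simps)
    finally show ?thesis unfolding \<Phi>'_def sum_list_const_mult
      by (simp flip: right_diff_distrib add: abs_mult)
  qed
  moreover have "c \<le> w ((u + r) / 2 ^ a) \<and> w ((u + r) / 2 ^ a) \<le> 1" if "u \<in> {0..1}" for u
    using w unit that by blast
  moreover have "finite S'" using S' fin finite_subset by blast
  moreover have "0 \<le> 2 ^ a * x t - r \<and> 2 ^ a * x t - r < 1" if "t \<in> S'" for t
    using x[OF that] by simp
  ultimately show ?thesis using fin
    by (intro vsystemI[where w = "\<lambda>u. w ((u + r) / 2 ^ a)" and \<Phi> = \<Phi>']) simp_all
qed

section \<open>Lowering the degree by a weighted measure\<close>

text \<open>Expanding the power of the modulus into m characters and m conjugate characters traces a
  nonzero correlation under the new measure back to a nonzero correlation of longer tuples under the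
  old one. The induction peels off one pair at a time.\<close>

lemma weighted_correlation_nonzero:
  assumes "finite S"
  shows "(\<Sum>\<omega>\<in>\<Omega>. complex_of_real (\<nu> \<omega> * cmod (expsum e S \<omega>) ^ (2 * m))
        * ((\<Prod>t\<leftarrow>ts. e t \<omega>) * cnj (\<Prod>t\<leftarrow>ts'. e t \<omega>))) \<noteq> 0 \<Longrightarrow>
    \<exists>ys ys'. length ys = m \<and> length ys' = m \<and> set ys \<subseteq> S \<and> set ys' \<subseteq> S \<and>
      (\<Sum>\<omega>\<in>\<Omega>. complex_of_real (\<nu> \<omega>)
        * ((\<Prod>t\<leftarrow>ys @ ts. e t \<omega>) * cnj (\<Prod>t\<leftarrow>ys' @ ts'. e t \<omega>))) \<noteq> 0"
proof (induction m arbitrary: ts ts')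
  case 0
  then show ?case by (intro exI[of _ "[]"]) simp
next
  case (Suc m)
  define P where "P \<omega> = (\<Prod>t\<leftarrow>ts. e t \<omega>)" for \<omega>
  define P' where "P' \<omega> = (\<Prod>t\<leftarrow>ts'. e t \<omega>)" for \<omega>
  define V where "V \<omega> = complex_of_real (\<nu> \<omega> * cmod (expsum e S \<omega>) ^ (2 * m))" for \<omega>
  have eq: "complex_of_real (\<nu> \<omega> * cmod (expsum e S \<omega>) ^ (2 * Suc m)) * (P \<omega> * cnj (P' \<omega>))
      = (\<Sum>y\<in>S. \<Sum>y'\<in>S. V \<omega> * ((e y \<omega> * P \<omega>) * cnj (e y' \<omega> * P' \<omega>)))" for \<omega>
  proof -
    have "complex_of_real (\<nu> \<omega> * cmod (expsum e S \<omega>) ^ (2 * Suc m)) = V \<omega> * complex_of_real (cmod (expsum e S \<omega>) ^ 2)"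
      unfolding V_def by (simp add: power2_eq_square)
    also have "complex_of_real (cmod (expsum e S \<omega>) ^ 2) = expsum e S \<omega> * cnj (expsum e S \<omega>)"
      using complex_norm_square by simp
    also have "\<dots> = (\<Sum>y\<in>S. \<Sum>y'\<in>S. e y \<omega> * cnj (e y' \<omega>))"
      unfolding expsum_def cnj_sum by (rule sum_product)
    finally show ?thesis
      by (simp add: sum_distrib_left sum_distrib_right algebra_simps)
  qed
  have "(\<Sum>y\<in>S. \<Sum>y'\<in>S. \<Sum>\<omega>\<in>\<Omega>. V \<omega> * ((e y \<omega> * P \<omega>) * cnj (e y' \<omega> * P' \<omega>)))
      = (\<Sum>\<omega>\<in>\<Omega>. \<Sum>y\<in>S. \<Sum>y'\<in>S. V \<omega> * ((e y \<omega> * P \<omega>) * cnj (e y' \<omega> * P' \<omega>)))"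
    by (rule trans[OF sum.cong[OF refl sum.swap] sum.swap])
  then have "(\<Sum>y\<in>S. \<Sum>y'\<in>S. \<Sum>\<omega>\<in>\<Omega>. V \<omega> * ((e y \<omega> * P \<omega>) * cnj (e y' \<omega> * P' \<omega>))) \<noteq> 0"
    using Suc.prems unfolding eq P_def[symmetric] P'_def[symmetric] by simp
  then obtain y where y: "y \<in> S"
    "(\<Sum>y'\<in>S. \<Sum>\<omega>\<in>\<Omega>. V \<omega> * ((e y \<omega> * P \<omega>) * cnj (e y' \<omega> * P' \<omega>))) \<noteq> 0"
    by (rule sum.not_neutral_contains_not_neutral)
  from y(2) obtain y' where y': "y' \<in> S"
    "(\<Sum>\<omega>\<in>\<Omega>. V \<omega> * ((e y \<omega> * P \<omega>) * cnj (e y' \<omega> * P' \<omega>))) \<noteq> 0"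
    by (rule sum.not_neutral_contains_not_neutral)
  have "(\<Sum>\<omega>\<in>\<Omega>. complex_of_real (\<nu> \<omega> * cmod (expsum e S \<omega>) ^ (2 * m))
        * ((\<Prod>t\<leftarrow>y # ts. e t \<omega>) * cnj (\<Prod>t\<leftarrow>y' # ts'. e t \<omega>))) \<noteq> 0"
    using y'(2) unfolding V_def P_def P'_def by simp
  from Suc.IH[OF this] obtain ys ys' where *: "length ys = m" "length ys' = m" "set ys \<subseteq> S" "set ys' \<subseteq> S"
    "(\<Sum>\<omega>\<in>\<Omega>. complex_of_real (\<nu> \<omega>)
        * ((\<Prod>t\<leftarrow>ys @ y # ts. e t \<omega>) * cnj (\<Prod>t\<leftarrow>ys' @ y' # ts'. e t \<omega>))) \<noteq> 0"
    by blast
  show ?case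
    by (rule exI[of _ "ys @ [y]"], rule exI[of _ "ys' @ [y']"]) (use * y y' in auto)
qed

lemma sum_list_dist_const:
  fixes f :: "'a \<Rightarrow> real"
  assumes "\<And>y. y \<in> set ys \<Longrightarrow> \<bar>f y - z\<bar> \<le> B"
  shows "\<bar>(\<Sum>y\<leftarrow>ys. f y) - real (length ys) * z\<bar> \<le> real (length ys) * B"
  using assms
proof (induction ys)
  case (Cons y ys)
  have "\<bar>f y - z\<bar> \<le> B" "\<bar>(\<Sum>y\<leftarrow>ys. f y) - real (length ys) * z\<bar> \<le> real (length ys) * B"
    using Cons by auto
  then show ?case by (simp add: algebra_simps)
qed simp

lemma derivative_bound_diff:
  fixes f :: "real \<Rightarrow> real"
  assumes "a \<le> b" "\<And>u. a \<le> u \<Longrightarrow> u \<le> b \<Longrightarrow> (f has_real_derivative f' u) (at u)"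
    and "\<And>u. a \<le> u \<Longrightarrow> u \<le> b \<Longrightarrow> \<bar>f' u\<bar> \<le> M"
  shows "\<bar>f b - f a\<bar> \<le> M * (b - a)"
proof (cases "a = b")
  case False
  then have "a < b" using assms by simp
  from MVT2[OF this assms(2)] obtain z where "a < z" "z < b" "f b - f a = (b - a) * f' z" by blast
  then show ?thesis using assms(3)[of z] by (simp add: abs_mult mult.commute)
qed simp

lemma prod_list_abs_le_1: "(\<And>y. y \<in> set ys \<Longrightarrow> \<bar>f y\<bar> \<le> (1::real)) \<Longrightarrow> \<bar>\<Prod>y\<leftarrow>ys. f y\<bar> \<le> 1"
  by (induction ys) (auto simp: abs_mult intro!: mult_le_one)

text \<open>The two intervals may have different lengths. The gap 1/4 is one cell at scale 2, which
  is what two non-adjacent quarters of the unit interval offer.\<close>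

definition separated :: "nat \<Rightarrow> int \<Rightarrow> nat \<Rightarrow> int \<Rightarrow> bool" where
  "separated a i b j \<longleftrightarrow> 0 \<le> i \<and> i < 2 ^ a \<and> 0 \<le> j \<and> j < 2 ^ b \<and>
     (real_of_int (i + 1) / 2 ^ a + 1 / 4 \<le> real_of_int j / 2 ^ b \<or>
      real_of_int (j + 1) / 2 ^ b + 1 / 4 \<le> real_of_int i / 2 ^ a)"

lemma cell_bounds:
  assumes "t \<in> cell x S a i"
  shows "real_of_int i \<le> 2 ^ a * x t" "2 ^ a * x t < real_of_int i + 1"
  using assms unfolding cell_def by (auto simp: floor_eq_iff)

text \<open>
  The functions with derivative \<open>w (u - \<xi>)\<^bsup>k - l\<^esup> q\<close> are almost constant on the cell \<open>(b, j)\<close> with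
  endpoint \<open>\<xi>\<close>, so weighting by a power of the exponential sum over that cell preserves the
  orthogonality relations for them, and \<open>|u - \<xi>|\<^bsup>k - l\<^esup>\<close> can be absorbed into \<open>w\<close> on the distant cell
  \<open>(a, i)\<close>.
\<close>

lemma vsystem_degree_drop:
  assumes sys: "vsystem k c K n \<Omega> \<nu> S x e" and l: "1 \<le> l" "l < k"
    and b: "b \<le> n" "l * b' \<le> (k - l + 1) * b" "a \<le> b'"
    and sep: "separated a i b j" and K: "K \<ge> 0" and c: "c > 0"
  shows "vsystem l (c / 4 ^ k) (K + 2 * real (moment_degree k)) (b' - a) \<Omega>
    (\<lambda>\<omega>. \<nu> \<omega> * cmod (expsum e (cell x S b j) \<omega>) ^ (2 * (moment_degree k - moment_degree l)))
    (cell x S a i) (\<lambda>t. 2 ^ a * x t - real_of_int i) e"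
proof (rule vsystemE[OF sys])
  fix w :: "real \<Rightarrow> real" and \<Phi> :: "real list \<Rightarrow> real \<Rightarrow> real"
  assume fin: "finite \<Omega>" "\<And>\<omega>. \<omega> \<in> \<Omega> \<Longrightarrow> \<nu> \<omega> \<ge> 0" "finite S"
    and x01: "\<And>t. t \<in> S \<Longrightarrow> 0 \<le> x t \<and> x t < 1"
    and w: "\<And>u. u \<in> {0..1::real} \<Longrightarrow> c \<le> w u \<and> w u \<le> 1"
    and \<Phi>: "\<And>\<xi>s u. length \<xi>s < k \<Longrightarrow> set \<xi>s \<subseteq> {0..1} \<Longrightarrow> u \<in> {0..1} \<Longrightarrow>
          (\<Phi> \<xi>s has_real_derivative (w u * (\<Prod>\<xi>\<leftarrow>\<xi>s. u - \<xi>))) (at u)"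
    and orth: "\<And>ts ts' \<xi>s. length ts = length ts' \<Longrightarrow> length ts \<le> moment_degree k \<Longrightarrow>
            set ts \<subseteq> S \<Longrightarrow> set ts' \<subseteq> S \<Longrightarrow> length \<xi>s < k \<Longrightarrow> set \<xi>s \<subseteq> {0..1} \<Longrightarrow>
            (\<Sum>\<omega>\<in>\<Omega>. complex_of_real (\<nu> \<omega>) * ((\<Prod>t\<leftarrow>ts. e t \<omega>) * cnj (\<Prod>t\<leftarrow>ts'. e t \<omega>))) \<noteq> 0
          \<Longrightarrow> \<bar>(\<Sum>t\<leftarrow>ts. \<Phi> \<xi>s (x t)) - (\<Sum>t\<leftarrow>ts'. \<Phi> \<xi>s (x t))\<bar> \<le> K * (1 / 2) ^ (n * k)"
  define \<xi> where "\<xi> = real_of_int j / 2 ^ b"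
  define r where "r = real_of_int i"
  define I where "I = cell x S a i"
  define I' where "I' = cell x S b j"
  define m where "m = moment_degree k - moment_degree l"
  have ir: "0 \<le> r" "r + 1 \<le> 2 ^ a"
  proof -
    have "i + 1 \<le> 2 ^ a" using sep unfolding separated_def by simp
    then have "real_of_int (i + 1) \<le> real_of_int (2 ^ a)" by (simp only: of_int_le_iff)
    then show "0 \<le> r" "r + 1 \<le> 2 ^ a" unfolding r_def using sep by (auto simp: separated_def)
  qed
  have jr: "0 \<le> \<xi>" "\<xi> + 1 / 2 ^ b \<le> 1"
  proof -
    have "j + 1 \<le> 2 ^ b" using sep unfolding separated_def by simp
    then have "real_of_int (j + 1) \<le> real_of_int (2 ^ b)" by (simp only: of_int_le_iff)
    then show "0 \<le> \<xi>" "\<xi> + 1 / 2 ^ b \<le> 1"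
      unfolding \<xi>_def using sep by (auto simp: separated_def field_simps)
  qed
  have \<xi>01: "\<xi> \<in> {0..1}" using jr by (auto intro: order_trans[rotated])
  note unit = rescale_unit_interval[OF ir]
  \<comment> \<open>Separation fixes the sign of T - \<xi> on the whole cell, so a global sign
    \<open>s\<close> turns (T - \<xi>)^(k - l) into a positive weight.\<close>
  obtain s :: real where s: "\<bar>s\<bar> = 1"
    "\<And>u. u \<in> {0..1} \<Longrightarrow> s * ((u + r) / 2 ^ a - \<xi>) ^ (k - l) = \<bar>(u + r) / 2 ^ a - \<xi>\<bar> ^ (k - l)
      \<and> \<bar>(u + r) / 2 ^ a - \<xi>\<bar> \<ge> 1 / 4"
  proof -
    have "real_of_int (i + 1) / 2 ^ a + 1 / 4 \<le> \<xi> \<or> \<xi> + 1 / 4 \<le> real_of_int i / 2 ^ a"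
    proof -
      have "\<xi> \<le> real_of_int (j + 1) / 2 ^ b" unfolding \<xi>_def by (intro divide_right_mono) auto
      then show ?thesis using sep unfolding separated_def \<xi>_def[symmetric] by auto
    qed
    moreover have left: "T \<le> E \<Longrightarrow> E + 1 / 4 \<le> \<xi> \<Longrightarrow> \<bar>T - \<xi>\<bar> = (-1) * (T - \<xi>) \<and> \<bar>T - \<xi>\<bar> \<ge> 1 / 4"
      for T E :: real by auto
    moreover have right: "T \<ge> E \<Longrightarrow> \<xi> + 1 / 4 \<le> E \<Longrightarrow> \<bar>T - \<xi>\<bar> = T - \<xi> \<and> \<bar>T - \<xi>\<bar> \<ge> 1 / 4"
      for T E :: real by auto
    ultimately show ?thesis
    proof (elim disjE)
      assume *: "real_of_int (i + 1) / 2 ^ a + 1 / 4 \<le> \<xi>"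
      show ?thesis
      proof (rule that[of "(-1) ^ (k - l)"])
        fix u :: real assume u: "u \<in> {0..1}"
        have "(u + r) / 2 ^ a \<le> real_of_int (i + 1) / 2 ^ a"
          using u unfolding r_def by (intro divide_right_mono) auto
        from left[OF this *] have "\<bar>(u + r) / 2 ^ a - \<xi>\<bar> = (-1) * ((u + r) / 2 ^ a - \<xi>)"
          "\<bar>(u + r) / 2 ^ a - \<xi>\<bar> \<ge> 1 / 4" by blast+
        then show "(-1) ^ (k - l) * ((u + r) / 2 ^ a - \<xi>) ^ (k - l) = \<bar>(u + r) / 2 ^ a - \<xi>\<bar> ^ (k - l)
          \<and> \<bar>(u + r) / 2 ^ a - \<xi>\<bar> \<ge> 1 / 4" by (metis power_mult_distrib)
      qed (simp add: power_abs)
    next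
      assume *: "\<xi> + 1 / 4 \<le> real_of_int i / 2 ^ a"
      show ?thesis
      proof (rule that[of 1])
        fix u :: real assume u: "u \<in> {0..1}"
        have "(u + r) / 2 ^ a \<ge> real_of_int i / 2 ^ a"
          using u unfolding r_def by (intro divide_right_mono) auto
        from right[OF this *] have "\<bar>(u + r) / 2 ^ a - \<xi>\<bar> = ((u + r) / 2 ^ a - \<xi>)"
          "\<bar>(u + r) / 2 ^ a - \<xi>\<bar> \<ge> 1 / 4" by blast+
        then show "1 * ((u + r) / 2 ^ a - \<xi>) ^ (k - l) = \<bar>(u + r) / 2 ^ a - \<xi>\<bar> ^ (k - l)
          \<and> \<bar>(u + r) / 2 ^ a - \<xi>\<bar> \<ge> 1 / 4" by simp
      qed simp
    qed
  qed
  \<comment> \<open>Adjoining k - l roots at \<xi> to fewer than l roots keeps the length below k,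
    so the given primitives apply.\<close>
  let ?m = "\<lambda>\<eta>s. replicate (k - l) \<xi> @ map (\<lambda>\<eta>. (\<eta> + r) / 2 ^ a) \<eta>s"
  define w' where "w' u = w ((u + r) / 2 ^ a) * \<bar>(u + r) / 2 ^ a - \<xi>\<bar> ^ (k - l)" for u
  define \<Phi>' where "\<Phi>' \<eta>s u = 2 ^ (a * (length \<eta>s + 1)) * (s * \<Phi> (?m \<eta>s) ((u + r) / 2 ^ a))" for \<eta>s u
  have m: "set (?m \<eta>s) \<subseteq> {0..1}" if "set \<eta>s \<subseteq> {0..1}" for \<eta>s
    using that unit \<xi>01 by auto
  have "(\<Phi>' \<eta>s has_real_derivative w' u * (\<Prod>\<eta>\<leftarrow>\<eta>s. u - \<eta>)) (at u)"
    if "length \<eta>s < l" "set \<eta>s \<subseteq> {0..1}" "u \<in> {0..1}" for \<eta>s u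
  proof -
    let ?t = "(u + r) / 2 ^ a"
    have "(\<Phi> (?m \<eta>s) has_real_derivative (w ?t * (\<Prod>\<eta>\<leftarrow>?m \<eta>s. ?t - \<eta>))) (at ?t)"
      using that m unit l by (intro \<Phi>) auto
    then have "((\<lambda>t. s * \<Phi> (?m \<eta>s) t) has_real_derivative s * (w ?t * (\<Prod>\<eta>\<leftarrow>?m \<eta>s. ?t - \<eta>))) (at ?t)"
      by (rule DERIV_cmult)
    also have "s * (w ?t * (\<Prod>\<eta>\<leftarrow>?m \<eta>s. ?t - \<eta>))
        = w ?t * (s * (?t - \<xi>) ^ (k - l)) * (\<Prod>\<eta>\<leftarrow>\<eta>s. ?t - (\<eta> + r) / 2 ^ a)"
      by (simp add: o_def map_replicate_const prod_list_replicate)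
    also have "\<dots> = w' u * (\<Prod>\<eta>\<leftarrow>\<eta>s. ?t - (\<eta> + r) / 2 ^ a)"
      using s(2)[OF that(3)] unfolding w'_def by simp
    finally show ?thesis unfolding \<Phi>'_def by (rule rescaled_primitive)
  qed
  moreover have "\<bar>(\<Sum>t\<leftarrow>ts. \<Phi>' \<eta>s (2 ^ a * x t - r)) - (\<Sum>t\<leftarrow>ts'. \<Phi>' \<eta>s (2 ^ a * x t - r))\<bar>
      \<le> (K + 2 * real (moment_degree k)) * (1 / 2) ^ ((b' - a) * l)"
    if ts: "length ts = length ts'" "length ts \<le> moment_degree l" "set ts \<subseteq> I" "set ts' \<subseteq> I"
      "length \<eta>s < l" "set \<eta>s \<subseteq> {0..1}"
      and nz: "(\<Sum>\<omega>\<in>\<Omega>. complex_of_real (\<nu> \<omega> * cmod (expsum e I' \<omega>) ^ (2 * m))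
          * ((\<Prod>t\<leftarrow>ts. e t \<omega>) * cnj (\<Prod>t\<leftarrow>ts'. e t \<omega>))) \<noteq> 0"
    for ts ts' \<eta>s
  proof -
    have "finite I'" using fin finite_subset cell_subset unfolding I'_def by metis
    from weighted_correlation_nonzero[OF this nz] obtain ys ys' where
      ys: "length ys = m" "length ys' = m" "set ys \<subseteq> I'" "set ys' \<subseteq> I'"
      and nz': "(\<Sum>\<omega>\<in>\<Omega>. complex_of_real (\<nu> \<omega>)
        * ((\<Prod>t\<leftarrow>ys @ ts. e t \<omega>) * cnj (\<Prod>t\<leftarrow>ys' @ ts'. e t \<omega>))) \<noteq> 0" by blast
    define \<Psi> where "\<Psi> = \<Phi> (?m \<eta>s)"
    have len: "length (?m \<eta>s) < k" using ts l by auto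
    have IS: "I \<subseteq> S" "I' \<subseteq> S" unfolding I_def I'_def by (auto simp: cell_def)
    have mk: "moment_degree l \<le> moment_degree k" using l by (intro moment_degree_mono) auto
    \<comment> \<open>The value of \<open>m\<close> is such that the joint tuples have at most
      \<open>moment_degree k\<close> entries, the length up to which correlations are
      controlled.\<close>
    have "\<bar>(\<Sum>t\<leftarrow>ys @ ts. \<Phi> (?m \<eta>s) (x t)) - (\<Sum>t\<leftarrow>ys' @ ts'. \<Phi> (?m \<eta>s) (x t))\<bar> \<le> K * (1 / 2) ^ (n * k)"
      using ts ys IS mk len m by (intro orth[OF _ _ _ _ _ _ nz']) (auto simp: m_def)
    then have tol: "\<bar>((\<Sum>t\<leftarrow>ys. \<Psi> (x t)) - (\<Sum>t\<leftarrow>ys'. \<Psi> (x t)))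
        + ((\<Sum>t\<leftarrow>ts. \<Psi> (x t)) - (\<Sum>t\<leftarrow>ts'. \<Psi> (x t)))\<bar> \<le> K * (1 / 2) ^ (n * k)"
      unfolding \<Psi>_def by (simp add: algebra_simps)
    \<comment> \<open>Near \<xi> the derivative carries the factor |u - \<xi>|^(k - l), at most
      2^(-b (k - l)), and the cell has length 2^-b; so each adjoined variable contributes the
      constant value at \<xi> up to 2^(-b (k - l + 1)).\<close>
    have near: "\<bar>\<Psi> (x y) - \<Psi> \<xi>\<bar> \<le> (1 / 2) ^ (b * (k - l + 1))" if "y \<in> I'" for y
    proof -
      have xy: "\<xi> \<le> x y" "x y \<le> \<xi> + 1 / 2 ^ b"
        using cell_bounds[of y x S b j] that unfolding I'_def \<xi>_def
        by (auto simp: field_simps)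
      have "\<bar>\<Psi> (x y) - \<Psi> \<xi>\<bar> \<le> (1 / 2 ^ b) ^ (k - l) * (x y - \<xi>)"
        unfolding \<Psi>_def
      proof (rule derivative_bound_diff[OF xy(1)])
        fix u assume u: "\<xi> \<le> u" "u \<le> x y"
        then have u01: "u \<in> {0..1}" using \<xi>01 xy jr by auto
        show "(\<Phi> (?m \<eta>s) has_real_derivative w u * (\<Prod>\<eta>\<leftarrow>?m \<eta>s. u - \<eta>)) (at u)"
          using len m[OF ts(6)] u01 by (rule \<Phi>)
        have "\<bar>w u\<bar> \<le> 1" using w[OF u01] c by simp
        moreover have "\<bar>u - \<xi>\<bar> ^ (k - l) \<le> (1 / 2 ^ b) ^ (k - l)"
          using u xy by (intro power_mono) auto
        moreover have "\<bar>\<Prod>\<eta>\<leftarrow>\<eta>s. u - (\<eta> + r) / 2 ^ a\<bar> \<le> 1"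
        proof (rule prod_list_abs_le_1)
          fix y assume "y \<in> set \<eta>s"
          then have "(y + r) / 2 ^ a \<in> {0..1}" using ts(6) by (intro unit) auto
          moreover have "\<bar>u - T\<bar> \<le> 1" if "T \<in> {0..1}" for T using u01 that by auto
          ultimately show "\<bar>u - (y + r) / 2 ^ a\<bar> \<le> 1" by blast
        qed
        ultimately have "\<bar>w u\<bar> * (\<bar>u - \<xi>\<bar> ^ (k - l) * \<bar>\<Prod>\<eta>\<leftarrow>\<eta>s. u - (\<eta> + r) / 2 ^ a\<bar>)
            \<le> 1 * ((1 / 2 ^ b) ^ (k - l) * 1)"
          by (intro mult_mono) auto
        then show "\<bar>w u * (\<Prod>\<eta>\<leftarrow>?m \<eta>s. u - \<eta>)\<bar> \<le> (1 / 2 ^ b) ^ (k - l)"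
          by (simp add: o_def map_replicate_const prod_list_replicate abs_mult power_abs)
      qed
      also have "\<dots> \<le> (1 / 2 ^ b) ^ (k - l) * (1 / 2 ^ b)"
        using xy by (intro mult_left_mono) auto
      also have "\<dots> = (1 / 2) ^ (b * (k - l + 1))"
        by (simp add: power_mult power_add power_one_over mult.commute flip: power_mult)
      finally show ?thesis .
    qed
    define E where "E = (1 / 2 :: real) ^ (b * (k - l + 1))"
    have "\<bar>(\<Sum>t\<leftarrow>ys. \<Psi> (x t)) - real m * \<Psi> \<xi>\<bar> \<le> real m * E"
      using sum_list_dist_const[of ys "\<lambda>t. \<Psi> (x t)" "\<Psi> \<xi>" E] near ys unfolding E_def by auto
    moreover have "\<bar>(\<Sum>t\<leftarrow>ys'. \<Psi> (x t)) - real m * \<Psi> \<xi>\<bar> \<le> real m * E"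
      using sum_list_dist_const[of ys' "\<lambda>t. \<Psi> (x t)" "\<Psi> \<xi>" E] near ys unfolding E_def by auto
    moreover have "K * (1 / 2) ^ (n * k) \<le> K * E"
    proof -
      have "b * (k - l + 1) \<le> n * k" using b l by (intro mult_le_mono) auto
      then show ?thesis unfolding E_def using K by (intro mult_left_mono power_decreasing) auto
    qed
    moreover have "real m * E \<le> real (moment_degree k) * E"
      unfolding m_def E_def by (intro mult_right_mono) auto
    ultimately have "\<bar>(\<Sum>t\<leftarrow>ts. \<Psi> (x t)) - (\<Sum>t\<leftarrow>ts'. \<Psi> (x t))\<bar> \<le> K * E + 2 * (real (moment_degree k) * E)"
      using tol by linarith
    also have "\<dots> = (K + 2 * real (moment_degree k)) * E" by (simp add: algebra_simps)
    finally have fin': "\<bar>(\<Sum>t\<leftarrow>ts. \<Psi> (x t)) - (\<Sum>t\<leftarrow>ts'. \<Psi> (x t))\<bar>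
        \<le> (K + 2 * real (moment_degree k)) * E" .
    \<comment> \<open>Here \<open>l * b' \<le> (k - l + 1) * b\<close> enters: the error of the
      adjoined variables stays below the degree-l tolerance at the finer scale
      \<open>b'\<close>.\<close>
    have "(2::real) ^ (a * (length \<eta>s + 1)) * E \<le> 2 ^ (a * l) * (1 / 2) ^ (b' * l)"
    proof -
      have 1: "a * (length \<eta>s + 1) \<le> a * l" using ts(5) by (intro mult_le_mono) auto
      have 2: "b' * l \<le> b * (k - l + 1)" using b(2) by (simp only: mult.commute)
      show ?thesis unfolding E_def by (intro mult_mono power_increasing[OF 1] power_decreasing[OF 2]) auto
    qed
    also have "\<dots> = (1 / 2) ^ ((b' - a) * l)"
    proof -
      have "b' * l = (b' - a) * l + a * l" using b by (simp flip: add_mult_distrib)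
      then show ?thesis by (simp add: power_add field_simps)
    qed
    finally have E2: "(2::real) ^ (a * (length \<eta>s + 1)) * E \<le> (1 / 2) ^ ((b' - a) * l)" .
    have "2 ^ (a * (length \<eta>s + 1)) * \<bar>(\<Sum>t\<leftarrow>ts. \<Psi> (x t)) - (\<Sum>t\<leftarrow>ts'. \<Psi> (x t))\<bar>
        \<le> 2 ^ (a * (length \<eta>s + 1)) * ((K + 2 * real (moment_degree k)) * E)"
      using fin' by (intro mult_left_mono) auto
    also have "\<dots> = (K + 2 * real (moment_degree k)) * (2 ^ (a * (length \<eta>s + 1)) * E)" by simp
    also have "\<dots> \<le> (K + 2 * real (moment_degree k)) * (1 / 2) ^ ((b' - a) * l)"
      using E2 K by (intro mult_left_mono) auto
    finally show ?thesis unfolding \<Phi>'_def sum_list_const_mult using s(1)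
      by (simp flip: right_diff_distrib add: abs_mult \<Psi>_def)
  qed
  \<comment> \<open>The distance from \<xi> lies between 1/4 and 1, so its power costs at most 4^k
    in the lower bound for the weight.\<close>
  moreover have "c / 4 ^ k \<le> w' u \<and> w' u \<le> 1" if u: "u \<in> {0..1}" for u
  proof -
    let ?t = "(u + r) / 2 ^ a"
    have wt: "c \<le> w ?t" "w ?t \<le> 1" using w unit u by blast+
    have "\<bar>T - \<xi>\<bar> \<le> 1" if "T \<in> {0..1}" for T using \<xi>01 that by auto
    then have 1: "\<bar>?t - \<xi>\<bar> \<le> 1" using unit[OF u] by blast
    have "(1 / 4) ^ k \<le> (1 / 4 :: real) ^ (k - l)" by (intro power_decreasing) auto
    also have "\<dots> \<le> \<bar>?t - \<xi>\<bar> ^ (k - l)" using s(2)[OF u] by (intro power_mono) auto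
    finally have "c * (1 / 4) ^ k \<le> w ?t * \<bar>?t - \<xi>\<bar> ^ (k - l)" using wt c by (intro mult_mono) auto
    moreover have "w ?t * \<bar>?t - \<xi>\<bar> ^ (k - l) \<le> 1"
      using wt c 1 by (intro mult_le_one power_le_one) auto
    ultimately show ?thesis unfolding w'_def by (simp add: power_one_over)
  qed
  moreover have "finite I" using fin finite_subset cell_subset unfolding I_def by metis
  moreover have "0 \<le> 2 ^ a * x t - r \<and> 2 ^ a * x t - r < 1" if "t \<in> I" for t
    using cell_bounds[of t x S a i] that unfolding I_def r_def by auto
  moreover have "\<forall>\<omega>\<in>\<Omega>. 0 \<le> \<nu> \<omega> * cmod (expsum e I' \<omega>) ^ (2 * m)" using fin by auto
  ultimately have "vsystem l (c / 4 ^ k) (K + 2 * real (moment_degree k)) (b' - a) \<Omega>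
      (\<lambda>\<omega>. \<nu> \<omega> * cmod (expsum e I' \<omega>) ^ (2 * m)) I (\<lambda>t. 2 ^ a * x t - r) e"
    using fin(1) by (intro vsystemI[where w = w' and \<Phi> = \<Phi>']) simp_all
  then show ?thesis unfolding I_def I'_def m_def r_def .
qed

section \<open>Linear, bilinear and mixed estimates\<close>

lemma moment_powr_power:
  assumes "\<And>\<omega>. \<omega> \<in> \<Omega> \<Longrightarrow> \<nu> \<omega> \<ge> 0" "d \<ge> 1"
  shows "(moment \<Omega> \<nu> q f powr (1 / real d)) ^ d = moment \<Omega> \<nu> q f"
proof (cases "moment \<Omega> \<nu> q f = 0")
  case False
  then have "moment \<Omega> \<nu> q f > 0" using moment_nonneg[of \<Omega> \<nu> q f] assms by auto
  then show ?thesis using assms(2)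
    by (simp add: powr_powr flip: powr_realpow)
qed (use assms in simp)

lemma decouplingD:
  assumes "decoupling k c K n B" "vsystem k c K n (\<Omega> :: nat set) \<nu> (S :: real set) x e"
  shows "moment \<Omega> \<nu> (2 * moment_degree k) (expsum e S)
          \<le> (B * sqsum \<Omega> \<nu> x e (moment_degree k) n S) ^ moment_degree k"
  using assms unfolding decoupling_def by blast

lemma decoupling_mono:
  assumes "decoupling k c K n B" "B \<le> B'" "0 \<le> B"
  shows "decoupling k c K n B'"
  unfolding decoupling_def
proof (intro allI impI)
  fix \<Omega> :: "nat set" and \<nu> and S :: "real set" and x e
  assume "vsystem k c K n \<Omega> \<nu> S x e"
  from decouplingD[OF assms(1) this]
  have "moment \<Omega> \<nu> (2 * moment_degree k) (expsum e S)
          \<le> (B * sqsum \<Omega> \<nu> x e (moment_degree k) n S) ^ moment_degree k" .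
  also have "\<dots> \<le> (B' * sqsum \<Omega> \<nu> x e (moment_degree k) n S) ^ moment_degree k"
    using assms sqsum_nonneg by (intro power_mono mult_right_mono mult_nonneg_nonneg)
  finally show "moment \<Omega> \<nu> (2 * moment_degree k) (expsum e S)
          \<le> (B' * sqsum \<Omega> \<nu> x e (moment_degree k) n S) ^ moment_degree k" .
qed

section \<open>Degree one and the trivial bound\<close>

lemma sum_shift_band:
  fixes f :: "int \<Rightarrow> real"
  assumes "finite I" "\<And>i. i \<in> I \<Longrightarrow> f i \<ge> 0"
  shows "(\<Sum>(i, j)\<in>{(i, j) \<in> I \<times> I. \<bar>i - j\<bar> \<le> int M}. (f i + f j) / 2) \<le> (2 * real M + 1) * (\<Sum>i\<in>I. f i)"
proof -
  let ?P = "{(i, j) \<in> I \<times> I. \<bar>i - j\<bar> \<le> int M}"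
  have finP: "finite ?P" by (rule finite_subset[of _ "I \<times> I"]) (use assms in auto)
  have 1: "(\<Sum>p\<in>?P. f (fst p)) \<le> (2 * real M + 1) * (\<Sum>i\<in>I. f i)"
  proof -
    have sub: "?P \<subseteq> (SIGMA i:I. {i - int M..i + int M})" by auto
    have "(\<Sum>p\<in>?P. f (fst p)) \<le> (\<Sum>p\<in>(SIGMA i:I. {i - int M..i + int M}). f (fst p))"
      using assms sub by (intro sum_mono2) auto
    also have "\<dots> = (\<Sum>i\<in>I. \<Sum>j\<in>{i - int M..i + int M}. f i)"
      using assms by (subst sum.Sigma) (auto simp: split_def)
    also have "\<dots> = (2 * real M + 1) * (\<Sum>i\<in>I. f i)"
      by (simp add: sum_distrib_left)
    finally show ?thesis .
  qed
  have 2: "(\<Sum>p\<in>?P. f (snd p)) = (\<Sum>p\<in>?P. f (fst p))"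
    by (rule sum.reindex_bij_witness[of _ prod.swap prod.swap]) auto
  have "(\<Sum>(i, j)\<in>?P. (f i + f j) / 2) = ((\<Sum>p\<in>?P. f (fst p)) + (\<Sum>p\<in>?P. f (snd p))) / 2"
    unfolding split_def sum.distrib[symmetric] sum_divide_distrib ..
  then show ?thesis using 1 2 by simp
qed

text \<open>\<open>\<Phi> []\<close> has derivative at least c, so a nonzero correlation forces two
  parameters to lie within K 2^-n / c of each other. Cells further apart are orthogonal, and the
  Gram matrix of the cell sums is a band matrix. This starts the induction on the degree.\<close>

lemma decoupling_degree_one:
  assumes "c > 0" "K \<ge> 0"
  shows "\<exists>B\<ge>1. \<forall>n. decoupling 1 c K n B"
proof -
  define M where "M = nat \<lceil>K / c\<rceil> + 1"
  have M: "K / c + 1 \<le> real M" unfolding M_def by linarith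
  have "decoupling 1 c K n (2 * real M + 1)" for n
    unfolding decoupling_def
  proof (intro allI impI)
    fix \<Omega> :: "nat set" and \<nu> and S :: "real set" and x e
    assume sys: "vsystem 1 c K n \<Omega> \<nu> S x e"
    have d1: "moment_degree 1 = 1" unfolding moment_degree_def by simp
    define F where "F i = expsum e (cell x S n i)" for i
    define I where "I = {0..<(2::int) ^ n}"
    define a where "a i j = (\<Sum>\<omega>\<in>\<Omega>. complex_of_real (\<nu> \<omega>) * (F i \<omega> * cnj (F j \<omega>)))" for i j
    show "moment \<Omega> \<nu> (2 * moment_degree 1) (expsum e S)
          \<le> ((2 * real M + 1) * sqsum \<Omega> \<nu> x e (moment_degree 1) n S) ^ moment_degree 1"
    proof (rule vsystemE[OF sys])
      fix w :: "real \<Rightarrow> real" and \<Phi> :: "real list \<Rightarrow> real \<Rightarrow> real"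
      assume fin: "finite \<Omega>" "\<And>\<omega>. \<omega> \<in> \<Omega> \<Longrightarrow> \<nu> \<omega> \<ge> 0" "finite S"
        and x01: "\<And>t. t \<in> S \<Longrightarrow> 0 \<le> x t \<and> x t < 1"
        and w: "\<And>u. u \<in> {0..1::real} \<Longrightarrow> c \<le> w u \<and> w u \<le> 1"
        and \<Phi>: "\<And>\<xi>s u. length \<xi>s < 1 \<Longrightarrow> set \<xi>s \<subseteq> {0..1} \<Longrightarrow> u \<in> {0..1} \<Longrightarrow>
              (\<Phi> \<xi>s has_real_derivative (w u * (\<Prod>\<xi>\<leftarrow>\<xi>s. u - \<xi>))) (at u)"
        and orth: "\<And>ts ts' \<xi>s. length ts = length ts' \<Longrightarrow> length ts \<le> moment_degree 1 \<Longrightarrow>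
            set ts \<subseteq> S \<Longrightarrow> set ts' \<subseteq> S \<Longrightarrow> length \<xi>s < 1 \<Longrightarrow> set \<xi>s \<subseteq> {0..1} \<Longrightarrow>
            (\<Sum>\<omega>\<in>\<Omega>. complex_of_real (\<nu> \<omega>) * ((\<Prod>t\<leftarrow>ts. e t \<omega>) * cnj (\<Prod>t\<leftarrow>ts'. e t \<omega>))) \<noteq> 0
          \<Longrightarrow> \<bar>(\<Sum>t\<leftarrow>ts. \<Phi> \<xi>s (x t)) - (\<Sum>t\<leftarrow>ts'. \<Phi> \<xi>s (x t))\<bar> \<le> K * (1 / 2) ^ (n * 1)"
      have inc: "c * (v - u) \<le> \<Phi> [] v - \<Phi> [] u" if "0 \<le> u" "u < v" "v \<le> 1" for u v
      proof -
        have "\<exists>z>u. z < v \<and> \<Phi> [] v - \<Phi> [] u = (v - u) * w z"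
          using that \<Phi>[of "[]"] by (intro MVT2) auto
        then obtain z where z: "u < z" "z < v" "\<Phi> [] v - \<Phi> [] u = (v - u) * w z" by blast
        then have "c \<le> w z" using w[of z] that by auto
        then show ?thesis using z by (simp add: mult.commute mult_left_mono)
      qed
      have near: "\<bar>i - j\<bar> \<le> int M" if nz: "a i j \<noteq> 0" for i j
      proof -
        have "a i j = (\<Sum>\<omega>\<in>\<Omega>. \<Sum>t\<in>cell x S n i. \<Sum>t'\<in>cell x S n j. complex_of_real (\<nu> \<omega>) * (e t \<omega> * cnj (e t' \<omega>)))"
          unfolding a_def F_def expsum_def cnj_sum sum_product by (simp add: sum_distrib_left)
        also have "\<dots> = (\<Sum>t\<in>cell x S n i. \<Sum>t'\<in>cell x S n j. \<Sum>\<omega>\<in>\<Omega>. complex_of_real (\<nu> \<omega>) * (e t \<omega> * cnj (e t' \<omega>)))"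
          by (rule sym, rule trans[OF sum.cong[OF refl sum.swap] sum.swap])
        finally have "(\<Sum>t\<in>cell x S n i. \<Sum>t'\<in>cell x S n j. \<Sum>\<omega>\<in>\<Omega>. complex_of_real (\<nu> \<omega>) * (e t \<omega> * cnj (e t' \<omega>))) \<noteq> 0"
          using nz by simp
        then obtain t where t: "t \<in> cell x S n i"
          "(\<Sum>t'\<in>cell x S n j. \<Sum>\<omega>\<in>\<Omega>. complex_of_real (\<nu> \<omega>) * (e t \<omega> * cnj (e t' \<omega>))) \<noteq> 0"
          by (rule sum.not_neutral_contains_not_neutral)
        from t(2) obtain t' where t': "t' \<in> cell x S n j"
          "(\<Sum>\<omega>\<in>\<Omega>. complex_of_real (\<nu> \<omega>) * (e t \<omega> * cnj (e t' \<omega>))) \<noteq> 0"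
          by (rule sum.not_neutral_contains_not_neutral)
        have tS: "t \<in> S" "t' \<in> S" using t t' by (auto simp: cell_def)
        have "\<bar>(\<Sum>t\<leftarrow>[t]. \<Phi> [] (x t)) - (\<Sum>t\<leftarrow>[t']. \<Phi> [] (x t))\<bar> \<le> K * (1 / 2) ^ (n * 1)"
          using t' tS by (intro orth) (auto simp: d1[simplified])
        then have le: "\<bar>\<Phi> [] (x t) - \<Phi> [] (x t')\<bar> \<le> K * (1 / 2) ^ n" by simp
        have "c * \<bar>x t - x t'\<bar> \<le> \<bar>\<Phi> [] (x t) - \<Phi> [] (x t')\<bar>"
          using inc[of "x t" "x t'"] inc[of "x t'" "x t"] x01 tS
          by (cases "x t" "x t'" rule: linorder_cases) (auto simp: less_imp_le)
        then have "c * \<bar>x t - x t'\<bar> \<le> K * (1 / 2) ^ n" using le by linarith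
        then have "2 ^ n * (c * \<bar>x t - x t'\<bar>) \<le> 2 ^ n * (K * (1 / 2) ^ n)" by (intro mult_left_mono) auto
        also have "\<dots> = K" by (simp add: power_one_over)
        finally have "2 ^ n * \<bar>x t - x t'\<bar> \<le> K / c" using assms by (simp add: field_simps)
        moreover have "\<bar>2 ^ n * x t - 2 ^ n * x t'\<bar> = 2 ^ n * \<bar>x t - x t'\<bar>"
          by (simp flip: right_diff_distrib add: abs_mult)
        ultimately have "\<bar>2 ^ n * x t - 2 ^ n * x t'\<bar> \<le> K / c" by simp
        moreover have "real_of_int i \<le> 2 ^ n * x t" "2 ^ n * x t < real_of_int i + 1"
          "real_of_int j \<le> 2 ^ n * x t'" "2 ^ n * x t' < real_of_int j + 1"
          using cell_bounds[OF t(1)] cell_bounds[OF t'(1)] by auto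
        moreover have "\<bar>real_of_int i - real_of_int j\<bar> < \<kappa> + 1"
          if "\<bar>p - q\<bar> \<le> \<kappa>" "real_of_int i \<le> p" "p < real_of_int i + 1"
            "real_of_int j \<le> q" "q < real_of_int j + 1" for p q \<kappa> :: real
          using that by linarith
        ultimately have "\<bar>real_of_int i - real_of_int j\<bar> < K / c + 1" by blast
        then have "real_of_int \<bar>i - j\<bar> < real M" using M by simp
        then show ?thesis by linarith
      qed
      have ab: "cmod (a i j) \<le> (moment \<Omega> \<nu> 2 (F i) + moment \<Omega> \<nu> 2 (F j)) / 2" for i j
      proof -
        have "cmod (a i j) \<le> (\<Sum>\<omega>\<in>\<Omega>. \<nu> \<omega> * (cmod (F i \<omega>) * cmod (F j \<omega>)))"
          unfolding a_def using fin by (intro order_trans[OF norm_sum] sum_mono) (simp add: norm_mult)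
        also have "\<dots> \<le> (\<Sum>\<omega>\<in>\<Omega>. \<nu> \<omega> * ((cmod (F i \<omega>) ^ 2 + cmod (F j \<omega>) ^ 2) / 2))"
          using fin sum_squares_bound[of "cmod (F i _)" "cmod (F j _)"]
          by (intro sum_mono mult_left_mono) (auto simp: field_simps)
        also have "\<dots> = (moment \<Omega> \<nu> 2 (F i) + moment \<Omega> \<nu> 2 (F j)) / 2"
          unfolding moment_def by (simp add: sum_divide_distrib distrib_left add_divide_distrib sum.distrib)
        finally show ?thesis .
      qed
      have "complex_of_real (moment \<Omega> \<nu> 2 (expsum e S)) = (\<Sum>(i, j)\<in>I \<times> I. a i j)"
      proof -
        have "complex_of_real (moment \<Omega> \<nu> 2 (expsum e S))
            = (\<Sum>\<omega>\<in>\<Omega>. complex_of_real (\<nu> \<omega>) * (expsum e S \<omega> * cnj (expsum e S \<omega>)))"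
          unfolding moment_def using complex_norm_square by simp
        also have "\<dots> = (\<Sum>\<omega>\<in>\<Omega>. \<Sum>(i, j)\<in>I \<times> I. complex_of_real (\<nu> \<omega>) * (F i \<omega> * cnj (F j \<omega>)))"
        proof (rule sum.cong[OF refl])
          fix \<omega>
          have "expsum e S \<omega> = (\<Sum>i\<in>I. F i \<omega>)"
            unfolding F_def I_def by (rule expsum_cells[OF fin(3) x01])
          then have "expsum e S \<omega> * cnj (expsum e S \<omega>) = (\<Sum>(i, j)\<in>I \<times> I. F i \<omega> * cnj (F j \<omega>))"
            by (simp only: cnj_sum sum_product sum.cartesian_product)
          then show "complex_of_real (\<nu> \<omega>) * (expsum e S \<omega> * cnj (expsum e S \<omega>))
              = (\<Sum>(i, j)\<in>I \<times> I. complex_of_real (\<nu> \<omega>) * (F i \<omega> * cnj (F j \<omega>)))"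
            by (simp only: sum_distrib_left split_def)
        qed
        also have "\<dots> = (\<Sum>(i, j)\<in>I \<times> I. a i j)"
          unfolding a_def by (subst sum.swap) (simp add: split_def)
        finally show ?thesis .
      qed
      also have "\<dots> = (\<Sum>(i, j)\<in>{(i, j) \<in> I \<times> I. \<bar>i - j\<bar> \<le> int M}. a i j)"
        using near by (intro sum.mono_neutral_right) (auto simp: I_def)
      finally have "moment \<Omega> \<nu> 2 (expsum e S) = Re (\<Sum>(i, j)\<in>{(i, j) \<in> I \<times> I. \<bar>i - j\<bar> \<le> int M}. a i j)"
        by (metis Re_complex_of_real)
      also have "\<dots> \<le> cmod (\<Sum>(i, j)\<in>{(i, j) \<in> I \<times> I. \<bar>i - j\<bar> \<le> int M}. a i j)"
        by (rule complex_Re_le_cmod)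
      also have "\<dots> \<le> (\<Sum>(i, j)\<in>{(i, j) \<in> I \<times> I. \<bar>i - j\<bar> \<le> int M}. (moment \<Omega> \<nu> 2 (F i) + moment \<Omega> \<nu> 2 (F j)) / 2)"
        using ab by (intro order_trans[OF norm_sum] sum_mono) (auto simp: split_def)
      also have "\<dots> \<le> (2 * real M + 1) * (\<Sum>i\<in>I. moment \<Omega> \<nu> 2 (F i))"
        using fin by (intro sum_shift_band) (auto simp: I_def moment_nonneg)
      also have "(\<Sum>i\<in>I. moment \<Omega> \<nu> 2 (F i)) = sqsum \<Omega> \<nu> x e 1 n S"
        unfolding sqsum_def I_def F_def using fin by (intro sum.cong) (auto simp: moment_nonneg)
      finally show ?thesis unfolding d1 by simp
    qed
  qed
  then show ?thesis by (intro exI[of _ "2 * real M + 1"]) auto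
qed

text \<open>Minkowski and Cauchy-Schwarz over the 2^n cells lose a factor 2^n; this supplies the
  exponent \<eta> = 1 from which the bootstrapping descends.\<close>

lemma decoupling_trivial:
  assumes "k \<ge> 1"
  shows "decoupling k c K n (2 ^ n)"
  unfolding decoupling_def
proof (intro allI impI)
  fix \<Omega> :: "nat set" and \<nu> and S :: "real set" and x e
  assume sys: "vsystem k c K n \<Omega> \<nu> S x e"
  have fin: "finite \<Omega>" "\<And>\<omega>. \<omega> \<in> \<Omega> \<Longrightarrow> \<nu> \<omega> \<ge> 0" "finite S"
    and x01: "\<And>t. t \<in> S \<Longrightarrow> 0 \<le> x t \<and> x t < 1"
    using sys unfolding vsystem_def by auto
  define d where "d = moment_degree k"
  have d: "d \<ge> 1" unfolding d_def by (rule moment_degree_pos[OF assms])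
  define F where "F i = expsum e (cell x S n i)" for i
  define I where "I = {0..<(2::int) ^ n}"
  define v where "v i = moment \<Omega> \<nu> (2 * d) (F i) powr (1 / real d)" for i
  have v: "v i \<ge> 0" "v i ^ d = moment \<Omega> \<nu> (2 * d) (F i)" for i
    unfolding v_def using moment_powr_power[OF fin(2) d] by auto
  have "moment \<Omega> \<nu> (2 * d) (expsum e S) = (\<Sum>\<omega>\<in>\<Omega>. \<nu> \<omega> * cmod (\<Sum>i\<in>I. F i \<omega>) ^ (2 * d))"
  proof -
    have "expsum e S \<omega> = (\<Sum>i\<in>I. F i \<omega>)" for \<omega>
      unfolding F_def I_def by (rule expsum_cells[OF fin(3) x01])
    then show ?thesis unfolding moment_def by simp
  qed
  also have "\<dots> \<le> (\<Sum>i\<in>I. sqrt (v i)) ^ (2 * d)"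
  proof (rule Minkowski_sum_power)
    fix i
    have "sqrt (v i) ^ (2 * d) = v i ^ d" using v by (simp add: power_mult)
    then show "0 \<le> sqrt (v i) \<and> (\<Sum>\<omega>\<in>\<Omega>. \<nu> \<omega> * cmod (F i \<omega>) ^ (2 * d)) \<le> sqrt (v i) ^ (2 * d)"
      using v by (simp add: moment_def)
  qed (use fin d in \<open>auto simp: I_def\<close>)
  also have "\<dots> = ((\<Sum>i\<in>I. sqrt (v i)) ^ 2) ^ d" by (simp add: power_mult)
  also have "\<dots> \<le> (2 ^ n * (\<Sum>i\<in>I. v i)) ^ d"
  proof (intro power_mono)
    have "(\<Sum>i\<in>I. 1 * sqrt (v i)) ^ 2 \<le> (\<Sum>i\<in>I. 1 ^ 2) * (\<Sum>i\<in>I. (sqrt (v i))\<^sup>2)"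
      by (rule Cauchy_Schwarz_ineq_sum)
    then show "(\<Sum>i\<in>I. sqrt (v i)) ^ 2 \<le> 2 ^ n * (\<Sum>i\<in>I. v i)"
      using v by (simp add: I_def)
  qed auto
  also have "(\<Sum>i\<in>I. v i) = sqsum \<Omega> \<nu> x e d n S" unfolding sqsum_def v_def F_def I_def ..
  finally show "moment \<Omega> \<nu> (2 * moment_degree k) (expsum e S)
          \<le> (2 ^ n * sqsum \<Omega> \<nu> x e (moment_degree k) n S) ^ moment_degree k" unfolding d_def .
qed

section \<open>Estimates inside one cell\<close>

lemma cell_rescale:
  assumes "a \<le> n" "r * 2 ^ (n - a) = real_of_int R"
  shows "cell (\<lambda>t. 2 ^ a * x t - r) S (n - a) j = cell x S n (j + R)"
proof -
  have "(2::real) ^ n = 2 ^ (n - a) * 2 ^ a" using assms(1) by (simp flip: power_add)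
  then have "2 ^ (n - a) * (2 ^ a * x t - r) = 2 ^ n * x t - real_of_int R" for t
    using assms(2) by (simp add: algebra_simps)
  then have "\<lfloor>2 ^ (n - a) * (2 ^ a * x t - r)\<rfloor> = \<lfloor>2 ^ n * x t\<rfloor> - R" for t
    by (simp only: floor_diff_of_int)
  then show ?thesis unfolding cell_def by auto
qed

lemma rescale_range:
  assumes "a \<le> n" "r * 2 ^ (n - a) = real_of_int R" "0 \<le> r" "r + 1 \<le> (2::real) ^ a"
  shows "0 \<le> R" "R + 2 ^ (n - a) \<le> 2 ^ n"
proof -
  have "real_of_int R \<ge> 0" using assms by (metis mult_nonneg_nonneg zero_le_numeral zero_le_power)
  then show "0 \<le> R" by simp
  have "(r + 1) * 2 ^ (n - a) \<le> 2 ^ a * 2 ^ (n - a)" using assms by (intro mult_right_mono) auto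
  also have "\<dots> = 2 ^ n" using assms(1) by (simp flip: power_add)
  finally have "real_of_int (R + 2 ^ (n - a)) \<le> real_of_int (2 ^ n)"
    using assms(2) by (simp add: algebra_simps)
  then show "R + 2 ^ (n - a) \<le> 2 ^ n" by (simp only: of_int_le_iff)
qed

text \<open>Only r 2^(n - a) has to be an integer: the fine cells of the two coordinates then
  coincide up to a shift of the index by \<open>R\<close>, and the cells outside the shifted range
  are empty.\<close>

lemma sqsum_rescale:
  assumes an: "a \<le> n" and R: "r * 2 ^ (n - a) = real_of_int R" and r: "0 \<le> r" "r + 1 \<le> 2 ^ a"
    and x: "\<And>t. t \<in> S \<Longrightarrow> r \<le> 2 ^ a * x t \<and> 2 ^ a * x t < r + 1" and d: "d \<ge> 1"
  shows "sqsum \<Omega> \<nu> (\<lambda>t. 2 ^ a * x t - r) e d (n - a) S = sqsum \<Omega> \<nu> x e d n S"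
proof -
  define h where "h i = moment \<Omega> \<nu> (2 * d) (expsum e (cell x S n i)) powr (1 / real d)" for i
  note range = rescale_range[OF an R r]
  have outside: "h i = 0" if "i \<notin> {R..<R + 2 ^ (n - a)}" for i
  proof -
    have "cell x S n i = {}"
    proof (rule ccontr)
      assume "cell x S n i \<noteq> {}"
      then obtain t where t: "t \<in> S" "\<lfloor>2 ^ n * x t\<rfloor> = i" unfolding cell_def by auto
      have n: "(2::real) ^ n = 2 ^ (n - a) * 2 ^ a" using an by (simp flip: power_add)
      have "2 ^ (n - a) * r \<le> 2 ^ (n - a) * (2 ^ a * x t)" using x[OF t(1)] by (intro mult_left_mono) auto
      then have 1: "real_of_int R \<le> 2 ^ n * x t" unfolding n using R by (simp add: mult.commute mult.left_commute)
      have "2 ^ (n - a) * (2 ^ a * x t) < 2 ^ (n - a) * (r + 1)" using x[OF t(1)] by (intro mult_strict_left_mono) auto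
      then have "2 ^ n * x t < real_of_int (R + 2 ^ (n - a))"
        unfolding n using R by (simp add: algebra_simps)
      then have "i < R + 2 ^ (n - a)" using t(2) by (simp only: floor_less_iff[symmetric])
      moreover have "R \<le> i" using 1 t(2) by (simp only: le_floor_iff[symmetric])
      ultimately show False using that by simp
    qed
    then show ?thesis unfolding h_def using d by simp
  qed
  have "sqsum \<Omega> \<nu> (\<lambda>t. 2 ^ a * x t - r) e d (n - a) S = (\<Sum>j\<in>{0..<2 ^ (n - a)}. h (j + R))"
    unfolding sqsum_def cell_rescale[OF an R] h_def ..
  also have "\<dots> = (\<Sum>i\<in>{R..<R + 2 ^ (n - a)}. h i)"
    by (rule sum.reindex_bij_witness[of _ "\<lambda>i. i - R" "\<lambda>j. j + R"]) auto
  also have "\<dots> = (\<Sum>i\<in>{0..<2 ^ n}. h i)"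
    using range outside by (intro sum.mono_neutral_left) auto
  finally show ?thesis unfolding sqsum_def h_def .
qed

lemma decoupling_rescaled:
  assumes dec: "decoupling k c K (n - a) B" and sys: "vsystem k c K n (\<Omega> :: nat set) \<nu> (S :: real set) x e"
    and an: "a \<le> n" and i: "0 \<le> i" "i < 2 ^ a" and K: "K \<ge> 0" and k: "k \<ge> 1"
  shows "moment \<Omega> \<nu> (2 * moment_degree k) (expsum e (cell x S a i))
    \<le> (B * sqsum \<Omega> \<nu> x e (moment_degree k) n (cell x S a i)) ^ moment_degree k"
proof -
  have "real_of_int (i + 1) \<le> real_of_int (2 ^ a)" using i by (simp only: of_int_le_iff)
  then have r: "0 \<le> real_of_int i" "real_of_int i + 1 \<le> 2 ^ a" using i by auto
  have R: "real_of_int i * 2 ^ (n - a) = real_of_int (i * 2 ^ (n - a))" by simp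
  have x: "real_of_int i \<le> 2 ^ a * x t \<and> 2 ^ a * x t < real_of_int i + 1" if "t \<in> cell x S a i" for t
    using cell_bounds[OF that] by simp
  have sys': "vsystem k c K (n - a) \<Omega> \<nu> (cell x S a i) (\<lambda>t. 2 ^ a * x t - real_of_int i) e"
    by (rule vsystem_rescale[OF sys an r cell_subset x K])
  have eq: "sqsum \<Omega> \<nu> (\<lambda>t. 2 ^ a * x t - real_of_int i) e (moment_degree k) (n - a) (cell x S a i)
      = sqsum \<Omega> \<nu> x e (moment_degree k) n (cell x S a i)"
    by (rule sqsum_rescale[OF an R r x moment_degree_pos[OF k]])
  from decouplingD[OF dec sys'] show ?thesis unfolding eq .
qed

section \<open>Reduction to distant pairs of intervals\<close>

text \<open>Scale 2 is the coarsest at which two dyadic subintervals of the unit interval can fail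
  to be adjacent. The geometric mean on the right makes the bound symmetric and homogeneous in both
  cells.\<close>

definition bilinear_decoupling :: "nat \<Rightarrow> real \<Rightarrow> real \<Rightarrow> nat \<Rightarrow> real \<Rightarrow> bool" where
  "bilinear_decoupling k c K n B \<longleftrightarrow>
     (\<forall>\<Omega> \<nu> S x e i j. vsystem k c K n (\<Omega> :: nat set) \<nu> (S :: real set) x e \<and> separated 2 i 2 j \<longrightarrow>
        (\<Sum>\<omega>\<in>\<Omega>. \<nu> \<omega> * (cmod (expsum e (cell x S 2 i) \<omega>) ^ moment_degree k
            * cmod (expsum e (cell x S 2 j) \<omega>) ^ moment_degree k))
          \<le> (B * sqrt (sqsum \<Omega> \<nu> x e (moment_degree k) n (cell x S 2 i)
               * sqsum \<Omega> \<nu> x e (moment_degree k) n (cell x S 2 j))) ^ moment_degree k)"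

lemma bilinear_decouplingD:
  assumes "bilinear_decoupling k c K n B" "vsystem k c K n (\<Omega> :: nat set) \<nu> (S :: real set) x e"
    "separated 2 i 2 j"
  shows "(\<Sum>\<omega>\<in>\<Omega>. \<nu> \<omega> * (cmod (expsum e (cell x S 2 i) \<omega>) ^ moment_degree k
            * cmod (expsum e (cell x S 2 j) \<omega>) ^ moment_degree k))
          \<le> (B * sqrt (sqsum \<Omega> \<nu> x e (moment_degree k) n (cell x S 2 i)
               * sqsum \<Omega> \<nu> x e (moment_degree k) n (cell x S 2 j))) ^ moment_degree k"
  using assms unfolding bilinear_decoupling_def by blast

text \<open>The two cells lie among the four children of adjacent parents, whose union is an
  interval of length 2^-a. Stretching that union to unit length makes them distant quarters.\<close>

lemma bilinear_decoupling_rescaled: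
  assumes bil: "bilinear_decoupling k c K (n - a) B"
    and sys: "vsystem k c K n (\<Omega> :: nat set) \<nu> (S :: real set) x e"
    and an: "a + 2 \<le> n" and K: "K \<ge> 0" and k: "k \<ge> 1"
    and ij: "0 \<le> i" "j < 2 ^ (a + 2)" "i + 2 \<le> j" "j div 2 = i div 2 + 1"
  shows "(\<Sum>\<omega>\<in>\<Omega>. \<nu> \<omega> * (cmod (expsum e (cell x S (a + 2) i) \<omega>) ^ moment_degree k
            * cmod (expsum e (cell x S (a + 2) j) \<omega>) ^ moment_degree k))
          \<le> (B * sqrt (sqsum \<Omega> \<nu> x e (moment_degree k) n (cell x S (a + 2) i)
               * sqsum \<Omega> \<nu> x e (moment_degree k) n (cell x S (a + 2) j))) ^ moment_degree k"
proof -
  define p where "p = i div 2"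
  \<comment> \<open>The union starts at p 2^-(a + 1) = (p / 2) 2^-a. For odd p it is not a dyadic
    interval, hence the half-integral \<open>r\<close>; its quarters still align with the cells at
    scale a + 2.\<close>
  define r where "r = real_of_int p / 2"
  define S' where "S' = cell x S (a + 2) i \<union> cell x S (a + 2) j"
  have p: "0 \<le> p" "2 * p \<le> i" "i \<le> 2 * p + 1" "2 * p + 2 \<le> j" "j \<le> 2 * p + 3"
    unfolding p_def using ij by auto
  have an': "a \<le> n" using an by simp
  have r: "0 \<le> r" "r + 1 \<le> 2 ^ a"
  proof -
    have "2 * p + 4 \<le> 2 ^ (a + 2)"
    proof -
      have "2 * p + 2 < 2 ^ (a + 2)" using p ij by linarith
      then have "2 * p + 2 < 4 * 2 ^ a" by simp
      then have "2 * p + 4 \<le> 4 * 2 ^ a" by presburger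
      then show ?thesis by simp
    qed
    then have "real_of_int (2 * p + 4) \<le> real_of_int (2 ^ (a + 2))" by (simp only: of_int_le_iff)
    then show "r + 1 \<le> 2 ^ a" unfolding r_def by simp
    show "0 \<le> r" unfolding r_def using p by simp
  qed
  have R: "r * 2 ^ (n - a) = real_of_int (p * 2 ^ (n - a - 1))"
  proof -
    have "(2::real) ^ (n - a) = 2 * 2 ^ (n - a - 1)" using an by (cases "n - a") auto
    then show ?thesis unfolding r_def by simp
  qed
  have R2: "r * 2 ^ (a + 2 - a) = real_of_int (2 * p)"
    unfolding r_def diff_add_inverse by simp
  have x: "r \<le> 2 ^ a * x t \<and> 2 ^ a * x t < r + 1" if "t \<in> S'" for t
  proof -
    define u where "u = (if t \<in> cell x S (a + 2) i then i else j)"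
    have u: "u = i \<or> u = j" "t \<in> cell x S (a + 2) u"
      using that unfolding S'_def u_def by (simp_all only: Un_iff split: if_splits) blast+
    have "2 * p \<le> u" "u + 1 \<le> 2 * p + 4" using u(1) p by (elim disjE; simp)+
    then have "real_of_int (2 * p) \<le> real_of_int u" "real_of_int (u + 1) \<le> real_of_int (2 * p + 4)"
      by (simp_all only: of_int_le_iff)
    then have h: "2 * real_of_int p \<le> real_of_int u" "real_of_int u + 1 \<le> 2 * real_of_int p + 4" by simp_all
    have e: "2 ^ (a + 2) * x t = 4 * (2 ^ a * x t)" by simp
    have aux: "q / 2 \<le> Z \<and> Z < q / 2 + 1"
      if "2 * q \<le> v" "v + 1 \<le> 2 * q + 4" "v \<le> 4 * Z" "4 * Z < v + 1" for q v Z :: real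
      using that by simp
    show ?thesis unfolding r_def
      by (rule aux[OF h]) (use cell_bounds[OF u(2)] in \<open>simp_all only: e\<close>)
  qed
  have S'S: "S' \<subseteq> S" unfolding S'_def by (auto simp: cell_def)
  define x' where "x' = (\<lambda>t. 2 ^ a * x t - r)"
  have sys': "vsystem k c K (n - a) \<Omega> \<nu> S' x' e"
    unfolding x'_def by (rule vsystem_rescale[OF sys an' r S'S x K])
  have cells: "cell x' S' 2 u = cell x S' (a + 2) (u + 2 * p)" for u
    using cell_rescale[OF _ R2, of x S' u] unfolding x'_def by simp
  have ci: "cell x' S' 2 (i - 2 * p) = cell x S (a + 2) i"
  proof -
    have "cell x' S' 2 (i - 2 * p) = cell x S' (a + 2) i" by (simp only: cells diff_add_cancel)
    also have "\<dots> = cell x S (a + 2) i" unfolding S'_def cell_def by blast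
    finally show ?thesis .
  qed
  have cj: "cell x' S' 2 (j - 2 * p) = cell x S (a + 2) j"
  proof -
    have "cell x' S' 2 (j - 2 * p) = cell x S' (a + 2) j" by (simp only: cells diff_add_cancel)
    also have "\<dots> = cell x S (a + 2) j" unfolding S'_def cell_def by blast
    finally show ?thesis .
  qed
  have sq: "sqsum \<Omega> \<nu> x' e (moment_degree k) (n - a) (cell x S (a + 2) u)
      = sqsum \<Omega> \<nu> x e (moment_degree k) n (cell x S (a + 2) u)" if "u = i \<or> u = j" for u
    unfolding x'_def
    by (rule sqsum_rescale[OF an' R r x moment_degree_pos[OF k]]) (use that in \<open>unfold S'_def, blast\<close>)
  have "separated 2 (i - 2 * p) 2 (j - 2 * p)"
  proof -
    have "real_of_int (i - 2 * p + 2) \<le> real_of_int (j - 2 * p)"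
      using ij(3) by (simp only: of_int_le_iff)
    moreover have "(U + 1) / 2 ^ 2 + 1 / 4 \<le> V / 2 ^ 2" if "U + 2 \<le> V" for U V :: real
    proof -
      have "(U + 1) / 2 ^ 2 + 1 / 4 = (U + 2) / 2 ^ 2" by (simp add: add_divide_distrib)
      also have "\<dots> \<le> V / 2 ^ 2" using that by (intro divide_right_mono) auto
      finally show ?thesis .
    qed
    ultimately have "real_of_int (i - 2 * p + 1) / 2 ^ 2 + 1 / 4 \<le> real_of_int (j - 2 * p) / 2 ^ 2"
      unfolding of_int_add of_int_1 of_int_numeral by blast
    then show ?thesis using p unfolding separated_def by (intro conjI disjI1) simp_all
  qed
  from bilinear_decouplingD[OF bil sys' this] show ?thesis
    unfolding ci cj sq[OF disjI1[OF refl]] sq[OF disjI2[OF refl]] .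
qed

lemma pair_sum_cells:
  assumes "finite S" "\<And>t. t \<in> S \<Longrightarrow> 0 \<le> x t \<and> x t < 1"
  shows "(\<Sum>(t, t')\<in>{(t, t') \<in> S \<times> S. P \<lfloor>2 ^ m * x t\<rfloor> \<lfloor>2 ^ m * x t'\<rfloor>}. e t \<omega> * e t' \<omega>)
    = (\<Sum>(i, j)\<in>{(i, j) \<in> {0..<2 ^ m} \<times> {0..<2 ^ m}. P i j}.
        expsum e (cell x S m i) \<omega> * expsum e (cell x S m j) \<omega>)"
proof -
  let ?A = "{(t, t') \<in> S \<times> S. P \<lfloor>2 ^ m * x t\<rfloor> \<lfloor>2 ^ m * x t'\<rfloor>}"
  let ?B = "{(i, j) \<in> {0..<2 ^ m} \<times> {0..<2 ^ m}. P i j}"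
  let ?g = "\<lambda>(t, t'). (\<lfloor>2 ^ m * x t\<rfloor>, \<lfloor>2 ^ m * x t'\<rfloor>)"
  have "(\<Sum>(t, t')\<in>?A. e t \<omega> * e t' \<omega>) = (\<Sum>p\<in>?B. \<Sum>(t, t')\<in>{q \<in> ?A. ?g q = p}. e t \<omega> * e t' \<omega>)"
  proof (rule sum.group[symmetric])
    show "finite ?A" by (rule finite_subset[of _ "S \<times> S"]) (use assms in auto)
    show "finite ?B" by (rule finite_subset[of _ "{0..<2 ^ m} \<times> {0..<2 ^ m}"]) auto
    show "?g ` ?A \<subseteq> ?B" using floor_power2_range assms(2) by (auto simp del: atLeastLessThan_iff)
  qed
  also have "\<dots> = (\<Sum>(i, j)\<in>?B. expsum e (cell x S m i) \<omega> * expsum e (cell x S m j) \<omega>)"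
  proof (rule sum.cong[OF refl])
    fix p assume p: "p \<in> ?B"
    obtain i j where ij: "p = (i, j)" by (cases p)
    have "{q \<in> ?A. ?g q = p} = cell x S m i \<times> cell x S m j"
      using p unfolding ij cell_def by auto
    then show "(\<Sum>(t, t')\<in>{q \<in> ?A. ?g q = p}. e t \<omega> * e t' \<omega>)
        = (case p of (i, j) \<Rightarrow> expsum e (cell x S m i) \<omega> * expsum e (cell x S m j) \<omega>)"
      unfolding ij expsum_def by (simp add: sum_product sum.cartesian_product)
  qed
  finally show ?thesis .
qed

text \<open>These are the facts about parents and children of dyadic intervals behind the Whitney
  decomposition of the unit square around its diagonal; the bound 3 limits the partners of a cell to
  7.\<close>

lemma int_div2_close:
  fixes i j :: int
  shows "\<bar>i - j\<bar> \<le> 1 \<Longrightarrow> \<bar>i div 2 - j div 2\<bar> \<le> 1"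
    and "\<bar>i div 2 - j div 2\<bar> \<le> 1 \<Longrightarrow> \<bar>i - j\<bar> \<le> 3"
    and "\<bar>i div 2 - j div 2\<bar> \<le> 1 \<Longrightarrow> \<not> \<bar>i - j\<bar> \<le> 1 \<Longrightarrow> i < j \<Longrightarrow>
      i + 2 \<le> j \<and> j div 2 = i div 2 + 1"
  by linarith+

text \<open>The square of the exponential sum is split according to the dyadic scale at which two
  positions cease to be adjacent.\<close>

lemma decoupling_from_bilinear:
  assumes bil: "\<And>m. 2 \<le> m \<Longrightarrow> m \<le> n \<Longrightarrow> bilinear_decoupling k c K m B"
    and K: "K \<ge> 0" and k: "k \<ge> 1" and B: "B \<ge> 1"
  shows "decoupling k c K n (7 * (real n + 1) * B)"
  unfolding decoupling_def
proof (intro allI impI)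
  fix \<Omega> :: "nat set" and \<nu> and S :: "real set" and x e
  assume sys: "vsystem k c K n \<Omega> \<nu> S x e"
  have fin: "finite \<Omega>" "\<And>\<omega>. \<omega> \<in> \<Omega> \<Longrightarrow> \<nu> \<omega> \<ge> 0" "finite S"
    and x01: "\<And>t. t \<in> S \<Longrightarrow> 0 \<le> x t \<and> x t < 1"
    using sys unfolding vsystem_def by auto
  define d where "d = moment_degree k"
  have d: "d \<ge> 1" unfolding d_def by (rule moment_degree_pos[OF k])
  define F where "F m i = expsum e (cell x S m i)" for m i
  define sq where "sq m i = sqsum \<Omega> \<nu> x e d n (cell x S m i)" for m i
  define total where "total = sqsum \<Omega> \<nu> x e d n S"
  have total0: "total \<ge> 0" unfolding total_def by (rule sqsum_nonneg)
  have sq0: "sq m i \<ge> 0" for m i unfolding sq_def by (rule sqsum_nonneg)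
  have sqtotal: "(\<Sum>i\<in>{0..<2 ^ m}. sq m i) = total" if "m \<le> n" for m
    unfolding sq_def total_def by (rule sqsum_cells[OF that d, symmetric])
  define fl where "fl m t = \<lfloor>2 ^ m * x t\<rfloor>" for m t
  \<comment> \<open>Pairs in equal or adjacent cells at scale m. These sets decrease with m, and
    their successive differences are the layers of the decomposition.\<close>
  define T where "T m = {(t, t') \<in> S \<times> S. \<bar>fl m t - fl m t'\<bar> \<le> 1}" for m
  define ee where "ee \<omega> = (\<lambda>(t, t'). e t \<omega> * e t' \<omega>)" for \<omega>
  define g where "g m \<omega> = (if m < n then sum (ee \<omega>) (T m - T (Suc m)) else sum (ee \<omega>) (T n))" for m \<omega>
  have flS: "fl m t = fl (Suc m) t div 2" for m t
    using floor_power2_mult[of m "Suc m" "x t"] unfolding fl_def by simp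
  have finT: "finite (T m)" for m
    unfolding T_def by (rule finite_subset[of _ "S \<times> S"]) (use fin in auto)
  have Tmono: "T (Suc m) \<subseteq> T m" for m
    unfolding T_def using int_div2_close(1) flS[of m] by auto
  have tel: "sum (ee \<omega>) (T 0) = (\<Sum>m<N. sum (ee \<omega>) (T m - T (Suc m))) + sum (ee \<omega>) (T N)" for N \<omega>
  proof (induction N)
    case (Suc N)
    have "sum (ee \<omega>) (T N) = sum (ee \<omega>) (T N - T (Suc N)) + sum (ee \<omega>) (T (Suc N))"
      using sum.subset_diff[OF Tmono finT] .
    then show ?case using Suc by simp
  qed simp
  have sq_eq: "expsum e S \<omega> ^ 2 = (\<Sum>m\<in>{..n}. g m \<omega>)" for \<omega>
  proof -
    have "fl 0 t = 0" if "t \<in> S" for t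
      using x01[OF that] unfolding fl_def by (simp add: floor_eq_iff)
    then have "T 0 = S \<times> S" unfolding T_def by auto
    then have "expsum e S \<omega> ^ 2 = sum (ee \<omega>) (T 0)"
      unfolding expsum_def ee_def power2_eq_square sum_product by (simp add: sum.cartesian_product)
    also have "\<dots> = (\<Sum>m<n. g m \<omega>) + g n \<omega>"
      unfolding tel[of \<omega> n] by (simp add: g_def)
    finally show ?thesis by (simp add: lessThan_Suc_atMost[symmetric])
  qed
  \<comment> \<open>A layer pairs each cell with at most 2 * 3 + 1 = 7 cells, the source of the
    constant 7. The arithmetic mean replaces the geometric one so that the square sums add up to
    \<open>total\<close>.\<close>
  have pair: "(\<Sum>\<omega>\<in>\<Omega>. \<nu> \<omega> * cmod (\<Sum>(i, j)\<in>W. F M i \<omega> * F M j \<omega>) ^ d) \<le> (7 * B * total) ^ d"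
    if W: "W \<subseteq> {(i, j) \<in> {0..<2 ^ M} \<times> {0..<2 ^ M}. \<bar>i - j\<bar> \<le> int 3}" and M: "M \<le> n"
      and each: "\<And>i j. (i, j) \<in> W \<Longrightarrow>
        (\<Sum>\<omega>\<in>\<Omega>. \<nu> \<omega> * (cmod (F M i \<omega>) ^ d * cmod (F M j \<omega>) ^ d)) \<le> (B * sqrt (sq M i * sq M j)) ^ d" for W M
  proof -
    let ?band = "{(i, j) \<in> {0..<2 ^ M} \<times> {0..<2 ^ M}. \<bar>i - j\<bar> \<le> int 3}"
    have finb: "finite ?band"
      by (rule finite_subset[of _ "{0..<2 ^ M} \<times> {0..<2 ^ M}"]) auto
    have "(\<Sum>\<omega>\<in>\<Omega>. \<nu> \<omega> * cmod (\<Sum>p\<in>W. F M (fst p) \<omega> * F M (snd p) \<omega>) ^ d)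
        \<le> (\<Sum>p\<in>W. B * ((sq M (fst p) + sq M (snd p)) / 2)) ^ d"
    proof (rule Minkowski_sum_power[OF fin(1) d fin(2)])
      show "finite W" using W finb finite_subset by blast
      fix p assume "p \<in> W"
      then have "(\<Sum>\<omega>\<in>\<Omega>. \<nu> \<omega> * (cmod (F M (fst p) \<omega>) ^ d * cmod (F M (snd p) \<omega>) ^ d))
          \<le> (B * sqrt (sq M (fst p) * sq M (snd p))) ^ d"
        using each[of "fst p" "snd p"] by simp
      also have "\<dots> \<le> (B * ((sq M (fst p) + sq M (snd p)) / 2)) ^ d"
        using sq0 B arith_geo_mean_sqrt[of "sq M (fst p)" "sq M (snd p)"]
        by (intro power_mono mult_left_mono mult_nonneg_nonneg) auto
      finally show "0 \<le> B * ((sq M (fst p) + sq M (snd p)) / 2) \<and>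
          (\<Sum>\<omega>\<in>\<Omega>. \<nu> \<omega> * cmod (F M (fst p) \<omega> * F M (snd p) \<omega>) ^ d)
            \<le> (B * ((sq M (fst p) + sq M (snd p)) / 2)) ^ d"
        using sq0 B by (simp add: norm_mult power_mult_distrib)
    qed
    also have "\<dots> \<le> (7 * B * total) ^ d"
    proof (intro power_mono)
      have "(\<Sum>p\<in>W. B * ((sq M (fst p) + sq M (snd p)) / 2))
          \<le> (\<Sum>p\<in>?band. B * ((sq M (fst p) + sq M (snd p)) / 2))"
        using W finb sq0 B by (intro sum_mono2) auto
      also have "\<dots> = B * (\<Sum>(i, j)\<in>?band. (sq M i + sq M j) / 2)"
        by (simp add: sum_distrib_left split_def)
      also have "\<dots> \<le> B * ((2 * real 3 + 1) * (\<Sum>i\<in>{0..<2 ^ M}. sq M i))"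
        using sq0 B by (intro mult_left_mono sum_shift_band) auto
      finally show "(\<Sum>p\<in>W. B * ((sq M (fst p) + sq M (snd p)) / 2)) \<le> 7 * B * total"
        unfolding sqtotal[OF M] by simp
      show "0 \<le> (\<Sum>p\<in>W. B * ((sq M (fst p) + sq M (snd p)) / 2))"
        using sq0 B by (intro sum_nonneg) auto
    qed
    finally show ?thesis by (simp add: split_def)
  qed
  have bound: "(\<Sum>\<omega>\<in>\<Omega>. \<nu> \<omega> * cmod (g m \<omega>) ^ d) \<le> (7 * B * total) ^ d" if m: "m \<le> n" for m
  proof (cases "m = n")
    case True
    let ?W = "{(i, j) \<in> {0..<(2::int) ^ n} \<times> {0..<2 ^ n}. \<bar>i - j\<bar> \<le> 1}"
    have "g m \<omega> = (\<Sum>(i, j)\<in>?W. F n i \<omega> * F n j \<omega>)" for \<omega>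
      unfolding True g_def T_def ee_def fl_def F_def
      using pair_sum_cells[OF fin(3) x01, where P = "\<lambda>i j. \<bar>i - j\<bar> \<le> 1" and m = n and e = e and \<omega> = \<omega>] by simp
    moreover have "(\<Sum>\<omega>\<in>\<Omega>. \<nu> \<omega> * cmod (\<Sum>(i, j)\<in>?W. F n i \<omega> * F n j \<omega>) ^ d) \<le> (7 * B * total) ^ d"
    proof (rule pair)
      fix i j assume ij: "(i, j) \<in> ?W"
      \<comment> \<open>At the finest scale the square sum of a cell has a single term, so
        Cauchy-Schwarz alone handles the pairs that are still adjacent.\<close>
      have sqn: "moment \<Omega> \<nu> (2 * d) (F n u) = sq n u ^ d" if "u \<in> {0..<2 ^ n}" for u
      proof -
        have "sq n u = (\<Sum>i\<in>{0..<2 ^ n}. if i = u then moment \<Omega> \<nu> (2 * d) (F n u) powr (1 / real d) else 0)"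
          unfolding sq_def sqsum_def F_def using d by (intro sum.cong refl) (auto simp: cell_cell)
        also have "\<dots> = moment \<Omega> \<nu> (2 * d) (F n u) powr (1 / real d)" using that by simp
        finally show ?thesis using fin(2) d by (simp add: moment_powr_power)
      qed
      let ?X = "\<Sum>\<omega>\<in>\<Omega>. \<nu> \<omega> * (cmod (F n i \<omega>) ^ d * cmod (F n j \<omega>) ^ d)"
      have h1: "?X ^ 2 \<le> (\<Sum>\<omega>\<in>\<Omega>. \<nu> \<omega> * cmod (F n i \<omega>) ^ (2 * d)) ^ (2 - 1) * (\<Sum>\<omega>\<in>\<Omega>. \<nu> \<omega> * cmod (F n j \<omega>) ^ (2 * d))"
      proof (rule Holder_sum_power[OF fin(1)])
        fix \<omega> assume "\<omega> \<in> \<Omega>"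
        show "(cmod (F n i \<omega>) ^ d * cmod (F n j \<omega>) ^ d) ^ 2
            = (cmod (F n i \<omega>) ^ (2 * d)) ^ (2 - 1) * cmod (F n j \<omega>) ^ (2 * d)"
          by (simp add: power_mult_distrib power_even_eq)
      qed (use fin in auto)
      have h2: "(\<Sum>\<omega>\<in>\<Omega>. \<nu> \<omega> * cmod (F n u \<omega>) ^ (2 * d)) = sq n u ^ d" if "u \<in> {0..<2 ^ n}" for u
        using sqn[OF that] unfolding moment_def .
      have h3: "sq n i ^ d * sq n j ^ d = (sqrt (sq n i * sq n j) ^ d) ^ 2"
      proof -
        have "(sqrt (sq n i * sq n j) ^ d) ^ 2 = (sqrt (sq n i * sq n j) ^ 2) ^ d"
          by (simp add: power_mult[symmetric] mult.commute)
        also have "sqrt (sq n i * sq n j) ^ 2 = sq n i * sq n j" using sq0 by simp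
        finally show ?thesis by (simp add: power_mult_distrib)
      qed
      have "?X ^ 2 \<le> (sqrt (sq n i * sq n j) ^ d) ^ 2"
        using h1 h2[of i] h2[of j] ij unfolding h3[symmetric] by simp
      then have "?X \<le> sqrt (sq n i * sq n j) ^ d"
        by (rule power2_le_imp_le) (use sq0 in simp)
      also have "\<dots> \<le> (B * sqrt (sq n i * sq n j)) ^ d"
      proof (intro power_mono)
        have "1 * sqrt (sq n i * sq n j) \<le> B * sqrt (sq n i * sq n j)"
          using B sq0 by (intro mult_right_mono) auto
        then show "sqrt (sq n i * sq n j) \<le> B * sqrt (sq n i * sq n j)" by simp
      qed (use sq0 in simp)
      finally show "?X \<le> (B * sqrt (sq n i * sq n j)) ^ d" .
    qed auto
    ultimately show ?thesis by simp
  next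
    case False
    then have mn: "Suc m \<le> n" using m by simp
    let ?P = "\<lambda>i j. \<bar>i div 2 - j div 2\<bar> \<le> 1 \<and> \<not> \<bar>i - j\<bar> \<le> (1::int)"
    let ?W = "{(i, j) \<in> {0..<(2::int) ^ Suc m} \<times> {0..<2 ^ Suc m}. ?P i j}"
    have "T m - T (Suc m) = {(t, t') \<in> S \<times> S. ?P (fl (Suc m) t) (fl (Suc m) t')}"
      unfolding T_def flS[of m] by auto
    then have "g m \<omega> = (\<Sum>(i, j)\<in>?W. F (Suc m) i \<omega> * F (Suc m) j \<omega>)" for \<omega>
      unfolding g_def ee_def F_def
      using pair_sum_cells[OF fin(3) x01, where P = ?P and m = "Suc m" and e = e and \<omega> = \<omega>] mn by (simp add: fl_def)
    moreover have "(\<Sum>\<omega>\<in>\<Omega>. \<nu> \<omega> * cmod (\<Sum>(i, j)\<in>?W. F (Suc m) i \<omega> * F (Suc m) j \<omega>) ^ d)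
        \<le> (7 * B * total) ^ d"
    proof (rule pair[OF _ mn])
      show "?W \<subseteq> {(i, j) \<in> {0..<2 ^ Suc m} \<times> {0..<2 ^ Suc m}. \<bar>i - j\<bar> \<le> int 3}"
        using int_div2_close(2) by auto
      fix i j assume ij: "(i, j) \<in> ?W"
      \<comment> \<open>The two cells at scale 1 are adjacent, so a pair in this layer forces
        \<open>Suc m\<close> to be at least 2.\<close>
      have "m \<noteq> 0"
      proof
        assume "m = 0"
        then have "0 \<le> i" "i < 2" "0 \<le> j" "j < 2" using ij by auto
        then show False using ij by auto
      qed
      then obtain a where a: "m = Suc a" by (cases m) auto
      have an: "a + 2 \<le> n" using mn a by simp
      have Sm: "Suc m = a + 2" using a by simp
      have bil': "bilinear_decoupling k c K (n - a) B" using an by (intro bil) auto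
      have main: "(\<Sum>\<omega>\<in>\<Omega>. \<nu> \<omega> * (cmod (F (Suc m) u \<omega>) ^ d * cmod (F (Suc m) v \<omega>) ^ d))
          \<le> (B * sqrt (sq (Suc m) u * sq (Suc m) v)) ^ d"
        if "(u, v) \<in> ?W" "u < v" for u v
        unfolding F_def sq_def d_def Sm
        by (rule bilinear_decoupling_rescaled[OF bil' sys an K k]) (use that Sm int_div2_close(3)[of u v] in auto)
      show "(\<Sum>\<omega>\<in>\<Omega>. \<nu> \<omega> * (cmod (F (Suc m) i \<omega>) ^ d * cmod (F (Suc m) j \<omega>) ^ d))
          \<le> (B * sqrt (sq (Suc m) i * sq (Suc m) j)) ^ d"
      proof (cases "i < j")
        case True
        then show ?thesis using main ij by blast
      next
        case False
        then have "(j, i) \<in> ?W" "j < i" using ij by auto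
        from main[OF this] show ?thesis by (simp add: mult.commute)
      qed
    qed
    ultimately show ?thesis by simp
  qed
  \<comment> \<open>The 2d-th moment of the sum is the d-th moment of its square, so Minkowski over
    the n + 1 layers applies.\<close>
  have "moment \<Omega> \<nu> (2 * d) (expsum e S) = (\<Sum>\<omega>\<in>\<Omega>. \<nu> \<omega> * cmod (\<Sum>m\<in>{..n}. g m \<omega>) ^ d)"
    unfolding moment_def sq_eq[symmetric] by (simp add: norm_power power_mult)
  also have "\<dots> \<le> (\<Sum>m\<in>{..n}. 7 * B * total) ^ d"
    using bound total0 B fin d by (intro Minkowski_sum_power) auto
  also have "(\<Sum>m\<in>{..n}. 7 * B * total) = 7 * (real n + 1) * B * total" by simp
  finally show "moment \<Omega> \<nu> (2 * moment_degree k) (expsum e S)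
          \<le> (7 * (real n + 1) * B * sqsum \<Omega> \<nu> x e (moment_degree k) n S) ^ moment_degree k"
    unfolding d_def total_def .
qed

section \<open>Mixed moments over cells of different lengths\<close>

text \<open>The critical exponent of degree k is shared between a cell of length 2^-a, which
  receives the critical exponent of degree l, and a cell of length 2^-b, which receives the rest.
  The normalisation makes \<open>M\<close> comparable with the constant in
  \<open>decoupling\<close>.\<close>

definition mixed_bound :: "nat \<Rightarrow> real \<Rightarrow> real \<Rightarrow> nat \<Rightarrow> nat \<Rightarrow> nat \<Rightarrow> nat \<Rightarrow> real \<Rightarrow> bool" where
  "mixed_bound k c K n l a b M \<longleftrightarrow>
     (\<forall>\<Omega> \<nu> S x e i j. vsystem k c K n (\<Omega> :: nat set) \<nu> (S :: real set) x e \<and> separated a i b j \<longrightarrow>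
        (\<Sum>\<omega>\<in>\<Omega>. \<nu> \<omega> * (cmod (expsum e (cell x S a i) \<omega>) ^ (2 * moment_degree l)
            * cmod (expsum e (cell x S b j) \<omega>) ^ (2 * (moment_degree k - moment_degree l))))
          \<le> M ^ moment_degree k
            * (sqsum \<Omega> \<nu> x e (moment_degree k) n (cell x S a i) ^ moment_degree l
            * sqsum \<Omega> \<nu> x e (moment_degree k) n (cell x S b j) ^ (moment_degree k - moment_degree l)))"

lemma mixed_boundD:
  assumes "mixed_bound k c K n l a b M" "vsystem k c K n (\<Omega> :: nat set) \<nu> (S :: real set) x e"
    "separated a i b j"
  shows "(\<Sum>\<omega>\<in>\<Omega>. \<nu> \<omega> * (cmod (expsum e (cell x S a i) \<omega>) ^ (2 * moment_degree l)
            * cmod (expsum e (cell x S b j) \<omega>) ^ (2 * (moment_degree k - moment_degree l))))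
          \<le> M ^ moment_degree k
            * (sqsum \<Omega> \<nu> x e (moment_degree k) n (cell x S a i) ^ moment_degree l
            * sqsum \<Omega> \<nu> x e (moment_degree k) n (cell x S b j) ^ (moment_degree k - moment_degree l))"
  using assms unfolding mixed_bound_def by blast

lemma mixed_bound_mono:
  assumes "mixed_bound k c K n l a b M" "0 \<le> M" "M \<le> M'"
  shows "mixed_bound k c K n l a b M'"
  unfolding mixed_bound_def
proof (intro allI impI, elim conjE)
  fix \<Omega> :: "nat set" and \<nu> and S :: "real set" and x e i j
  assume "vsystem k c K n \<Omega> \<nu> S x e" "separated a i b j"
  from mixed_boundD[OF assms(1) this]
  show "(\<Sum>\<omega>\<in>\<Omega>. \<nu> \<omega> * (cmod (expsum e (cell x S a i) \<omega>) ^ (2 * moment_degree l)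
            * cmod (expsum e (cell x S b j) \<omega>) ^ (2 * (moment_degree k - moment_degree l))))
          \<le> M' ^ moment_degree k
            * (sqsum \<Omega> \<nu> x e (moment_degree k) n (cell x S a i) ^ moment_degree l
            * sqsum \<Omega> \<nu> x e (moment_degree k) n (cell x S b j) ^ (moment_degree k - moment_degree l))"
    by (rule order_trans) (use assms sqsum_nonneg in \<open>intro mult_right_mono power_mono mult_nonneg_nonneg zero_le_power\<close>)
qed

lemma separated_sym: "separated a i b j \<longleftrightarrow> separated b j a i"
  unfolding separated_def by blast

lemma separated_child:
  assumes "separated a i b j" "a \<le> a'" "u div 2 ^ (a' - a) = i"
  shows "separated a' u b j"
proof -
  define m where "m = a' - a"
  have a': "a' = a + m" unfolding m_def using assms by simp
  have e: "u = i * 2 ^ m + u mod 2 ^ m"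
    using assms(3) div_mult_mod_eq[of u "2 ^ m"] unfolding m_def[symmetric] by simp
  have md: "0 \<le> u mod 2 ^ m" "u mod 2 ^ m < 2 ^ m" by simp_all
  have e': "(i + 1) * 2 ^ m = i * 2 ^ m + 2 ^ m" by (simp add: algebra_simps)
  have lo: "i * 2 ^ m \<le> u" using e md by linarith
  have up: "u + 1 \<le> (i + 1) * 2 ^ m" using e e' md by linarith
  have i: "0 \<le> i" "i + 1 \<le> 2 ^ a" using assms(1) unfolding separated_def by auto
  have "0 \<le> i * 2 ^ m" using i(1) by simp
  then have u0: "0 \<le> u" using lo by linarith
  have "(i + 1) * 2 ^ m \<le> 2 ^ a * 2 ^ m" using i by (intro mult_right_mono) auto
  then have u1: "u < 2 ^ a'" using up unfolding a' power_add by linarith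
  have "real_of_int (i * 2 ^ m) \<le> real_of_int u" using lo by (simp only: of_int_le_iff)
  then have "real_of_int (i * 2 ^ m) / 2 ^ a' \<le> real_of_int u / 2 ^ a'" by (intro divide_right_mono) auto
  then have 1: "real_of_int i / 2 ^ a \<le> real_of_int u / 2 ^ a'" unfolding a' power_add by simp
  have "real_of_int (u + 1) \<le> real_of_int ((i + 1) * 2 ^ m)" using up by (simp only: of_int_le_iff)
  then have "real_of_int (u + 1) / 2 ^ a' \<le> real_of_int ((i + 1) * 2 ^ m) / 2 ^ a'" by (intro divide_right_mono) auto
  also have "\<dots> = real_of_int (i + 1) / 2 ^ a" unfolding a' power_add by simp
  finally have 2: "real_of_int (u + 1) / 2 ^ a' \<le> real_of_int (i + 1) / 2 ^ a" .
  show ?thesis using assms(1) 1 2 u0 u1 unfolding separated_def by linarith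
qed

text \<open>For l = 0 the first cell drops out, and what remains is rescaled decoupling on the
  second cell at scale n - b. The shortened scale is the origin of all gain: it saves \<eta> b in
  the exponent.\<close>

lemma mixed_bound_zero:
  assumes "decoupling k c K (n - b) B" "b \<le> n" "K \<ge> 0" "k \<ge> 1"
  shows "mixed_bound k c K n 0 a b B"
  unfolding mixed_bound_def
proof (intro allI impI, elim conjE)
  fix \<Omega> :: "nat set" and \<nu> and S :: "real set" and x e i j
  assume sys: "vsystem k c K n \<Omega> \<nu> S x e" and sep: "separated a i b j"
  have "0 \<le> j" "j < 2 ^ b" using sep unfolding separated_def by auto
  from decoupling_rescaled[OF assms(1) sys assms(2) this assms(3,4)]
  show "(\<Sum>\<omega>\<in>\<Omega>. \<nu> \<omega> * (cmod (expsum e (cell x S a i) \<omega>) ^ (2 * moment_degree 0)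
            * cmod (expsum e (cell x S b j) \<omega>) ^ (2 * (moment_degree k - moment_degree 0))))
          \<le> B ^ moment_degree k
            * (sqsum \<Omega> \<nu> x e (moment_degree k) n (cell x S a i) ^ moment_degree 0
            * sqsum \<Omega> \<nu> x e (moment_degree k) n (cell x S b j) ^ (moment_degree k - moment_degree 0))"
    unfolding moment_def by (simp add: moment_degree_def[of 0] power_mult_distrib)
qed

text \<open>A substitute for Hoelder with exponents (p + q) / p and (p + q) / q that avoids roots:
  after normalising, u^p v^q \<le> max(u, v)^(p + q) \<le> u^(p + q) + v^(p + q), at the cost of a
  factor 2.\<close>

lemma product_moment_bound:
  fixes \<nu> f g :: "'a \<Rightarrow> real"
  assumes "finite A" and nonneg: "\<And>a. a \<in> A \<Longrightarrow> \<nu> a \<ge> 0 \<and> f a \<ge> 0 \<and> g a \<ge> 0"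
    and p: "p \<ge> 1" and q: "q \<ge> 1" and "b \<ge> 0" "c \<ge> 0"
    and f: "(\<Sum>a\<in>A. \<nu> a * f a ^ (p + q)) \<le> b ^ (p + q)"
    and g: "(\<Sum>a\<in>A. \<nu> a * g a ^ (p + q)) \<le> c ^ (p + q)"
  shows "(\<Sum>a\<in>A. \<nu> a * (f a ^ p * g a ^ q)) \<le> 2 * (b ^ p * c ^ q)"
proof -
  have zero: "(\<Sum>a\<in>A. \<nu> a * (f a ^ p * g a ^ q)) = 0"
    if "(\<Sum>a\<in>A. \<nu> a * h a ^ (p + q)) \<le> 0" "h = f \<or> h = g" for h
  proof (rule sum.neutral, rule ballI)
    fix a assume a: "a \<in> A"
    have h0: "\<And>a. a \<in> A \<Longrightarrow> 0 \<le> \<nu> a * h a ^ (p + q)" using that(2) nonneg by auto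
    then have "(\<Sum>a\<in>A. \<nu> a * h a ^ (p + q)) = 0"
      using that(1) by (intro antisym sum_nonneg) auto
    then have "\<nu> a * h a ^ (p + q) = 0"
      using sum_nonneg_eq_0_iff[OF assms(1) h0] a by auto
    then have "\<nu> a = 0 \<or> h a = 0" by auto
    then show "\<nu> a * (f a ^ p * g a ^ q) = 0" using that(2) p q by auto
  qed
  consider "b = 0" | "c = 0" | "b > 0" "c > 0" using assms by linarith
  then show ?thesis
  proof cases
    case 1
    then have "(\<Sum>a\<in>A. \<nu> a * f a ^ (p + q)) \<le> 0" using f p by (simp add: power_0_left)
    then show ?thesis using zero[of f] assms by simp
  next
    case 2
    then have "(\<Sum>a\<in>A. \<nu> a * g a ^ (p + q)) \<le> 0" using g p by (simp add: power_0_left)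
    then show ?thesis using zero[of g] assms by simp
  next
    case 3
    have pt: "f a ^ p * g a ^ q \<le> (b ^ p * c ^ q) * (f a ^ (p + q) / b ^ (p + q) + g a ^ (p + q) / c ^ (p + q))"
      if a: "a \<in> A" for a
    proof -
      define u where "u = f a / b"
      define v where "v = g a / c"
      have uv: "u \<ge> 0" "v \<ge> 0" unfolding u_def v_def using nonneg[OF a] 3 by auto
      have "u ^ p * v ^ q \<le> max u v ^ p * max u v ^ q"
        using uv by (intro mult_mono power_mono) auto
      also have "\<dots> = max u v ^ (p + q)" by (simp add: power_add)
      also have "\<dots> \<le> u ^ (p + q) + v ^ (p + q)" using uv by (auto simp: max_def)
      finally have "(b ^ p * c ^ q) * (u ^ p * v ^ q) \<le> (b ^ p * c ^ q) * (u ^ (p + q) + v ^ (p + q))"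
        using 3 by (intro mult_left_mono) auto
      moreover have "(b ^ p * c ^ q) * (u ^ p * v ^ q) = f a ^ p * g a ^ q"
        unfolding u_def v_def using 3 by (simp add: power_divide)
      ultimately show ?thesis unfolding u_def v_def by (simp only: power_divide)
    qed
    have "(\<Sum>a\<in>A. \<nu> a * (f a ^ p * g a ^ q))
        \<le> (\<Sum>a\<in>A. \<nu> a * ((b ^ p * c ^ q) * (f a ^ (p + q) / b ^ (p + q) + g a ^ (p + q) / c ^ (p + q))))"
      using pt nonneg by (intro sum_mono mult_left_mono) auto
    also have "\<dots> = (b ^ p * c ^ q) * ((\<Sum>a\<in>A. \<nu> a * f a ^ (p + q)) / b ^ (p + q)
        + (\<Sum>a\<in>A. \<nu> a * g a ^ (p + q)) / c ^ (p + q))"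
      unfolding sum_divide_distrib sum.distrib[symmetric] sum_distrib_left
      by (intro sum.cong refl) (simp add: algebra_simps)
    also have "\<dots> \<le> (b ^ p * c ^ q) * (1 + 1)"
      using f g 3 by (intro mult_left_mono add_mono) (auto simp: divide_le_eq_1)
    finally show ?thesis by simp
  qed
qed

lemma moment_degree_strict_mono: "l < k \<Longrightarrow> moment_degree l < moment_degree k"
proof -
  assume "l < k"
  then have "2 * moment_degree l < 2 * moment_degree k"
    unfolding moment_degree_double by (intro mult_less_le_imp_less) auto
  then show ?thesis by simp
qed

text \<open>Decoupling each cell separately gives a bound without gain, the start of the iteration.
  The factor 2 in the constant swallows the one lost in \<open>product_moment_bound\<close>.\<close>

lemma mixed_bound_trivial:
  assumes "decoupling k c K (n - a) B" "decoupling k c K (n - b) B" "a \<le> n" "b \<le> n"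
    and K: "K \<ge> 0" and l: "1 \<le> l" "l < k" and B: "B \<ge> 0"
  shows "mixed_bound k c K n l a b (2 * B)"
  unfolding mixed_bound_def
proof (intro allI impI, elim conjE)
  fix \<Omega> :: "nat set" and \<nu> and S :: "real set" and x e i j
  assume sys: "vsystem k c K n \<Omega> \<nu> S x e" and sep: "separated a i b j"
  define D where "D = moment_degree k"
  define p where "p = moment_degree l"
  define q where "q = D - p"
  have p: "p \<ge> 1" unfolding p_def by (rule moment_degree_pos[OF l(1)])
  have q: "q \<ge> 1" unfolding q_def D_def p_def using moment_degree_strict_mono[OF l(2)] by simp
  have D: "D = p + q" using q unfolding q_def by simp
  have fin: "finite \<Omega>" "\<And>\<omega>. \<omega> \<in> \<Omega> \<Longrightarrow> \<nu> \<omega> \<ge> 0" using sys unfolding vsystem_def by auto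
  have ij: "0 \<le> i" "i < 2 ^ a" "0 \<le> j" "j < 2 ^ b" using sep unfolding separated_def by auto
  have k: "k \<ge> 1" using l by simp
  define f where "f \<omega> = (cmod (expsum e (cell x S a i) \<omega>))\<^sup>2" for \<omega>
  define g where "g \<omega> = (cmod (expsum e (cell x S b j) \<omega>))\<^sup>2" for \<omega>
  define sf where "sf = sqsum \<Omega> \<nu> x e D n (cell x S a i)"
  define sg where "sg = sqsum \<Omega> \<nu> x e D n (cell x S b j)"
  have s0: "sf \<ge> 0" "sg \<ge> 0" unfolding sf_def sg_def by (rule sqsum_nonneg)+
  have "(\<Sum>\<omega>\<in>\<Omega>. \<nu> \<omega> * (f \<omega> ^ p * g \<omega> ^ q)) \<le> 2 * ((B * sf) ^ p * (B * sg) ^ q)"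
  proof (rule product_moment_bound[OF fin(1) _ p q])
    show "(\<Sum>\<omega>\<in>\<Omega>. \<nu> \<omega> * f \<omega> ^ (p + q)) \<le> (B * sf) ^ (p + q)"
      using decoupling_rescaled[OF assms(1) sys assms(3) ij(1,2) K k]
      unfolding moment_def f_def sf_def D[symmetric] D_def by (simp only: power_mult)
    show "(\<Sum>\<omega>\<in>\<Omega>. \<nu> \<omega> * g \<omega> ^ (p + q)) \<le> (B * sg) ^ (p + q)"
      using decoupling_rescaled[OF assms(2) sys assms(4) ij(3,4) K k]
      unfolding moment_def g_def sg_def D[symmetric] D_def by (simp only: power_mult)
  qed (use fin s0 B in \<open>auto simp: f_def g_def\<close>)
  also have "\<dots> = 2 * B ^ D * (sf ^ p * sg ^ q)" unfolding D by (simp add: power_mult_distrib power_add)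
  also have "\<dots> \<le> (2 * B) ^ D * (sf ^ p * sg ^ q)"
  proof (intro mult_right_mono)
    have "(2::real) ^ 1 \<le> 2 ^ D" using D p by (intro power_increasing) auto
    then show "2 * B ^ D \<le> (2 * B) ^ D" using B by (simp add: power_mult_distrib mult_right_mono)
  qed (use s0 in auto)
  finally show "(\<Sum>\<omega>\<in>\<Omega>. \<nu> \<omega> * (cmod (expsum e (cell x S a i) \<omega>) ^ (2 * moment_degree l)
            * cmod (expsum e (cell x S b j) \<omega>) ^ (2 * (moment_degree k - moment_degree l))))
          \<le> (2 * B) ^ moment_degree k
            * (sqsum \<Omega> \<nu> x e (moment_degree k) n (cell x S a i) ^ moment_degree l
            * sqsum \<Omega> \<nu> x e (moment_degree k) n (cell x S b j) ^ (moment_degree k - moment_degree l))"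
    unfolding f_def g_def sf_def sg_def q_def p_def D_def by (simp only: power_mult)
qed

text \<open>Writing d_j for \<open>moment_degree j\<close> and D for d_k, the pair of exponents
  (d_l, D - d_l) is the convex combination of (d_(l - 1), D - d_(l - 1)) and the reversed pair (D -
  d_(k - l), d_(k - l)) with weights (k - l) / (k - l + 1) and 1 / (k - l + 1).\<close>

lemma moment_degree_interpolation:
  assumes "1 \<le> l" "l < k"
  shows "(k - l + 1) * moment_degree l = (k - l) * moment_degree (l - 1) + (moment_degree k - moment_degree (k - l))"
    and "(k - l + 1) * (moment_degree k - moment_degree l)
      = (k - l) * (moment_degree k - moment_degree (l - 1)) + moment_degree (k - l)"
proof -
  obtain m where m: "k = l + m" using assms less_imp_add_positive by blast
  obtain l' where l': "l = Suc l'" using assms by (cases l) auto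
  have dm: "moment_degree m \<le> moment_degree k" "moment_degree l \<le> moment_degree k"
      "moment_degree l' \<le> moment_degree k"
    using m l' by (auto intro: moment_degree_mono)
  have r: "2 * real (moment_degree j) = real j * (real j + 1)" for j
    using arg_cong[OF moment_degree_double[of j], of real] by (simp add: algebra_simps)
  have "2 * (real (m + 1) * real (moment_degree l)) = 2 * (real m * real (moment_degree l')
      + (real (moment_degree k) - real (moment_degree m)))"
    unfolding distrib_left mult.left_commute[of 2] right_diff_distrib r
    by (simp add: m l' algebra_simps)
  then have base: "real (m + 1) * real (moment_degree l) = real m * real (moment_degree l')
      + (real (moment_degree k) - real (moment_degree m))" by (simp only: mult_cancel_left) simp
  then have 1: "real ((m + 1) * moment_degree l) = real (m * moment_degree l' + (moment_degree k - moment_degree m))"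
    using dm by (simp add: of_nat_diff algebra_simps)
  then show "(k - l + 1) * moment_degree l = (k - l) * moment_degree (l - 1) + (moment_degree k - moment_degree (k - l))"
    unfolding m l' by (simp only: of_nat_eq_iff) simp
  have "real (m + 1) * (real (moment_degree k) - real (moment_degree l))
      = real m * (real (moment_degree k) - real (moment_degree l')) + real (moment_degree m)"
    using base by (simp add: algebra_simps)
  moreover have "real ((m + 1) * (moment_degree k - moment_degree l))
      = real (m + 1) * (real (moment_degree k) - real (moment_degree l))"
    by (simp only: of_nat_mult of_nat_diff[OF dm(2)])
  moreover have "real (m * (moment_degree k - moment_degree l') + moment_degree m)
      = real m * (real (moment_degree k) - real (moment_degree l')) + real (moment_degree m)"
    by (simp only: of_nat_add of_nat_mult of_nat_diff[OF dm(3)])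
  ultimately have "real ((m + 1) * (moment_degree k - moment_degree l))
      = real (m * (moment_degree k - moment_degree l') + moment_degree m)"
    by (simp only:)
  then show "(k - l + 1) * (moment_degree k - moment_degree l)
      = (k - l) * (moment_degree k - moment_degree (l - 1)) + moment_degree (k - l)"
    unfolding m l' by (simp only: of_nat_eq_iff) simp
qed

text \<open>Hoelder with the weights of \<open>moment_degree_interpolation\<close>. The second
  ingredient is used with the two cells exchanged, hence the swapped a and b in
  \<open>Y\<close>.\<close>

lemma mixed_bound_interpolate:
  assumes l: "1 \<le> l" "l < k"
    and X: "mixed_bound k c K n (l - 1) a b MX" and Y: "mixed_bound k c K n (k - l) b a MY"
    and M: "MX \<ge> 0" "MY \<ge> 0" "M \<ge> 0" "MX ^ (k - l) * MY \<le> M ^ (k - l + 1)"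
  shows "mixed_bound k c K n l a b M"
  unfolding mixed_bound_def
proof (intro allI impI, elim conjE)
  fix \<Omega> :: "nat set" and \<nu> and S :: "real set" and x e i j
  assume sys: "vsystem k c K n \<Omega> \<nu> S x e" and sep: "separated a i b j"
  define D where "D = moment_degree k"
  define r where "r = k - l"
  have fin: "finite \<Omega>" "\<And>\<omega>. \<omega> \<in> \<Omega> \<Longrightarrow> \<nu> \<omega> \<ge> 0" using sys unfolding vsystem_def by auto
  define f where "f \<omega> = cmod (expsum e (cell x S a i) \<omega>)" for \<omega>
  define g where "g \<omega> = cmod (expsum e (cell x S b j) \<omega>)" for \<omega>
  define sf where "sf = sqsum \<Omega> \<nu> x e D n (cell x S a i)"
  define sg where "sg = sqsum \<Omega> \<nu> x e D n (cell x S b j)"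
  have s0: "sf \<ge> 0" "sg \<ge> 0" unfolding sf_def sg_def by (rule sqsum_nonneg)+
  define d where "d = moment_degree l"
  define d1 where "d1 = moment_degree (l - 1)"
  define d2 where "d2 = moment_degree r"
  have e1: "(r + 1) * d = r * d1 + (D - d2)" and e2: "(r + 1) * (D - d) = r * (D - d1) + d2"
    using moment_degree_interpolation[OF l] unfolding d_def d1_def d2_def D_def r_def by auto
  have interp: "(h1 ^ (t * d) * h2 ^ (t * (D - d))) ^ (r + 1)
      = (h1 ^ (t * d1) * h2 ^ (t * (D - d1))) ^ r * (h2 ^ (t * d2) * h1 ^ (t * (D - d2)))"
    for h1 h2 :: real and t
  proof -
    have x1: "t * d * (r + 1) = t * d1 * r + t * (D - d2)"
      using arg_cong[OF e1, of "\<lambda>z. t * z"] by (simp add: algebra_simps)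
    have x2: "t * (D - d) * (r + 1) = t * (D - d1) * r + t * d2"
      using arg_cong[OF e2, of "\<lambda>z. t * z"] by (simp add: algebra_simps)
    show ?thesis
      unfolding power_mult_distrib
      unfolding power_mult[symmetric]
      unfolding x1 x2
      unfolding power_add
      by (simp only: mult_ac)
  qed
  let ?Z = "\<Sum>\<omega>\<in>\<Omega>. \<nu> \<omega> * (f \<omega> ^ (2 * d) * g \<omega> ^ (2 * (D - d)))"
  let ?X = "\<Sum>\<omega>\<in>\<Omega>. \<nu> \<omega> * (f \<omega> ^ (2 * d1) * g \<omega> ^ (2 * (D - d1)))"
  let ?Y = "\<Sum>\<omega>\<in>\<Omega>. \<nu> \<omega> * (g \<omega> ^ (2 * d2) * f \<omega> ^ (2 * (D - d2)))"
  have fg0: "f \<omega> \<ge> 0" "g \<omega> \<ge> 0" for \<omega> unfolding f_def g_def by auto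
  have "?Z ^ (r + 1) \<le> ?X ^ (r + 1 - 1) * ?Y"
  proof (rule Holder_sum_power[OF fin(1)])
    fix \<omega> assume "\<omega> \<in> \<Omega>"
    show "(f \<omega> ^ (2 * d) * g \<omega> ^ (2 * (D - d))) ^ (r + 1)
      = (f \<omega> ^ (2 * d1) * g \<omega> ^ (2 * (D - d1))) ^ (r + 1 - 1) * (g \<omega> ^ (2 * d2) * f \<omega> ^ (2 * (D - d2)))"
      unfolding interp by simp
  qed (use fin fg0 in auto)
  also have "\<dots> \<le> (MX ^ D * (sf ^ d1 * sg ^ (D - d1))) ^ (r + 1 - 1) * (MY ^ D * (sg ^ d2 * sf ^ (D - d2)))"
  proof (intro mult_mono power_mono)
    show "?X \<le> MX ^ D * (sf ^ d1 * sg ^ (D - d1))"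
      using mixed_boundD[OF X sys sep] unfolding f_def g_def sf_def sg_def D_def d1_def .
    show "?Y \<le> MY ^ D * (sg ^ d2 * sf ^ (D - d2))"
      using mixed_boundD[OF Y sys sep[unfolded separated_sym[of a]]]
      unfolding f_def g_def sf_def sg_def D_def d2_def r_def .
  qed (use fin fg0 M s0 in \<open>auto intro!: sum_nonneg mult_nonneg_nonneg\<close>)
  also have "\<dots> = (MX ^ r * MY) ^ D * ((sf ^ d1 * sg ^ (D - d1)) ^ r * (sg ^ d2 * sf ^ (D - d2)))"
    by (simp add: power_mult_distrib mult_ac flip: power_mult)
  also have "\<dots> = (MX ^ r * MY) ^ D * (sf ^ d * sg ^ (D - d)) ^ (r + 1)"
    using interp[of sf 1 sg] by simp
  also have "\<dots> \<le> (M ^ (r + 1)) ^ D * (sf ^ d * sg ^ (D - d)) ^ (r + 1)"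
    using M s0 unfolding r_def[symmetric] by (intro mult_right_mono power_mono) auto
  also have "\<dots> = (M ^ D * (sf ^ d * sg ^ (D - d))) ^ (r + 1)"
  proof -
    have "(M ^ (r + 1)) ^ D = (M ^ D) ^ (r + 1)" by (simp only: power_mult[symmetric] mult.commute)
    then show ?thesis by (simp only: power_mult_distrib)
  qed
  finally have "?Z ^ Suc r \<le> (M ^ D * (sf ^ d * sg ^ (D - d))) ^ Suc r" by simp
  then have "?Z \<le> M ^ D * (sf ^ d * sg ^ (D - d))"
    by (rule power_le_imp_le_base) (use M s0 in auto)
  then show "(\<Sum>\<omega>\<in>\<Omega>. \<nu> \<omega> * (cmod (expsum e (cell x S a i) \<omega>) ^ (2 * moment_degree l)
            * cmod (expsum e (cell x S b j) \<omega>) ^ (2 * (moment_degree k - moment_degree l))))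
          \<le> M ^ moment_degree k
            * (sqsum \<Omega> \<nu> x e (moment_degree k) n (cell x S a i) ^ moment_degree l
            * sqsum \<Omega> \<nu> x e (moment_degree k) n (cell x S b j) ^ (moment_degree k - moment_degree l))"
    unfolding f_def g_def sf_def sg_def d_def D_def .
qed

lemma powr_inverse_le:
  assumes "0 \<le> W" "W \<le> y ^ d" "0 \<le> y" "d \<ge> 1"
  shows "W powr (1 / real d) \<le> (y::real)"
proof -
  have "W powr (1 / real d) \<le> (y ^ d) powr (1 / real d)" using assms by (intro powr_mono2) auto
  also have "\<dots> = y" using assms by (cases "y = 0") (auto simp: powr_powr simp flip: powr_realpow)
  finally show ?thesis .
qed

text \<open>A power of the exponential sum over the second cell is absorbed into the measure, which
  turns the first cell into a system of degree l. Decoupling in that degree cuts it into cells of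
  length 2^-b', where the given mixed bound applies; their square sums add up to that of the first
  cell.\<close>

lemma mixed_bound_refine:
  assumes l: "1 \<le> l" "l < k" and b: "b \<le> n" "b' \<le> n" "l * b' \<le> (k - l + 1) * b" "a \<le> b'"
    and c: "c > 0" and K: "K \<ge> 0"
    and low: "decoupling l (c / 4 ^ k) (K + 2 * real (moment_degree k)) (b' - a) B"
    and B: "B \<ge> 1" and M: "M \<ge> 0" and fine: "mixed_bound k c K n l b' b M"
  shows "mixed_bound k c K n l a b (B * M)"
  unfolding mixed_bound_def
proof (intro allI impI, elim conjE)
  fix \<Omega> :: "nat set" and \<nu> and S :: "real set" and x e i j
  assume sys: "vsystem k c K n \<Omega> \<nu> S x e" and sep: "separated a i b j"
  define D where "D = moment_degree k"
  define d where "d = moment_degree l"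
  have d: "d \<ge> 1" unfolding d_def by (rule moment_degree_pos[OF l(1)])
  have D: "D \<ge> 1" "d \<le> D"
    unfolding D_def d_def using l moment_degree_pos[of k] moment_degree_mono[of l k] by simp_all
  have fin: "finite \<Omega>" "\<And>\<omega>. \<omega> \<in> \<Omega> \<Longrightarrow> \<nu> \<omega> \<ge> 0" using sys unfolding vsystem_def by auto
  define g where "g = expsum e (cell x S b j)"
  define \<nu>' where "\<nu>' \<omega> = \<nu> \<omega> * cmod (g \<omega>) ^ (2 * (D - d))" for \<omega>
  define I where "I = cell x S a i"
  define s where "s T = sqsum \<Omega> \<nu> x e D n T" for T
  have s0: "s T \<ge> 0" for T unfolding s_def by (rule sqsum_nonneg)
  define x' where "x' = (\<lambda>t. 2 ^ a * x t - real_of_int i)"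
  define m where "m = b' - a"
  define R where "R = i * 2 ^ m"
  have b'n: "a \<le> n" using b by simp
  have i: "0 \<le> i" "i + 1 \<le> 2 ^ a" using sep unfolding separated_def by auto
  have "real_of_int (i + 1) \<le> real_of_int (2 ^ a)" using i by (simp only: of_int_le_iff)
  then have r: "0 \<le> real_of_int i" "real_of_int i + 1 \<le> 2 ^ a" using i by auto
  have R: "real_of_int i * 2 ^ (b' - a) = real_of_int R" unfolding R_def m_def by simp
  note range = rescale_range[OF b(4) R r]
  have sys': "vsystem l (c / 4 ^ k) (K + 2 * real (moment_degree k)) m \<Omega> \<nu>' I x' e"
    unfolding \<nu>'_def g_def I_def x'_def m_def D_def d_def
    by (rule vsystem_degree_drop[OF sys l b(1,3,4) sep K c])
  have main: "moment \<Omega> \<nu>' (2 * d) (expsum e I) \<le> (B * sqsum \<Omega> \<nu>' x' e d m I) ^ d"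
    using decouplingD[OF low[folded m_def] sys'] unfolding d_def .
  \<comment> \<open>\<open>P\<close> collects the part of the fine bound that does not depend on the
    first cell; the d-th root makes the bound for each child linear in the square sums to be
    added.\<close>
  define P where "P = (M ^ D * s (cell x S b j) ^ (D - d)) powr (1 / real d)"
  have P0: "P \<ge> 0" unfolding P_def by simp
  have Pd: "P ^ d = M ^ D * s (cell x S b j) ^ (D - d)"
  proof -
    have "M ^ D * s (cell x S b j) ^ (D - d) \<ge> 0" using M s0 by simp
    then show ?thesis unfolding P_def using d
      by (cases "M ^ D * s (cell x S b j) ^ (D - d) = 0") (auto simp: powr_powr power_0_left simp flip: powr_realpow)
  qed
  have child: "cell x' I m v = cell x S b' (v + R)" if "v \<in> {0..<2 ^ m}" for v
  proof -
    have "cell x' I m v = cell x I b' (v + R)"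
      unfolding x'_def m_def by (rule cell_rescale[OF b(4) R])
    also have "\<dots> = cell x S b' (v + R)"
      unfolding I_def cell_cell[OF b(4)] m_def[symmetric] R_def using that by simp
    finally show ?thesis .
  qed
  have each: "moment \<Omega> \<nu>' (2 * d) (expsum e (cell x' I m v)) powr (1 / real d) \<le> P * s (cell x S b' (v + R))"
    if v: "v \<in> {0..<2 ^ m}" for v
  proof (rule powr_inverse_le)
    have "(v + R) div 2 ^ (b' - a) = i" unfolding R_def m_def[symmetric] using v by simp
    then have sep': "separated b' (v + R) b j" by (rule separated_child[OF sep b(4)])
    show "moment \<Omega> \<nu>' (2 * d) (expsum e (cell x' I m v)) \<le> (P * s (cell x S b' (v + R))) ^ d"
      using mixed_boundD[OF fine sys sep'] unfolding child[OF v] moment_def \<nu>'_def power_mult_distrib Pd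
      by (simp add: g_def s_def D_def d_def mult_ac)
    show "0 \<le> moment \<Omega> \<nu>' (2 * d) (expsum e (cell x' I m v))"
      using fin by (intro moment_nonneg) (auto simp: \<nu>'_def)
  qed (use P0 s0 d in auto)
  have "sqsum \<Omega> \<nu>' x' e d m I \<le> (\<Sum>v\<in>{0..<2 ^ m}. P * s (cell x S b' (v + R)))"
    unfolding sqsum_def using each by (intro sum_mono)
  also have "\<dots> = P * (\<Sum>v\<in>{0..<2 ^ m}. s (cell x S b' (v + R)))" by (simp add: sum_distrib_left)
  also have "(\<Sum>v\<in>{0..<2 ^ m}. s (cell x S b' (v + R))) = (\<Sum>v\<in>{0..<2 ^ m}. s (cell x I b' (v + R)))"
    using child cell_rescale[OF b(4) R, of x I] unfolding x'_def m_def by (intro sum.cong refl) auto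
  also have "\<dots> = (\<Sum>u\<in>{R..<R + 2 ^ m}. s (cell x I b' u))"
    by (rule sum.reindex_bij_witness[of _ "\<lambda>i. i - R" "\<lambda>j. j + R"]) auto
  also have "P * \<dots> \<le> P * (\<Sum>u\<in>{0..<2 ^ b'}. s (cell x I b' u))"
    using range P0 s0 unfolding m_def by (intro mult_left_mono sum_mono2) auto
  also have "(\<Sum>u\<in>{0..<2 ^ b'}. s (cell x I b' u)) = s I"
    unfolding s_def by (rule sqsum_cells[OF b(2) D(1), symmetric])
  finally have "sqsum \<Omega> \<nu>' x' e d m I \<le> P * s I" by simp
  then have "(B * sqsum \<Omega> \<nu>' x' e d m I) ^ d \<le> (B * (P * s I)) ^ d"
    using B sqsum_nonneg by (intro power_mono mult_left_mono mult_nonneg_nonneg) auto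
  then have "moment \<Omega> \<nu>' (2 * d) (expsum e I) \<le> (B * (P * s I)) ^ d" using main by linarith
  also have "\<dots> = B ^ d * (M ^ D * (s I ^ d * s (cell x S b j) ^ (D - d)))"
    unfolding power_mult_distrib Pd by simp
  \<comment> \<open>\<open>B\<close> is at least 1 and occurs with exponent d \<le> D, so raising it
    to D fits the normalisation of \<open>mixed_bound\<close>.\<close>
  also have "\<dots> \<le> B ^ D * (M ^ D * (s I ^ d * s (cell x S b j) ^ (D - d)))"
    using B D M s0 by (intro mult_right_mono power_increasing) auto
  also have "\<dots> = (B * M) ^ D * (s I ^ d * s (cell x S b j) ^ (D - d))"
    by (simp add: power_mult_distrib)
  finally show "(\<Sum>\<omega>\<in>\<Omega>. \<nu> \<omega> * (cmod (expsum e (cell x S a i) \<omega>) ^ (2 * moment_degree l)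
            * cmod (expsum e (cell x S b j) \<omega>) ^ (2 * (moment_degree k - moment_degree l))))
          \<le> (B * M) ^ moment_degree k
            * (sqsum \<Omega> \<nu> x e (moment_degree k) n (cell x S a i) ^ moment_degree l
            * sqsum \<Omega> \<nu> x e (moment_degree k) n (cell x S b j) ^ (moment_degree k - moment_degree l))"
    unfolding moment_def \<nu>'_def g_def I_def s_def D_def d_def by (simp add: mult_ac)
qed

section \<open>The bootstrapping iteration\<close>

text \<open>The gain at step \<open>i\<close> of the iteration; \<open>\<eta>\<close> is the current decoupling exponent and \<open>\<epsilon>\<close> the
  loss from decoupling in lower degree.\<close>

primrec gain :: "nat \<Rightarrow> real \<Rightarrow> real \<Rightarrow> nat \<Rightarrow> nat \<Rightarrow> real" where
  "gain k \<eta> \<epsilon> 0 l = (if l = 0 then \<eta> else 0)"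
| "gain k \<eta> \<epsilon> (Suc i) l = (if l = 0 then \<eta> else
     real (k - l) / real (k - l + 1) * gain k \<eta> \<epsilon> i (l - 1) + gain k \<eta> \<epsilon> i (k - l) / real l - \<epsilon>)"

lemma gain_zero: "gain k \<eta> \<epsilon> i 0 = \<eta>"
  by (cases i) auto

text \<open>For l \<ge> 1 the old gain at l enters the new gain at l + 1 with coefficient (k - l -
  1) / (k - l) and the new gain at k - l with coefficient 1 / (k - l); these add up to 1. The value
  at l = 0 contributes (k - 1) / k times \<eta>.\<close>

lemma gain_sum_Suc:
  assumes "k \<ge> 2"
  shows "(\<Sum>l\<in>{1..<k}. gain k \<eta> \<epsilon> (Suc i) l)
    = (\<Sum>l\<in>{1..<k}. gain k \<eta> \<epsilon> i l) + real (k - 1) / real k * \<eta> - real (k - 1) * \<epsilon>"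
proof -
  define g where "g l = gain k \<eta> \<epsilon> i l" for l
  have "(\<Sum>l\<in>{1..<k}. gain k \<eta> \<epsilon> (Suc i) l)
      = (\<Sum>l\<in>{1..<k}. real (k - l) / real (k - l + 1) * g (l - 1)) + (\<Sum>l\<in>{1..<k}. g (k - l) / real l)
        - (\<Sum>l\<in>{1..<k}. \<epsilon>)"
    unfolding sum.distrib[symmetric] sum_subtractf[symmetric] g_def by (intro sum.cong refl) auto
  also have "(\<Sum>l\<in>{1..<k}. g (k - l) / real l) = (\<Sum>l\<in>{1..<k}. g l / real (k - l))"
    by (rule sum.reindex_bij_witness[of _ "\<lambda>l. k - l" "\<lambda>l. k - l"]) auto
  also have "(\<Sum>l\<in>{1..<k}. real (k - l) / real (k - l + 1) * g (l - 1))
      = (\<Sum>l\<in>{0..<k - 1}. real (k - l - 1) / real (k - l) * g l)"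
    by (rule sum.reindex_bij_witness[of _ "\<lambda>l. l + 1" "\<lambda>l. l - 1"]) (auto simp: Suc_diff_Suc)
  also have "\<dots> = (\<Sum>l\<in>{0..<k}. real (k - l - 1) / real (k - l) * g l)"
    by (intro sum.mono_neutral_left) auto
  also have "{0..<k} = insert 0 {1..<k}" using assms by auto
  also have "(\<Sum>l\<in>insert 0 {1..<k}. real (k - l - 1) / real (k - l) * g l)
      = real (k - 1) / real k * \<eta> + (\<Sum>l\<in>{1..<k}. real (k - l - 1) / real (k - l) * g l)"
    by (subst sum.insert) (auto simp: g_def gain_zero)
  also have "real (k - 1) / real k * \<eta> + (\<Sum>l\<in>{1..<k}. real (k - l - 1) / real (k - l) * g l)
        + (\<Sum>l\<in>{1..<k}. g l / real (k - l)) - (\<Sum>l\<in>{1..<k}. \<epsilon>)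
      = real (k - 1) / real k * \<eta> + (\<Sum>l\<in>{1..<k}. real (k - l - 1) / real (k - l) * g l + g l / real (k - l))
        - real (k - 1) * \<epsilon>"
    by (simp add: sum.distrib)
  also have "(\<Sum>l\<in>{1..<k}. real (k - l - 1) / real (k - l) * g l + g l / real (k - l)) = (\<Sum>l\<in>{1..<k}. g l)"
  proof (intro sum.cong refl)
    fix l assume "l \<in> {1..<k}"
    then have r: "real (k - l - 1) = real (k - l) - 1" "real (k - l) > 0" by auto
    have "real (k - l - 1) / real (k - l) * g l + g l / real (k - l) = (real (k - l) * g l) / real (k - l)"
      unfolding r by (simp add: add_divide_distrib[symmetric] algebra_simps)
    then show "real (k - l - 1) / real (k - l) * g l + g l / real (k - l) = g l" using r by simp
  qed
  finally show ?thesis unfolding g_def by simp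
qed

lemma gain_sum:
  assumes "k \<ge> 2"
  shows "(\<Sum>l\<in>{1..<k}. gain k \<eta> \<epsilon> i l) = real i * (real (k - 1) * (\<eta> / real k - \<epsilon>))"
proof (induction i)
  case (Suc i)
  have "real (k - 1) / real k * \<eta> - real (k - 1) * \<epsilon> = real (k - 1) * (\<eta> / real k - \<epsilon>)"
    by (simp add: right_diff_distrib)
  moreover have "real (Suc i) * (real (k - 1) * (\<eta> / real k - \<epsilon>))
      = real i * (real (k - 1) * (\<eta> / real k - \<epsilon>)) + real (k - 1) * (\<eta> / real k - \<epsilon>)"
    by (simp add: distrib_right)
  ultimately show ?case unfolding gain_sum_Suc[OF assms] Suc by linarith
qed simp

text \<open>The recursion preserves the sum over \<open>l\<close> up to a constant increment, so some gain is unbounded.\<close>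

lemma exists_large_gain:
  assumes "k \<ge> 2"
  shows "\<exists>l\<in>{1..<k}. gain k \<eta> \<epsilon> i l \<ge> real i * (\<eta> / real k - \<epsilon>)"
proof (rule ccontr)
  assume "\<not> ?thesis"
  then have "(\<Sum>l\<in>{1..<k}. gain k \<eta> \<epsilon> i l) < (\<Sum>l\<in>{1..<k}. real i * (\<eta> / real k - \<epsilon>))"
    using assms by (intro sum_strict_mono) (auto simp: not_le)
  then show False unfolding gain_sum[OF assms] by simp
qed

text \<open>Each round is one interpolation followed by one refinement. The bound
  \<open>k ^ Suc i * b \<le> n\<close> leaves room for the scale to grow by a factor of at most k
  per round, and divisibility of b by \<open>fact k ^ i\<close> keeps all the scales (k - l + 1) b /
  l integral.\<close>

lemma mixed_bound_iteration:
  assumes k: "k \<ge> 2" and c: "c > 0" and K: "K \<ge> 0" and C0: "C0 \<ge> 1" and \<eta>: "\<eta> \<ge> 0" and \<epsilon>: "\<epsilon> > 0"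
    and dec: "\<And>n. decoupling k c K n (C0 * 2 powr (\<eta> * real n))"
    and C2: "C2 \<ge> 1"
    and low: "\<And>l m. 1 \<le> l \<Longrightarrow> l < k \<Longrightarrow>
      decoupling l (c / 4 ^ k) (K + 2 * real (moment_degree k)) m (C2 * 2 powr (\<epsilon> / real k * real m))"
  shows "\<exists>C\<ge>1. \<forall>n b l a. k ^ Suc i * b \<le> n \<longrightarrow> fact k ^ i dvd b \<longrightarrow> 1 \<le> l \<longrightarrow> l < k \<longrightarrow>
      l * a \<le> (k - l + 1) * b \<longrightarrow>
      mixed_bound k c K n l a b (C * 2 powr (\<eta> * real n - gain k \<eta> \<epsilon> i l * real b))"
proof (induction i)
  case 0
  have "mixed_bound k c K n l a b (2 * C0 * 2 powr (\<eta> * real n))"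
    if *: "k * b \<le> n" "1 \<le> l" "l < k" "l * a \<le> (k - l + 1) * b" for n b l a
  proof -
    have "a \<le> l * a" using * by simp
    also have "\<dots> \<le> (k - l + 1) * b" by (rule *)
    also have "\<dots> \<le> k * b" using * by (intro mult_right_mono) auto
    finally have an: "a \<le> n" using * by linarith
    have "b \<le> k * b" using k by simp
    then have bn: "b \<le> n" using * by linarith
    have "decoupling k c K (n - z) (C0 * 2 powr (\<eta> * real n))" if "z \<le> n" for z
      by (rule decoupling_mono[OF dec]) (use C0 \<eta> in \<open>auto intro!: mult_left_mono powr_mono\<close>)
    then have "mixed_bound k c K n l a b (2 * (C0 * 2 powr (\<eta> * real n)))"
      using an bn K * C0 by (intro mixed_bound_trivial) auto
    then show ?thesis by (simp add: mult.assoc)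
  qed
  then show ?case using C0 by (intro exI[of _ "2 * C0"]) auto
next
  case (Suc i)
  then obtain C1 where C1: "C1 \<ge> 1" and IH: "\<And>n b l a. k ^ Suc i * b \<le> n \<Longrightarrow> fact k ^ i dvd b \<Longrightarrow>
      1 \<le> l \<Longrightarrow> l < k \<Longrightarrow> l * a \<le> (k - l + 1) * b \<Longrightarrow>
      mixed_bound k c K n l a b (C1 * 2 powr (\<eta> * real n - gain k \<eta> \<epsilon> i l * real b))"
    by blast
  define C where "C = max C0 C1"
  have C: "C \<ge> 1" "C0 \<le> C" "C1 \<le> C" unfolding C_def using C0 by auto
  have "mixed_bound k c K n l a b (C2 * C * 2 powr (\<eta> * real n - gain k \<eta> \<epsilon> (Suc i) l * real b))"
    if *: "k ^ Suc (Suc i) * b \<le> n" "fact k ^ Suc i dvd b" "1 \<le> l" "l < k" "l * a \<le> (k - l + 1) * b" for n b l a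
  proof -
    obtain q where q: "b = fact k ^ Suc i * q" using *(2) by (elim dvdE)
    have "l dvd (fact k :: nat)" using * by (intro dvd_fact) auto
    then obtain t where t: "(fact k :: nat) = l * t" by (elim dvdE)
    \<comment> \<open>This is (k - l + 1) b / l, the finest scale that degree-l decoupling reaches.
      One factor \<open>fact k\<close> of b is spent on the division by l.\<close>
    define b' where "b' = (k - l + 1) * (fact k ^ i * (t * q))"
    have lb': "l * b' = (k - l + 1) * b" unfolding b'_def q by (simp add: t mult_ac)
    have b'k: "b' \<le> k * b"
    proof -
      have "b' \<le> l * b'" using * by simp
      also have "\<dots> \<le> k * b" unfolding lb' using * by (intro mult_right_mono) auto
      finally show ?thesis .
    qed
    have pos: "k ^ j \<ge> 1" for j using k by simp
    have kb': "k ^ Suc i * b' \<le> n"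
    proof -
      have "k ^ Suc i * b' \<le> k ^ Suc i * (k * b)" using b'k by (intro mult_left_mono) auto
      also have "\<dots> = k ^ Suc (Suc i) * b" by simp
      finally show ?thesis using *(1) by linarith
    qed
    have kb: "k ^ Suc i * b \<le> n"
    proof -
      have "k ^ Suc i * b \<le> k ^ Suc (Suc i) * b" using k by (intro mult_right_mono power_increasing) auto
      then show ?thesis using *(1) by linarith
    qed
    have le: "z \<le> k ^ Suc i * z" for z using mult_le_mono1[OF pos[of "Suc i"], of z] by (simp only: mult_1)
    have bn: "b \<le> n" using le_trans[OF le kb] .
    have b'n: "b' \<le> n" using le_trans[OF le kb'] .
    have ab': "a \<le> b'"
    proof -
      have "l * a \<le> l * b'" unfolding lb' by (rule *(5))
      then show ?thesis using * by simp
    qed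
    define MX where "MX = C * 2 powr (\<eta> * real n - gain k \<eta> \<epsilon> i (l - 1) * real b)"
    \<comment> \<open>In the exchanged bound the cell of length 2^-b' is the second one, so its gain
      is multiplied by \<open>b'\<close> rather than b.\<close>
    define MY where "MY = C * 2 powr (\<eta> * real n - gain k \<eta> \<epsilon> i (k - l) * real b')"
    have X: "mixed_bound k c K n (l - 1) b' b MX"
    proof (cases "l = 1")
      case True
      have "mixed_bound k c K n 0 b' b (C0 * 2 powr (\<eta> * real (n - b)))"
        by (rule mixed_bound_zero[OF dec bn K]) (use k in simp)
      moreover have "C0 * 2 powr (\<eta> * real (n - b)) \<le> MX"
        unfolding MX_def True using bn C C0
        by (intro mult_mono) (auto simp: gain_zero of_nat_diff algebra_simps)
      ultimately show ?thesis unfolding True using C0 by (auto intro: mixed_bound_mono)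
    next
      case False
      have "(l - 1) * b' \<le> l * b'" by simp
      also have "\<dots> \<le> (k - (l - 1) + 1) * b" unfolding lb' by (intro mult_right_mono) auto
      finally have le: "(l - 1) * b' \<le> (k - (l - 1) + 1) * b" .
      have dv: "fact k ^ i dvd b" unfolding q by simp
      have "mixed_bound k c K n (l - 1) b' b (C1 * 2 powr (\<eta> * real n - gain k \<eta> \<epsilon> i (l - 1) * real b))"
        by (rule IH[OF kb dv]) (use False * le in auto)
      then show ?thesis
        by (rule mixed_bound_mono) (use C C1 in \<open>auto simp: MX_def intro!: mult_right_mono\<close>)
    qed
    have Y: "mixed_bound k c K n (k - l) b b' MY"
    proof -
      have "(k - l) * b \<le> l * b'" unfolding lb' by (intro mult_right_mono) auto
      also have "\<dots> \<le> (k - (k - l) + 1) * b'" using * by (intro mult_right_mono) auto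
      finally have le: "(k - l) * b \<le> (k - (k - l) + 1) * b'" .
      have dv: "fact k ^ i dvd b'" unfolding b'_def by simp
      have "mixed_bound k c K n (k - l) b b' (C1 * 2 powr (\<eta> * real n - gain k \<eta> \<epsilon> i (k - l) * real b'))"
        by (rule IH[OF kb' dv]) (use * le in auto)
      then show ?thesis
        by (rule mixed_bound_mono) (use C C1 in \<open>auto simp: MY_def intro!: mult_right_mono\<close>)
    qed
    \<comment> \<open>\<gamma> is the gain before the lower-degree loss \<epsilon> is paid. The
      Hoelder weight 1 / (k - l + 1) times b' = (k - l + 1) b / l leaves b / l, which explains the
      denominator l in the recursion.\<close>
    define \<gamma> where "\<gamma> = gain k \<eta> \<epsilon> (Suc i) l + \<epsilon>"
    have \<gamma>: "real (k - l + 1) * (\<gamma> * real b)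
        = real (k - l) * (gain k \<eta> \<epsilon> i (l - 1) * real b) + gain k \<eta> \<epsilon> i (k - l) * real b'"
    proof -
      define r where "r = real (k - l + 1)"
      have r: "r > 0" unfolding r_def by simp
      have lb'r: "real l * real b' = r * real b" unfolding r_def of_nat_mult[symmetric] lb' ..
      have l0: "real l > 0" using * by simp
      have "\<gamma> = real (k - l) / r * gain k \<eta> \<epsilon> i (l - 1) + gain k \<eta> \<epsilon> i (k - l) / real l"
        unfolding \<gamma>_def r_def using * by simp
      then have "r * (\<gamma> * real b) = real (k - l) * (gain k \<eta> \<epsilon> i (l - 1) * real b) * (r / r)
          + gain k \<eta> \<epsilon> i (k - l) * (r * real b) / real l"
        by (simp add: algebra_simps)
      also have "\<dots> = real (k - l) * (gain k \<eta> \<epsilon> i (l - 1) * real b) + gain k \<eta> \<epsilon> i (k - l) * real b'"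
        unfolding lb'r[symmetric] using r l0 by simp
      finally show ?thesis unfolding r_def .
    qed
    define M where "M = C * 2 powr (\<eta> * real n - \<gamma> * real b)"
    have MXY: "MX ^ (k - l) * MY \<le> M ^ (k - l + 1)"
    proof -
      have pw: "(2 powr u) ^ j = 2 powr (real j * u)" for u :: real and j
        by (simp add: powr_power mult.commute)
      have "MX ^ (k - l) * MY = C ^ (k - l + 1) * (2 powr (real (k - l) * (\<eta> * real n - gain k \<eta> \<epsilon> i (l - 1) * real b))
          * 2 powr (\<eta> * real n - gain k \<eta> \<epsilon> i (k - l) * real b'))"
        unfolding MX_def MY_def power_mult_distrib pw by simp
      also have "2 powr (real (k - l) * (\<eta> * real n - gain k \<eta> \<epsilon> i (l - 1) * real b))
          * 2 powr (\<eta> * real n - gain k \<eta> \<epsilon> i (k - l) * real b')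
          = 2 powr (real (k - l + 1) * (\<eta> * real n - \<gamma> * real b))"
        unfolding powr_add[symmetric] right_diff_distrib \<gamma> by (simp add: algebra_simps)
      also have "C ^ (k - l + 1) * \<dots> = M ^ (k - l + 1)"
        unfolding M_def power_mult_distrib pw ..
      finally show ?thesis by simp
    qed
    have fine: "mixed_bound k c K n l b' b M"
      by (rule mixed_bound_interpolate[OF *(3,4) X Y _ _ _ MXY])
         (use C in \<open>auto simp: MX_def MY_def M_def\<close>)
    define B where "B = C2 * 2 powr (\<epsilon> * real b)"
    have B1: "B \<ge> 1"
    proof -
      have "1 * 1 \<le> C2 * 2 powr (\<epsilon> * real b)"
        using C2 \<epsilon> by (intro mult_mono) (auto intro!: ge_one_powr_ge_zero)
      then show ?thesis unfolding B_def by simp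
    qed
    \<comment> \<open>The lower-degree loss runs over b' - a \<le> k b scales, so the exponent
      \<epsilon> / k turns it into \<epsilon> b.\<close>
    have dl: "decoupling l (c / 4 ^ k) (K + 2 * real (moment_degree k)) (b' - a) B"
    proof (rule decoupling_mono[OF low[OF *(3,4)]])
      have "real (b' - a) \<le> real (k * b)" using b'k by linarith
      then have "\<epsilon> / real k * real (b' - a) \<le> \<epsilon> / real k * real (k * b)"
        using \<epsilon> by (intro mult_left_mono) auto
      also have "\<dots> = \<epsilon> * real b" using k by simp
      finally show "C2 * 2 powr (\<epsilon> / real k * real (b' - a)) \<le> B"
        unfolding B_def using C2 by (intro mult_left_mono powr_mono) auto
    qed (use C2 in auto)
    have "mixed_bound k c K n l a b (B * M)"
      by (rule mixed_bound_refine[OF *(3,4) bn b'n _ ab' c K dl B1 _ fine])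
         (use lb' C in \<open>auto simp: M_def\<close>)
    also have "B * M = C2 * C * 2 powr (\<eta> * real n - gain k \<eta> \<epsilon> (Suc i) l * real b)"
    proof -
      have "B * M = C2 * C * (2 powr (\<epsilon> * real b) * 2 powr (\<eta> * real n - \<gamma> * real b))"
        unfolding B_def M_def by simp
      also have "2 powr (\<epsilon> * real b) * 2 powr (\<eta> * real n - \<gamma> * real b)
          = 2 powr (\<eta> * real n - gain k \<eta> \<epsilon> (Suc i) l * real b)"
        unfolding powr_add[symmetric] \<gamma>_def by (simp add: algebra_simps)
      finally show ?thesis .
    qed
    finally show ?thesis .
  qed
  moreover have "C2 * C \<ge> 1" using mult_mono[of 1 C2 1 C] C2 C by simp
  ultimately show ?case by (intro exI[of _ "C2 * C"]) blast
qed

section \<open>From mixed moments back to linear decoupling\<close>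

lemma sum_power_le_card:
  fixes y :: "'a \<Rightarrow> real"
  assumes "finite U" "\<And>u. u \<in> U \<Longrightarrow> y u \<ge> 0" "q \<ge> 1"
  shows "(\<Sum>u\<in>U. y u) ^ q \<le> real (card U) ^ q * (\<Sum>u\<in>U. y u ^ q)"
proof (cases "U = {}")
  case True
  then show ?thesis using assms by (simp add: power_0_left)
next
  case False
  define M where "M = Max (y ` U)"
  have "M \<in> y ` U" unfolding M_def using assms False by (intro Max_in) auto
  then obtain v where v: "v \<in> U" "M = y v" by auto
  have le: "y u \<le> y v" if "u \<in> U" for u
    using that assms unfolding v(2)[symmetric] M_def by (intro Max_ge) auto
  have "(\<Sum>u\<in>U. y u) \<le> real (card U) * y v" using sum_bounded_above[of U y "y v"] le by simp
  then have "(\<Sum>u\<in>U. y u) ^ q \<le> (real (card U) * y v) ^ q"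
    using assms by (intro power_mono) (auto intro: sum_nonneg)
  also have "\<dots> = real (card U) ^ q * y v ^ q" by (rule power_mult_distrib)
  also have "\<dots> \<le> real (card U) ^ q * (\<Sum>u\<in>U. y u ^ q)"
    using v assms by (intro mult_left_mono member_le_sum) auto
  finally show ?thesis .
qed

text \<open>The second cell is cut into at most 2^b cells, with the crude loss (2^b)^(2 (D - d) + 1)
  \<le> 2^(3 b D). It is proportional to b in the exponent, so any gain above 3 compensates
  it.\<close>

lemma mixed_bound_coarsen:
  assumes l: "1 \<le> l" "l < k" and b: "2 \<le> b" "b \<le> n" and M: "M \<ge> 0"
    and fine: "mixed_bound k c K n l a b M"
  shows "mixed_bound k c K n l a 2 (2 ^ (3 * b) * M)"
  unfolding mixed_bound_def
proof (intro allI impI, elim conjE)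
  fix \<Omega> :: "nat set" and \<nu> and S :: "real set" and x e i j
  assume sys: "vsystem k c K n \<Omega> \<nu> S x e" and sep: "separated a i 2 j"
  define D where "D = moment_degree k"
  define d where "d = moment_degree l"
  have dD: "d < D" unfolding d_def D_def by (rule moment_degree_strict_mono[OF l(2)])
  have fin: "finite \<Omega>" "\<And>\<omega>. \<omega> \<in> \<Omega> \<Longrightarrow> \<nu> \<omega> \<ge> 0" "finite S"
    and x01: "\<And>t. t \<in> S \<Longrightarrow> 0 \<le> x t \<and> x t < 1"
    using sys unfolding vsystem_def by auto
  define f where "f \<omega> = cmod (expsum e (cell x S a i) \<omega>)" for \<omega>
  define G where "G u \<omega> = cmod (expsum e (cell x S b u) \<omega>)" for u \<omega>
  define s where "s T = sqsum \<Omega> \<nu> x e D n T" for T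
  have s0: "s T \<ge> 0" for T unfolding s_def by (rule sqsum_nonneg)
  define U where "U = {u \<in> {0..<(2::int) ^ b}. u div 2 ^ (b - 2) = j}"
  have finU: "finite U" by (rule finite_subset[of _ "{0..<2 ^ b}"]) (auto simp: U_def)
  have "U \<subseteq> {0..<2 ^ b}" by (auto simp: U_def)
  from card_mono[OF _ this] have cardU: "card U \<le> 2 ^ b" by (simp add: nat_power_eq)
  define q where "q = 2 * (D - d)"
  have q: "q \<ge> 1" "q + 1 \<le> 3 * D" unfolding q_def using dD by auto
  have split: "expsum e (cell x S 2 j) \<omega> = (\<Sum>u\<in>U. expsum e (cell x S b u) \<omega>)" for \<omega>
  proof -
    have "expsum e (cell x S 2 j) \<omega> = (\<Sum>u\<in>{0..<2 ^ b}. expsum e (cell x (cell x S 2 j) b u) \<omega>)"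
    proof (rule expsum_cells)
      show "finite (cell x S 2 j)" using fin(3) cell_subset finite_subset by metis
      show "0 \<le> x t \<and> x t < 1" if "t \<in> cell x S 2 j" for t
        using that x01 unfolding cell_def by blast
    qed
    also have "\<dots> = (\<Sum>u\<in>U. expsum e (cell x S b u) \<omega>)"
      unfolding cell_cell[OF b(1)] U_def by (intro sum.mono_neutral_cong_right) auto
    finally show ?thesis .
  qed
  have each: "(\<Sum>\<omega>\<in>\<Omega>. \<nu> \<omega> * (f \<omega> ^ (2 * d) * G u \<omega> ^ q)) \<le> M ^ D * (s (cell x S a i) ^ d * s (cell x S 2 j) ^ (D - d))"
    if u: "u \<in> U" for u
  proof -
    have "u div 2 ^ (b - 2) = j" using u unfolding U_def by simp
    then have "separated b u a i"
      using separated_child[OF sep[unfolded separated_sym[of a]] b(1)] by blast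
    then have sep': "separated a i b u" by (simp only: separated_sym)
    have "(\<Sum>\<omega>\<in>\<Omega>. \<nu> \<omega> * (f \<omega> ^ (2 * d) * G u \<omega> ^ q)) \<le> M ^ D * (s (cell x S a i) ^ d * s (cell x S b u) ^ (D - d))"
      using mixed_boundD[OF fine sys sep'] unfolding f_def G_def s_def D_def d_def q_def .
    also have "\<dots> \<le> M ^ D * (s (cell x S a i) ^ d * s (cell x S 2 j) ^ (D - d))"
    proof (intro mult_left_mono power_mono)
      have "s (cell x S b u) = s (cell x (cell x S 2 j) b u)"
        using u unfolding cell_cell[OF b(1)] U_def by simp
      also have "\<dots> \<le> (\<Sum>v\<in>{0..<2 ^ b}. s (cell x (cell x S 2 j) b v))"
        using u s0 unfolding U_def by (intro member_le_sum) auto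
      also have "\<dots> = s (cell x S 2 j)"
        unfolding s_def by (rule sqsum_cells[OF b(2), symmetric]) (use dD in simp)
      finally show "s (cell x S b u) \<le> s (cell x S 2 j)" .
    qed (use s0 M in auto)
    finally show ?thesis .
  qed
  define R where "R = M ^ D * (s (cell x S a i) ^ d * s (cell x S 2 j) ^ (D - d))"
  have R0: "R \<ge> 0" unfolding R_def using M s0 by simp
  have "(\<Sum>\<omega>\<in>\<Omega>. \<nu> \<omega> * (f \<omega> ^ (2 * d) * cmod (expsum e (cell x S 2 j) \<omega>) ^ q))
      \<le> (\<Sum>\<omega>\<in>\<Omega>. \<nu> \<omega> * (f \<omega> ^ (2 * d) * (real (card U) ^ q * (\<Sum>u\<in>U. G u \<omega> ^ q))))"
  proof (intro sum_mono mult_left_mono)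
    fix \<omega>
    have "cmod (expsum e (cell x S 2 j) \<omega>) ^ q \<le> (\<Sum>u\<in>U. G u \<omega>) ^ q"
      unfolding split G_def by (intro power_mono norm_sum) auto
    also have "\<dots> \<le> real (card U) ^ q * (\<Sum>u\<in>U. G u \<omega> ^ q)"
      by (rule sum_power_le_card[OF finU _ q(1)]) (simp add: G_def)
    finally show "cmod (expsum e (cell x S 2 j) \<omega>) ^ q \<le> real (card U) ^ q * (\<Sum>u\<in>U. G u \<omega> ^ q)" .
  qed (use fin in \<open>auto simp: f_def\<close>)
  also have "\<dots> = real (card U) ^ q * (\<Sum>u\<in>U. \<Sum>\<omega>\<in>\<Omega>. \<nu> \<omega> * (f \<omega> ^ (2 * d) * G u \<omega> ^ q))"
    by (subst sum.swap) (simp add: sum_distrib_left mult_ac)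
  also have "\<dots> \<le> real (card U) ^ q * (\<Sum>u\<in>U. R)"
    using each unfolding R_def by (intro mult_left_mono sum_mono) auto
  also have "\<dots> = real (card U) ^ (q + 1) * R" by simp
  also have "\<dots> \<le> (2 ^ b) ^ (q + 1) * R"
  proof (intro mult_right_mono power_mono)
    have "real (card U) \<le> real (2 ^ b)" using cardU by (simp only: of_nat_le_iff)
    then show "real (card U) \<le> 2 ^ b" by simp
  qed (use R0 in auto)
  also have "\<dots> \<le> (2 ^ b) ^ (3 * D) * R"
    using q R0 by (intro mult_right_mono power_increasing) auto
  also have "\<dots> = (2 ^ (3 * b) * M) ^ D * (s (cell x S a i) ^ d * s (cell x S 2 j) ^ (D - d))"
    unfolding R_def power_mult_distrib by (simp add: power_mult[symmetric] mult_ac)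
  finally show "(\<Sum>\<omega>\<in>\<Omega>. \<nu> \<omega> * (cmod (expsum e (cell x S a i) \<omega>) ^ (2 * moment_degree l)
            * cmod (expsum e (cell x S 2 j) \<omega>) ^ (2 * (moment_degree k - moment_degree l))))
          \<le> (2 ^ (3 * b) * M) ^ moment_degree k
            * (sqsum \<Omega> \<nu> x e (moment_degree k) n (cell x S a i) ^ moment_degree l
            * sqsum \<Omega> \<nu> x e (moment_degree k) n (cell x S 2 j) ^ (moment_degree k - moment_degree l))"
    unfolding f_def s_def D_def d_def q_def .
qed

text \<open>Cauchy-Schwarz between the mixed moment and the one with both cells exchanged: the
  exponents 2d and 2 (D - d) average to D in either cell.\<close>

lemma bilinear_from_mixed:
  assumes l: "l < k" and M: "M \<ge> 0" and mixed: "mixed_bound k c K n l 2 2 M"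
  shows "bilinear_decoupling k c K n M"
  unfolding bilinear_decoupling_def
proof (intro allI impI, elim conjE)
  fix \<Omega> :: "nat set" and \<nu> and S :: "real set" and x e i j
  assume sys: "vsystem k c K n \<Omega> \<nu> S x e" and sep: "separated 2 i 2 j"
  define D where "D = moment_degree k"
  define d where "d = moment_degree l"
  have dD: "D = d + (D - d)" unfolding d_def D_def using moment_degree_strict_mono[OF l] by simp
  have fin: "finite \<Omega>" "\<And>\<omega>. \<omega> \<in> \<Omega> \<Longrightarrow> \<nu> \<omega> \<ge> 0" using sys unfolding vsystem_def by auto
  define f where "f \<omega> = cmod (expsum e (cell x S 2 i) \<omega>)" for \<omega>
  define g where "g \<omega> = cmod (expsum e (cell x S 2 j) \<omega>)" for \<omega>
  define sf where "sf = sqsum \<Omega> \<nu> x e D n (cell x S 2 i)"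
  define sg where "sg = sqsum \<Omega> \<nu> x e D n (cell x S 2 j)"
  have s0: "sf \<ge> 0" "sg \<ge> 0" unfolding sf_def sg_def by (rule sqsum_nonneg)+
  have fg0: "f \<omega> \<ge> 0" "g \<omega> \<ge> 0" for \<omega> unfolding f_def g_def by auto
  have sym: "(h1 ^ D * h2 ^ D) ^ t = (h1 ^ (t * d) * h2 ^ (t * (D - d))) * (h2 ^ (t * d) * h1 ^ (t * (D - d)))"
    for h1 h2 :: real and t
  proof -
    have "t * D = t * d + t * (D - d)" using arg_cong[OF dD, of "\<lambda>z. t * z"] by (simp only: distrib_left)
    then have "h ^ (D * t) = h ^ (t * d) * h ^ (t * (D - d))" for h :: real
      by (simp only: mult.commute[of D] power_add)
    then show ?thesis unfolding power_mult_distrib power_mult[symmetric] by (simp only: mult_ac)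
  qed
  let ?Z = "\<Sum>\<omega>\<in>\<Omega>. \<nu> \<omega> * (f \<omega> ^ D * g \<omega> ^ D)"
  let ?X = "\<Sum>\<omega>\<in>\<Omega>. \<nu> \<omega> * (f \<omega> ^ (2 * d) * g \<omega> ^ (2 * (D - d)))"
  let ?Y = "\<Sum>\<omega>\<in>\<Omega>. \<nu> \<omega> * (g \<omega> ^ (2 * d) * f \<omega> ^ (2 * (D - d)))"
  have "?Z ^ 2 \<le> ?X ^ (2 - 1) * ?Y"
  proof (rule Holder_sum_power[OF fin(1)])
    fix \<omega> assume "\<omega> \<in> \<Omega>"
    show "(f \<omega> ^ D * g \<omega> ^ D) ^ 2
      = (f \<omega> ^ (2 * d) * g \<omega> ^ (2 * (D - d))) ^ (2 - 1) * (g \<omega> ^ (2 * d) * f \<omega> ^ (2 * (D - d)))"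
      unfolding sym by simp
  qed (use fin fg0 in auto)
  also have "\<dots> \<le> (M ^ D * (sf ^ d * sg ^ (D - d))) ^ (2 - 1) * (M ^ D * (sg ^ d * sf ^ (D - d)))"
  proof (intro mult_mono power_mono)
    show "?X \<le> M ^ D * (sf ^ d * sg ^ (D - d))"
      using mixed_boundD[OF mixed sys sep] unfolding f_def g_def sf_def sg_def D_def d_def .
    show "?Y \<le> M ^ D * (sg ^ d * sf ^ (D - d))"
      using mixed_boundD[OF mixed sys sep[unfolded separated_sym[of 2 i]]]
      unfolding f_def g_def sf_def sg_def D_def d_def .
  qed (use fin fg0 M s0 in \<open>auto intro!: sum_nonneg mult_nonneg_nonneg\<close>)
  also have "\<dots> = (M ^ D * M ^ D) * (sf ^ D * sg ^ D)"
    using sym[of sf sg 1] by (simp add: mult_ac)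
  also have "\<dots> = ((M * sqrt (sf * sg)) ^ D) ^ 2"
  proof -
    have "((M * sqrt (sf * sg)) ^ D) ^ 2 = ((M * sqrt (sf * sg)) ^ 2) ^ D"
      by (simp only: power_mult[symmetric] mult.commute)
    also have "(M * sqrt (sf * sg)) ^ 2 = M * M * (sf * sg)"
      using s0 by (simp add: power_mult_distrib power2_eq_square)
    finally show ?thesis by (simp add: power_mult_distrib)
  qed
  finally have "?Z \<le> (M * sqrt (sf * sg)) ^ D"
    by (rule power2_le_imp_le) (use M s0 in auto)
  then show "(\<Sum>\<omega>\<in>\<Omega>. \<nu> \<omega> * (cmod (expsum e (cell x S 2 i) \<omega>) ^ moment_degree k
            * cmod (expsum e (cell x S 2 j) \<omega>) ^ moment_degree k))
          \<le> (M * sqrt (sqsum \<Omega> \<nu> x e (moment_degree k) n (cell x S 2 i)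
               * sqsum \<Omega> \<nu> x e (moment_degree k) n (cell x S 2 j))) ^ moment_degree k"
    unfolding f_def g_def sf_def sg_def D_def .
qed

lemma bilinear_decoupling_mono:
  assumes "bilinear_decoupling k c K n B" "0 \<le> B" "B \<le> B'"
  shows "bilinear_decoupling k c K n B'"
  unfolding bilinear_decoupling_def
proof (intro allI impI, elim conjE)
  fix \<Omega> :: "nat set" and \<nu> and S :: "real set" and x e i j
  assume "vsystem k c K n \<Omega> \<nu> S x e" "separated 2 i 2 j"
  from bilinear_decouplingD[OF assms(1) this]
  show "(\<Sum>\<omega>\<in>\<Omega>. \<nu> \<omega> * (cmod (expsum e (cell x S 2 i) \<omega>) ^ moment_degree k
            * cmod (expsum e (cell x S 2 j) \<omega>) ^ moment_degree k))
          \<le> (B' * sqrt (sqsum \<Omega> \<nu> x e (moment_degree k) n (cell x S 2 i)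
               * sqsum \<Omega> \<nu> x e (moment_degree k) n (cell x S 2 j))) ^ moment_degree k"
    by (rule order_trans)
       (intro power_mono mult_right_mono mult_nonneg_nonneg assms real_sqrt_ge_zero sqsum_nonneg)
qed

text \<open>Lets the n + 1 layers of the Whitney decomposition be absorbed into an arbitrarily small
  exponent.\<close>

lemma linear_le_powr:
  assumes "\<kappa> > 0"
  shows "real n + 1 \<le> (1 + 1 / (\<kappa> * ln 2)) * 2 powr (\<kappa> * real n)"
proof -
  define L where "L = \<kappa> * ln 2"
  have L: "L > 0" unfolding L_def using assms by simp
  have "real n + 1 \<le> (1 + 1 / L) * (1 + L * real n)"
    using L by (simp add: field_simps)
  also have "\<dots> \<le> (1 + 1 / L) * exp (L * real n)"
    using L exp_ge_add_one_self by (intro mult_left_mono) auto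
  also have "exp (L * real n) = 2 powr (\<kappa> * real n)" unfolding powr_def L_def by (simp add: mult_ac)
  finally show ?thesis unfolding L_def .
qed

text \<open>The decrement \<kappa> is uniform in \<eta> \<ge> \<eta>1; with a decrement depending on
  \<eta> the descent could stall above \<eta>1.\<close>

lemma decoupling_improvement:
  assumes k: "k \<ge> 2" and c: "c > 0" and K: "K \<ge> 0" and \<eta>1: "\<eta>1 > 0"
    and low: "\<And>l \<epsilon>. 1 \<le> l \<Longrightarrow> l < k \<Longrightarrow> \<epsilon> > 0 \<Longrightarrow> \<exists>C\<ge>1. \<forall>m.
      decoupling l (c / 4 ^ k) (K + 2 * real (moment_degree k)) m (C * 2 powr (\<epsilon> * real m))"
  shows "\<exists>\<kappa>>0. \<forall>\<eta>\<ge>\<eta>1. (\<exists>C\<ge>1. \<forall>n. decoupling k c K n (C * 2 powr (\<eta> * real n))) \<longrightarrow>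
      (\<exists>C\<ge>1. \<forall>n. decoupling k c K n (C * 2 powr ((\<eta> - \<kappa>) * real n)))"
proof -
  \<comment> \<open>With this choice \<eta> / k - \<epsilon> \<ge> \<epsilon> for every \<eta> \<ge>
    \<eta>1, so some gain after h rounds is at least h \<epsilon>.\<close>
  define \<epsilon> where "\<epsilon> = \<eta>1 / (2 * real k)"
  have \<epsilon>: "\<epsilon> > 0" unfolding \<epsilon>_def using \<eta>1 k by simp
  obtain h1 :: nat where h1: "4 / \<epsilon> \<le> real h1" using real_arch_simple by blast
  \<comment> \<open>\<open>h2\<close> secures 2 \<kappa> \<le> \<eta>1, which keeps \<eta> - 2
    \<kappa> nonnegative, so that a bound at a smaller scale is also one at scale n.\<close>
  have "\<exists>h2. (1 / real k) ^ h2 < \<eta>1"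
    using k \<eta>1 by (intro real_arch_pow_inv) auto
  then obtain h2 where h2: "(1 / real k) ^ h2 < \<eta>1" by blast
  \<comment> \<open>With \<open>h\<close> iterations the gain exceeds \<open>4\<close>, which beats the loss \<open>2\<^bsup>3b\<^esup>\<close> of \<open>mixed_bound_coarsen\<close>.\<close>
  define h where "h = Suc (h1 + h2)"
  have h: "real h * \<epsilon> \<ge> 4"
  proof -
    have "4 \<le> real h1 * \<epsilon>" using h1 \<epsilon> by (simp add: divide_le_eq)
    also have "\<dots> \<le> real h * \<epsilon>" unfolding h_def using \<epsilon> by (intro mult_right_mono) auto
    finally show ?thesis .
  qed
  \<comment> \<open>A scale b near n / k^(h + 1) yields a saving of 2^-b, that is 2 \<kappa> n in
    the exponent; half of it is given up for the factor n + 1.\<close>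
  define \<kappa> where "\<kappa> = (1 / real k) ^ Suc h / 2"
  have \<kappa>: "\<kappa> > 0" unfolding \<kappa>_def using k by simp
  have \<kappa>\<eta>: "2 * \<kappa> \<le> \<eta>1"
  proof -
    have "(1 / real k) ^ Suc h \<le> (1 / real k) ^ h2"
      using k unfolding h_def by (intro power_decreasing) auto
    then show ?thesis unfolding \<kappa>_def using h2 by simp
  qed
  have "\<exists>C2. \<forall>l. 1 \<le> l \<and> l < k \<longrightarrow> C2 l \<ge> 1 \<and> (\<forall>m. decoupling l (c / 4 ^ k) (K + 2 * real (moment_degree k)) m
      (C2 l * 2 powr (\<epsilon> / real k * real m)))"
  proof (rule choice, rule allI)
    fix l
    show "\<exists>C. 1 \<le> l \<and> l < k \<longrightarrow> C \<ge> 1 \<and> (\<forall>m. decoupling l (c / 4 ^ k) (K + 2 * real (moment_degree k)) m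
      (C * 2 powr (\<epsilon> / real k * real m)))"
      using low[of l "\<epsilon> / real k"] \<epsilon> k by (cases "1 \<le> l \<and> l < k") auto
  qed
  then obtain C2 where C2: "\<And>l. 1 \<le> l \<Longrightarrow> l < k \<Longrightarrow> C2 l \<ge> 1"
    "\<And>l m. 1 \<le> l \<Longrightarrow> l < k \<Longrightarrow> decoupling l (c / 4 ^ k) (K + 2 * real (moment_degree k)) m
      (C2 l * 2 powr (\<epsilon> / real k * real m))" by blast
  define C3 where "C3 = 1 + (\<Sum>l\<in>{1..<k}. C2 l)"
  have C3: "C3 \<ge> 1" unfolding C3_def using C2(1) by (auto intro!: sum_nonneg intro: order_trans[OF zero_le_one])
  have low': "decoupling l (c / 4 ^ k) (K + 2 * real (moment_degree k)) m (C3 * 2 powr (\<epsilon> / real k * real m))"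
    if "1 \<le> l" "l < k" for l m
  proof (rule decoupling_mono[OF C2(2)[OF that]])
    have "C2 l \<le> (\<Sum>l\<in>{1..<k}. C2 l)"
      using that C2(1) by (intro member_le_sum) (auto intro: order_trans[OF zero_le_one])
    then show "C2 l * 2 powr (\<epsilon> / real k * real m) \<le> C3 * 2 powr (\<epsilon> / real k * real m)"
      unfolding C3_def by (intro mult_right_mono) auto
    show "0 \<le> C2 l * 2 powr (\<epsilon> / real k * real m)" using C2(1)[OF that] by simp
  qed
  have "\<exists>C\<ge>1. \<forall>n. decoupling k c K n (C * 2 powr ((\<eta> - \<kappa>) * real n))"
    if \<eta>: "\<eta> \<ge> \<eta>1" and ex: "\<exists>C\<ge>1. \<forall>n. decoupling k c K n (C * 2 powr (\<eta> * real n))" for \<eta>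
  proof -
    from ex obtain C0 where C0: "C0 \<ge> 1" and dec: "\<And>n. decoupling k c K n (C0 * 2 powr (\<eta> * real n))"
      by blast
    have \<eta>0: "\<eta> \<ge> 0" using \<eta> \<eta>1 by linarith
    from mixed_bound_iteration[OF k c K C0 \<eta>0 \<epsilon> dec C3 low', of h] obtain C where C: "C \<ge> 1"
      and it: "\<And>n b l a. k ^ Suc h * b \<le> n \<Longrightarrow> fact k ^ h dvd b \<Longrightarrow> 1 \<le> l \<Longrightarrow> l < k \<Longrightarrow>
        l * a \<le> (k - l + 1) * b \<Longrightarrow>
        mixed_bound k c K n l a b (C * 2 powr (\<eta> * real n - gain k \<eta> \<epsilon> h l * real b))"
      by blast
    obtain l where l: "l \<in> {1..<k}" "gain k \<eta> \<epsilon> h l \<ge> real h * (\<eta> / real k - \<epsilon>)"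
      using exists_large_gain[OF k] by blast
    have g4: "gain k \<eta> \<epsilon> h l \<ge> 4"
    proof -
      have "\<eta>1 / real k - \<epsilon> = \<epsilon>" unfolding \<epsilon>_def using k by (simp add: field_simps)
      moreover have "\<eta>1 / real k \<le> \<eta> / real k" using \<eta> by (intro divide_right_mono) auto
      ultimately have "\<epsilon> \<le> \<eta> / real k - \<epsilon>" by linarith
      then have "real h * \<epsilon> \<le> real h * (\<eta> / real k - \<epsilon>)" by (intro mult_left_mono) auto
      then show ?thesis using h l(2) by linarith
    qed
    \<comment> \<open>Admissible scales b are multiples of \<open>F\<close>, and
      \<open>F * (n div Q)\<close> is the largest one with k^(h + 1) b \<le> n.\<close>
    define F where "F = (fact k :: nat) ^ h"
    define Q where "Q = k ^ Suc h * F"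
    have F: "F \<ge> k"
    proof -
      have "k \<le> fact k" by (rule fact_ge_self)
      also have "\<dots> \<le> (fact k :: nat) ^ h" unfolding h_def by (rule self_le_power) auto
      finally show ?thesis unfolding F_def .
    qed
    have Q: "Q > 0" unfolding Q_def using F k by simp
    define C4 where "C4 = max C (2 * C0)"
    have C4: "C4 \<ge> 1" "C \<le> C4" "2 * C0 \<le> C4" unfolding C4_def using C by auto
    have bil: "bilinear_decoupling k c K n (C4 * 2 powr (\<eta> * real n - real (F * (n div Q))))" if n: "n \<ge> 2" for n
    proof (cases "n div Q = 0")
      case True
      \<comment> \<open>For n < Q there is no room for the iteration, but then no saving is claimed
        either and the trivial mixed bound suffices.\<close>
      have "decoupling k c K (n - 2) (C0 * 2 powr (\<eta> * real n))"
        by (rule decoupling_mono[OF dec]) (use C0 \<eta>0 in \<open>auto intro!: mult_left_mono powr_mono\<close>)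
      then have "mixed_bound k c K n l 2 2 (2 * (C0 * 2 powr (\<eta> * real n)))"
        using n K l C0 by (intro mixed_bound_trivial) auto
      then have "bilinear_decoupling k c K n (2 * (C0 * 2 powr (\<eta> * real n)))"
        using l C0 by (intro bilinear_from_mixed) auto
      then show ?thesis unfolding True
        by (rule bilinear_decoupling_mono) (use C4 C0 in \<open>auto intro!: mult_right_mono simp flip: mult.assoc\<close>)
    next
      case False
      define b where "b = F * (n div Q)"
      have bk: "b \<ge> k" unfolding b_def using False F by (metis One_nat_def Suc_leI le_trans mult_le_mono mult_1_right neq0_conv)
      have kb: "k ^ Suc h * b \<le> n"
      proof -
        have "k ^ Suc h * b = Q * (n div Q)" unfolding b_def Q_def by (simp only: mult.assoc)
        then show ?thesis by simp
      qed
      have "1 * b \<le> k ^ Suc h * b" using k by (intro mult_right_mono) auto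
      then have bn: "b \<le> n" using kb by linarith
      have "l * 2 \<le> 2 * b" using l bk by auto
      also have "\<dots> \<le> (k - l + 1) * b" using l by (intro mult_right_mono) auto
      finally have "mixed_bound k c K n l 2 b (C * 2 powr (\<eta> * real n - gain k \<eta> \<epsilon> h l * real b))"
        using kb l by (intro it) (auto simp: b_def F_def)
      then have "mixed_bound k c K n l 2 2 (2 ^ (3 * b) * (C * 2 powr (\<eta> * real n - gain k \<eta> \<epsilon> h l * real b)))"
        using l bk bn k C by (intro mixed_bound_coarsen) auto
      then have "bilinear_decoupling k c K n (2 ^ (3 * b) * (C * 2 powr (\<eta> * real n - gain k \<eta> \<epsilon> h l * real b)))"
        using l C by (intro bilinear_from_mixed) auto
      moreover have "2 ^ (3 * b) * (C * 2 powr (\<eta> * real n - gain k \<eta> \<epsilon> h l * real b)) \<le> C4 * 2 powr (\<eta> * real n - real b)"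
      proof -
        have "(2::real) ^ (3 * b) = 2 powr (3 * real b)" by (simp flip: powr_realpow)
        then have "2 ^ (3 * b) * (C * 2 powr (\<eta> * real n - gain k \<eta> \<epsilon> h l * real b))
            = C * 2 powr (3 * real b + (\<eta> * real n - gain k \<eta> \<epsilon> h l * real b))"
          by (simp add: powr_add)
        also have "\<dots> \<le> C4 * 2 powr (\<eta> * real n - real b)"
        proof (intro mult_mono powr_mono)
          have "4 * real b \<le> gain k \<eta> \<epsilon> h l * real b" using g4 by (intro mult_right_mono) auto
          then show "3 * real b + (\<eta> * real n - gain k \<eta> \<epsilon> h l * real b) \<le> \<eta> * real n - real b" by linarith
        qed (use C C4 in auto)
        finally show ?thesis .
      qed
      ultimately show ?thesis unfolding b_def[symmetric]
        using C by (auto intro: bilinear_decoupling_mono)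
    qed
    \<comment> \<open>The factor 2^F pays for the rounding in the division by \<open>Q\<close>,
      which costs at most F in the exponent.\<close>
    define C5 where "C5 = C4 * 2 ^ F"
    have C5: "C5 \<ge> 1"
    proof -
      have "1 * 1 \<le> C4 * 2 ^ F" using C4 by (intro mult_mono) auto
      then show ?thesis unfolding C5_def by simp
    qed
    have bil': "bilinear_decoupling k c K m (C5 * 2 powr ((\<eta> - 2 * \<kappa>) * real n))" if m: "2 \<le> m" "m \<le> n" for m n
    proof (rule bilinear_decoupling_mono[OF bil[OF m(1)]])
      have "real F * (2 * \<kappa> * real m / real F - 1) \<le> real F * real (m div Q)"
      proof (intro mult_left_mono)
        have F0: "real F > 0" using F k by simp
        have "2 * \<kappa> * real m / real F = real m / real Q"
          unfolding \<kappa>_def Q_def by (simp add: power_one_over)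
        moreover have "real m / real Q < real (m div Q) + 1"
        proof -
          have "m < Q * (m div Q + 1)" using dividend_less_times_div[OF Q, of m] by simp
          then have "real m < real (Q * (m div Q + 1))" by (simp only: of_nat_less_iff)
          then have "real m < (real (m div Q) + 1) * real Q" by (simp add: algebra_simps)
          then show ?thesis using Q by (simp add: pos_divide_less_eq)
        qed
        ultimately show "2 * \<kappa> * real m / real F - 1 \<le> real (m div Q)" by linarith
      qed auto
      then have "2 * \<kappa> * real m - real F \<le> real (F * (m div Q))" using F k by (simp add: right_diff_distrib)
      then have "\<eta> * real m - real (F * (m div Q)) \<le> (\<eta> - 2 * \<kappa>) * real m + real F"
        by (simp add: left_diff_distrib)
      also have "(\<eta> - 2 * \<kappa>) * real m \<le> (\<eta> - 2 * \<kappa>) * real n"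
        using \<kappa>\<eta> \<eta> m by (intro mult_left_mono) auto
      finally have "2 powr (\<eta> * real m - real (F * (m div Q))) \<le> 2 powr ((\<eta> - 2 * \<kappa>) * real n + real F)"
        by simp
      also have "\<dots> = 2 ^ F * 2 powr ((\<eta> - 2 * \<kappa>) * real n)"
        by (simp add: powr_add powr_realpow)
      finally have "C4 * 2 powr (\<eta> * real m - real (F * (m div Q))) \<le> C4 * (2 ^ F * 2 powr ((\<eta> - 2 * \<kappa>) * real n))"
        using C4 by (intro mult_left_mono) auto
      then show "C4 * 2 powr (\<eta> * real m - real (F * (m div Q))) \<le> C5 * 2 powr ((\<eta> - 2 * \<kappa>) * real n)"
        unfolding C5_def by (simp only: mult.assoc)
      show "0 \<le> C4 * 2 powr (\<eta> * real m - real (F * (m div Q)))" using C4 by simp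
    qed
    define C7 where "C7 = 1 + 1 / (\<kappa> * ln 2)"
    have C7: "C7 \<ge> 1" unfolding C7_def using \<kappa> by simp
    have "decoupling k c K n (7 * C7 * C5 * 2 powr ((\<eta> - \<kappa>) * real n))" for n
    proof -
      define B where "B = C5 * 2 powr ((\<eta> - 2 * \<kappa>) * real n)"
      have "1 * 1 \<le> B" unfolding B_def using C5 \<kappa>\<eta> \<eta>
        by (intro mult_mono ge_one_powr_ge_zero) auto
      then have "decoupling k c K n (7 * (real n + 1) * B)"
        using bil' K k unfolding B_def by (intro decoupling_from_bilinear) auto
      moreover have "7 * (real n + 1) * B \<le> 7 * C7 * C5 * 2 powr ((\<eta> - \<kappa>) * real n)"
      proof -
        have "7 * (real n + 1) * B \<le> 7 * (C7 * 2 powr (\<kappa> * real n)) * B"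
          using linear_le_powr[OF \<kappa>, of n] \<open>1 * 1 \<le> B\<close> unfolding C7_def
          by (intro mult_right_mono mult_left_mono) auto
        also have "\<dots> = 7 * C7 * C5 * (2 powr (\<kappa> * real n) * 2 powr ((\<eta> - 2 * \<kappa>) * real n))"
          unfolding B_def by simp
        also have "2 powr (\<kappa> * real n) * 2 powr ((\<eta> - 2 * \<kappa>) * real n) = 2 powr ((\<eta> - \<kappa>) * real n)"
          unfolding powr_add[symmetric] by (simp add: algebra_simps)
        finally show ?thesis .
      qed
      ultimately show ?thesis using \<open>1 * 1 \<le> B\<close> by (auto intro: decoupling_mono)
    qed
    moreover have "7 * C7 * C5 \<ge> 1"
    proof -
      have "1 * 1 \<le> (7 * C7) * C5" using C5 C7 by (intro mult_mono) auto
      then show ?thesis by simp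
    qed
    ultimately show ?thesis by (intro exI[of _ "7 * C7 * C5"]) auto
  qed
  then show ?thesis using \<kappa> by blast
qed

text \<open>The set of admissible exponents is closed upwards, contains 1, and is stable under
  subtracting a fixed \<kappa> from members that are at least \<eta>; finitely many steps therefore
  reach \<eta>.\<close>

theorem decoupling_moment_curve:
  assumes "k \<ge> 1" "c > 0" "K \<ge> 0" "\<eta> > 0"
  shows "\<exists>C\<ge>1. \<forall>n. decoupling k c K n (C * 2 powr (\<eta> * real n))"
  using assms
proof (induction k arbitrary: c K \<eta> rule: less_induct)
  case (less k)
  show ?case
  proof (cases "k = 1")
    case True
    obtain B where B: "B \<ge> 1" "\<And>n. decoupling 1 c K n B"
      using decoupling_degree_one less.prems by blast
    have "B * 1 \<le> B * 2 powr (\<eta> * real n)" for n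
      using B less.prems by (intro mult_left_mono ge_one_powr_ge_zero) auto
    then have "decoupling 1 c K n (B * 2 powr (\<eta> * real n))" for n
      using B by (intro decoupling_mono[OF B(2)]) auto
    then show ?thesis using B True by blast
  next
    case False
    then have k: "k \<ge> 2" using less.prems by simp
    define H where "H x = (\<exists>C\<ge>1. \<forall>n. decoupling k c K n (C * 2 powr (x * real n)))" for x
    have H_mono: "H y" if "H x" "x \<le> y" for x y
    proof -
      from that obtain C where C: "C \<ge> 1" "\<And>n. decoupling k c K n (C * 2 powr (x * real n))"
        unfolding H_def by blast
      have "decoupling k c K n (C * 2 powr (y * real n))" for n
        by (rule decoupling_mono[OF C(2)]) (use C that in \<open>auto intro!: mult_left_mono powr_mono mult_right_mono\<close>)
      then show ?thesis unfolding H_def using C by blast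
    qed
    have H1: "H 1" unfolding H_def
      using decoupling_trivial[of k] less.prems by (intro exI[of _ 1]) (auto simp: powr_realpow)
    have "\<exists>\<kappa>>0. \<forall>x\<ge>\<eta>. H x \<longrightarrow> H (x - \<kappa>)"
      unfolding H_def
    proof (rule decoupling_improvement[OF k less.prems(2,3,4)])
      fix l and \<epsilon> :: real assume l: "1 \<le> l" "l < k" "\<epsilon> > 0"
      show "\<exists>C\<ge>1. \<forall>m. decoupling l (c / 4 ^ k) (K + 2 * real (moment_degree k)) m (C * 2 powr (\<epsilon> * real m))"
        using less.prems l by (intro less.IH) auto
    qed
    then obtain \<kappa> where \<kappa>: "\<kappa> > 0" "\<And>x. x \<ge> \<eta> \<Longrightarrow> H x \<Longrightarrow> H (x - \<kappa>)" by blast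
    \<comment> \<open>The maximum with \<eta> stops the descent at the point below which no
      decrement is available.\<close>
    have "H (max \<eta> (1 - real j * \<kappa>))" for j
    proof (induction j)
      case 0
      show ?case using H1 by (auto intro: H_mono)
    next
      case (Suc j)
      have "H (max \<eta> (1 - real j * \<kappa>) - \<kappa>)" by (rule \<kappa>(2)[OF _ Suc]) simp
      then show ?case by (rule H_mono) (use \<kappa> in \<open>auto simp: max_def algebra_simps\<close>)
    qed
    moreover obtain j :: nat where "1 / \<kappa> \<le> real j" using real_arch_simple by blast
    then have "1 \<le> real j * \<kappa>" using \<kappa> by (simp add: divide_le_eq)
    ultimately have "H \<eta>" using less.prems by (metis diff_le_0_iff_le max.absorb1 less_imp_le order_trans)
    then show ?thesis unfolding H_def .
  qed
qed

section \<open>Mean values for well-spaced sets\<close>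

lemma sum_list_power_sums_poly:
  "(\<Sum>t\<leftarrow>ts. \<Sum>i\<in>I. f i * g t i) = (\<Sum>i\<in>I. f i * (\<Sum>t\<leftarrow>ts. g t i))" for f :: "'i \<Rightarrow> 'a :: comm_semiring_0"
  by (induction ts) (auto simp: distrib_left sum.distrib)

text \<open>For two tuples with different power sums, the differences are the coefficients of a
  nonzero polynomial in z, which has finitely many roots. Any z that avoids these roots for all
  pairs of short tuples combines the k equations into a single linear one.\<close>

lemma exists_separating_functional:
  fixes A :: "real set"
  assumes "finite A"
  obtains \<theta> :: "real \<Rightarrow> real" where
    "\<And>ts ts'. set ts \<subseteq> A \<Longrightarrow> set ts' \<subseteq> A \<Longrightarrow> length ts \<le> D \<Longrightarrow> length ts' \<le> D \<Longrightarrow>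
      (\<Sum>t\<leftarrow>ts. \<theta> t) = (\<Sum>t\<leftarrow>ts'. \<theta> t) \<longleftrightarrow> (\<forall>j\<in>{1..k}. (\<Sum>t\<leftarrow>ts. t ^ j) = (\<Sum>t\<leftarrow>ts'. t ^ j))"
proof -
  define L where "L = {ts. set ts \<subseteq> A \<and> length ts \<le> D}"
  have finL: "finite L" unfolding L_def by (rule finite_lists_length_le[OF assms])
  define c where "c ts ts' j = (if j = 0 then 0 else (\<Sum>t\<leftarrow>ts. t ^ j) - (\<Sum>t\<leftarrow>ts'. t ^ j))"
    for ts ts' :: "real list" and j :: nat
  define bad where "bad ts ts' = (if \<exists>j\<le>k. c ts ts' j \<noteq> 0 then {z. (\<Sum>j\<le>k. c ts ts' j * z ^ j) = 0} else {})"
    for ts ts'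
  have "finite (bad ts ts')" for ts ts'
    unfolding bad_def using polyfun_finite_roots[of "c ts ts'" k] by auto
  then have "finite (\<Union>ts\<in>L. \<Union>ts'\<in>L. bad ts ts')" using finL by auto
  then have "\<exists>z. z \<notin> (\<Union>ts\<in>L. \<Union>ts'\<in>L. bad ts ts')"
    using ex_new_if_finite infinite_UNIV_char_0 by blast
  then obtain z where z: "\<And>ts ts'. ts \<in> L \<Longrightarrow> ts' \<in> L \<Longrightarrow> z \<notin> bad ts ts'" by blast
  define \<theta> where "\<theta> t = (\<Sum>j\<in>{1..k}. z ^ j * t ^ j)" for t
  show thesis
  proof (rule that[of \<theta>])
    fix ts ts' assume *: "set ts \<subseteq> A" "set ts' \<subseteq> A" "length ts \<le> D" "length ts' \<le> D"
    have "(\<Sum>t\<leftarrow>ts. \<theta> t) - (\<Sum>t\<leftarrow>ts'. \<theta> t) = (\<Sum>j\<in>{1..k}. c ts ts' j * z ^ j)"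
      unfolding \<theta>_def sum_list_power_sums_poly sum_subtractf[symmetric]
      by (intro sum.cong refl) (simp add: c_def algebra_simps)
    also have "\<dots> = (\<Sum>j\<le>k. c ts ts' j * z ^ j)"
      by (intro sum.mono_neutral_left) (auto simp: c_def)
    finally have eq: "(\<Sum>t\<leftarrow>ts. \<theta> t) - (\<Sum>t\<leftarrow>ts'. \<theta> t) = (\<Sum>j\<le>k. c ts ts' j * z ^ j)" .
    have c0: "(\<forall>j\<le>k. c ts ts' j = 0) \<longleftrightarrow> (\<forall>j\<in>{1..k}. (\<Sum>t\<leftarrow>ts. t ^ j) = (\<Sum>t\<leftarrow>ts'. t ^ j))"
      unfolding c_def by auto
    have "z \<notin> bad ts ts'" using * by (intro z) (auto simp: L_def)
    then have "(\<Sum>j\<le>k. c ts ts' j * z ^ j) = 0 \<longleftrightarrow> (\<forall>j\<le>k. c ts ts' j = 0)"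
      unfolding bad_def by (auto split: if_splits)
    then show "(\<Sum>t\<leftarrow>ts. \<theta> t) = (\<Sum>t\<leftarrow>ts'. \<theta> t) \<longleftrightarrow> (\<forall>j\<in>{1..k}. (\<Sum>t\<leftarrow>ts. t ^ j) = (\<Sum>t\<leftarrow>ts'. t ^ j))"
      unfolding eq_iff_diff_eq_0[of "\<Sum>t\<leftarrow>ts. \<theta> t"] eq using c0 by blast
  qed
qed

text \<open>Simultaneous Diophantine approximation replaces the real frequencies by integers without
  changing which short sums coincide.\<close>

lemma exists_integer_frequencies:
  fixes A :: "real set"
  assumes "finite A"
  obtains g :: "real \<Rightarrow> int" where
    "\<And>ts ts'. set ts \<subseteq> A \<Longrightarrow> set ts' \<subseteq> A \<Longrightarrow> length ts \<le> D \<Longrightarrow> length ts' \<le> D \<Longrightarrow>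
      (\<Sum>t\<leftarrow>ts. g t) = (\<Sum>t\<leftarrow>ts'. g t) \<longleftrightarrow> (\<forall>j\<in>{1..k}. (\<Sum>t\<leftarrow>ts. t ^ j) = (\<Sum>t\<leftarrow>ts'. t ^ j))"
proof -
  obtain \<theta> :: "real \<Rightarrow> real" where \<theta>:
    "\<And>ts ts'. set ts \<subseteq> A \<Longrightarrow> set ts' \<subseteq> A \<Longrightarrow> length ts \<le> D \<Longrightarrow> length ts' \<le> D \<Longrightarrow>
      (\<Sum>t\<leftarrow>ts. \<theta> t) = (\<Sum>t\<leftarrow>ts'. \<theta> t) \<longleftrightarrow> (\<forall>j\<in>{1..k}. (\<Sum>t\<leftarrow>ts. t ^ j) = (\<Sum>t\<leftarrow>ts'. t ^ j))"
    using exists_separating_functional[OF assms] by blast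
  define L where "L = {ts. set ts \<subseteq> A \<and> length ts \<le> D}"
  have finL: "finite L" unfolding L_def by (rule finite_lists_length_le[OF assms])
  \<comment> \<open>The value 1 is inserted so that \<delta> is defined, positive and at most 1 even
    if no two sums differ.\<close>
  define V where "V = insert 1 ((\<lambda>(ts, ts'). \<bar>(\<Sum>t\<leftarrow>ts. \<theta> t) - (\<Sum>t\<leftarrow>ts'. \<theta> t)\<bar>) ` (L \<times> L) - {0})"
  define \<delta> where "\<delta> = Min V"
  have finV: "finite V" unfolding V_def using finL by auto
  have "V \<noteq> {}" unfolding V_def by auto
  then have "\<delta> \<in> V" unfolding \<delta>_def using finV by (intro Min_in)
  then have \<delta>0: "\<delta> > 0" unfolding V_def by auto
  have \<delta>1: "\<delta> \<le> 1" unfolding \<delta>_def using finV by (intro Min_le) (auto simp: V_def)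
  have \<delta>L: "\<delta> \<le> \<bar>(\<Sum>t\<leftarrow>ts. \<theta> t) - (\<Sum>t\<leftarrow>ts'. \<theta> t)\<bar>"
    if "ts \<in> L" "ts' \<in> L" "(\<Sum>t\<leftarrow>ts. \<theta> t) \<noteq> (\<Sum>t\<leftarrow>ts'. \<theta> t)" for ts ts'
    unfolding \<delta>_def using finV that by (intro Min_le) (auto simp: V_def)
  obtain N :: nat where N: "(2 * real D + 1) / \<delta> < real N" using reals_Archimedean2 by blast
  have "0 < (2 * real D + 1) / \<delta>" using \<delta>0 by simp
  then have N0: "N > 0" using N by (cases N) auto
  have N1: "2 * real D / real N < \<delta>"
  proof -
    have "2 * real D < 2 * real D + 1" by simp
    also have "\<dots> < real N * \<delta>" using N \<delta>0 by (simp add: pos_divide_less_eq)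
    finally show ?thesis using N0 by (simp add: pos_divide_less_eq mult.commute)
  qed
  obtain h where h: "bij_betw h {0..<card A} A" using ex_bij_betw_nat_finite[OF assms] by blast
  \<comment> \<open>After multiplication by \<open>q\<close> every frequency is within 1 / N of an
    integer, so a sum of at most D of them is off by at most D / N.\<close>
  obtain q p where q: "0 < q" and p: "\<And>i. i < card A \<Longrightarrow> \<bar>of_int q * \<theta> (h i) - of_int (p i)\<bar> < 1 / real N"
    using Dirichlet_approx_simult[OF N0, of "card A" "\<lambda>i. \<theta> (h i)"] by metis
  define g where "g a = p (inv_into {0..<card A} h a)" for a
  have g: "\<bar>of_int q * \<theta> a - of_int (g a)\<bar> \<le> 1 / real N" if "a \<in> A" for a
  proof -
    have "inv_into {0..<card A} h a \<in> {0..<card A}" "h (inv_into {0..<card A} h a) = a"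
      using bij_betwE[OF bij_betw_inv_into[OF h]] bij_betw_inv_into_right[OF h] that by blast+
    then show ?thesis using p[of "inv_into {0..<card A} h a"] unfolding g_def by simp
  qed
  have gl: "\<bar>of_int q * (\<Sum>t\<leftarrow>ts. \<theta> t) - of_int (\<Sum>t\<leftarrow>ts. g t)\<bar> \<le> real (length ts) / real N"
    if "set ts \<subseteq> A" for ts
    using that
  proof (induction ts)
    case (Cons a ts)
    have "\<bar>of_int q * \<theta> a - of_int (g a)\<bar> \<le> 1 / real N" using Cons g by simp
    moreover have "\<bar>of_int q * (\<Sum>t\<leftarrow>ts. \<theta> t) - of_int (\<Sum>t\<leftarrow>ts. g t)\<bar> \<le> real (length ts) / real N"
      using Cons by simp
    moreover have "real (length (a # ts)) / real N = 1 / real N + real (length ts) / real N"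
      by (simp add: add_divide_distrib)
    moreover have "of_int q * (\<Sum>t\<leftarrow>a # ts. \<theta> t) - of_int (\<Sum>t\<leftarrow>a # ts. g t)
        = (of_int q * \<theta> a - of_int (g a)) + (of_int q * (\<Sum>t\<leftarrow>ts. \<theta> t) - of_int (\<Sum>t\<leftarrow>ts. g t))"
      by (simp add: algebra_simps)
    ultimately show ?case by linarith
  qed simp
  show thesis
  proof (rule that[of g])
    fix ts ts' assume *: "set ts \<subseteq> A" "set ts' \<subseteq> A" "length ts \<le> D" "length ts' \<le> D"
    define a where "a = (\<Sum>t\<leftarrow>ts. \<theta> t)"
    define a' where "a' = (\<Sum>t\<leftarrow>ts'. \<theta> t)"
    define b where "b = (\<Sum>t\<leftarrow>ts. g t)"
    define b' where "b' = (\<Sum>t\<leftarrow>ts'. g t)"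
    have "real (length ts) / real N \<le> real D / real N" "real (length ts') / real N \<le> real D / real N"
      using * by (auto intro!: divide_right_mono)
    then have "\<bar>of_int q * a - of_int b\<bar> \<le> real D / real N" "\<bar>of_int q * a' - of_int b'\<bar> \<le> real D / real N"
      using gl[OF *(1)] gl[OF *(2)] unfolding a_def a'_def b_def b'_def by linarith+
    moreover have "of_int q * (a - a') - of_int (b - b') = (of_int q * a - of_int b) - (of_int q * a' - of_int b')"
      by (simp add: algebra_simps)
    moreover have "2 * real D / real N = real D / real N + real D / real N" by (simp add: add_divide_distrib[symmetric])
    ultimately have close: "\<bar>of_int q * (a - a') - of_int (b - b')\<bar> < \<delta>" using N1 by linarith
    \<comment> \<open>Equal real sums give integers at distance below 1. Distinct real sums are at
      least \<delta> apart, and the factor q \<ge> 1 can only widen this.\<close>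
    have "a = a' \<longleftrightarrow> b = b'"
    proof
      assume "a = a'"
      then have "\<bar>real_of_int (b - b')\<bar> < 1" using close \<delta>1 by simp
      then show "b = b'" by linarith
    next
      assume "b = b'"
      then have lt: "\<bar>of_int q * (a - a')\<bar> < \<delta>" using close by simp
      have "1 * \<bar>a - a'\<bar> \<le> \<bar>of_int q\<bar> * \<bar>a - a'\<bar>" using q by (intro mult_right_mono) auto
      then have "\<bar>a - a'\<bar> < \<delta>" using lt by (simp add: abs_mult)
      then show "a = a'" using \<delta>L[of ts ts'] * unfolding a_def a'_def L_def by fastforce
    qed
    then show "(\<Sum>t\<leftarrow>ts. g t) = (\<Sum>t\<leftarrow>ts'. g t) \<longleftrightarrow> (\<forall>j\<in>{1..k}. (\<Sum>t\<leftarrow>ts. t ^ j) = (\<Sum>t\<leftarrow>ts'. t ^ j))"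
      using \<theta>[OF *] unfolding a_def a'_def b_def b'_def by simp
  qed
qed

lemma sum_roots_of_unity:
  fixes v :: int
  assumes "N > 0" "\<bar>v\<bar> < int N"
  shows "(\<Sum>\<omega><N. cis (2 * pi * of_int v / real N) ^ \<omega>) = (if v = 0 then of_nat N else 0)"
proof (cases "v = 0")
  case False
  define z where "z = cis (2 * pi * of_int v / real N)"
  have "real N * (2 * pi * of_int v / real N) = 2 * pi * of_int v" using assms by simp
  then have zN: "z ^ N = 1" unfolding z_def Complex.DeMoivre by (simp only: cis_multiple_2pi[OF Ints_of_int])
  have "z \<noteq> 1"
  proof
    assume "z = 1"
    then have "cos (2 * pi * of_int v / real N) = 1" unfolding z_def by (simp add: complex_eq_iff)
    then obtain m :: int where "2 * pi * of_int v / real N = of_int m * 2 * pi"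
      using cos_one_2pi_int by blast
    then have "real_of_int v = of_int m * real N" using assms by (simp add: field_simps)
    then have "real_of_int v = real_of_int (m * int N)" by simp
    then have v: "v = m * int N" by (simp only: of_int_eq_iff)
    then have "m \<noteq> 0" using False by auto
    then have "1 * int N \<le> \<bar>m\<bar> * int N" by (intro mult_right_mono) auto
    then show False using assms(2) unfolding v abs_mult by simp
  qed
  then show ?thesis using False geometric_sum[of z N] zN unfolding z_def by simp
qed simp

lemma prod_list_cis_power:
  "(\<Prod>t\<leftarrow>ts. cis (2 * pi * of_int (g t) / real N) ^ \<omega>) = cis (2 * pi * of_int (\<Sum>t\<leftarrow>ts. g t) / real N) ^ \<omega>"
proof (induction ts)
  case (Cons a ts)
  have "cis (2 * pi * of_int (g a) / real N) ^ \<omega> * cis (2 * pi * of_int (\<Sum>t\<leftarrow>ts. g t) / real N) ^ \<omega>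
      = cis (2 * pi * of_int (\<Sum>t\<leftarrow>a # ts. g t) / real N) ^ \<omega>"
    unfolding power_mult_distrib[symmetric] cis_mult
    by (simp add: add_divide_distrib[symmetric] distrib_left[symmetric])
  then show ?case using Cons by simp
qed simp

text \<open>On the residues modulo N with uniform measure, characters of integer frequencies are
  exactly orthogonal as long as no sum of frequencies wraps around. Exactness is what permits the
  tolerance K = 0 in the mean value.\<close>

lemma exists_character_model:
  fixes A :: "real set"
  assumes "finite A"
  obtains N :: nat and e :: "real \<Rightarrow> nat \<Rightarrow> complex" where "N > 0" "\<And>t \<omega>. cmod (e t \<omega>) = 1"
    "\<And>ts ts'. set ts \<subseteq> A \<Longrightarrow> set ts' \<subseteq> A \<Longrightarrow> length ts \<le> D \<Longrightarrow> length ts' \<le> D \<Longrightarrow>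
      (\<Sum>\<omega><N. complex_of_real (1 / real N) * ((\<Prod>t\<leftarrow>ts. e t \<omega>) * cnj (\<Prod>t\<leftarrow>ts'. e t \<omega>)))
        = (if \<forall>j\<in>{1..k}. (\<Sum>t\<leftarrow>ts. t ^ j) = (\<Sum>t\<leftarrow>ts'. t ^ j) then 1 else 0)"
proof -
  obtain g :: "real \<Rightarrow> int" where g:
    "\<And>ts ts'. set ts \<subseteq> A \<Longrightarrow> set ts' \<subseteq> A \<Longrightarrow> length ts \<le> D \<Longrightarrow> length ts' \<le> D \<Longrightarrow>
      (\<Sum>t\<leftarrow>ts. g t) = (\<Sum>t\<leftarrow>ts'. g t) \<longleftrightarrow> (\<forall>j\<in>{1..k}. (\<Sum>t\<leftarrow>ts. t ^ j) = (\<Sum>t\<leftarrow>ts'. t ^ j))"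
    using exists_integer_frequencies[OF assms] by blast
  define G where "G = (\<Sum>a\<in>A. nat \<bar>g a\<bar>)"
  \<comment> \<open>Two sums of at most D frequencies differ by at most 2 D G, hence never by a
    nonzero multiple of \<open>N\<close>.\<close>
  define N where "N = 2 * D * G + 1"
  have gG: "\<bar>g a\<bar> \<le> int G" if "a \<in> A" for a
  proof -
    have "nat \<bar>g a\<bar> \<le> G" unfolding G_def using that assms by (intro member_le_sum) auto
    then show ?thesis by linarith
  qed
  have gs: "\<bar>\<Sum>t\<leftarrow>ts. g t\<bar> \<le> int (length ts) * int G" if "set ts \<subseteq> A" for ts
    using that
  proof (induction ts)
    case (Cons a ts)
    then have "\<bar>g a\<bar> \<le> int G" "\<bar>\<Sum>t\<leftarrow>ts. g t\<bar> \<le> int (length ts) * int G" using gG by auto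
    then show ?case by (simp add: distrib_right)
  qed simp
  define e where "e t \<omega> = cis (2 * pi * of_int (g t) / real N) ^ \<omega>" for t and \<omega> :: nat
  show thesis
  proof (rule that[of N e])
    show N0: "N > 0" unfolding N_def by simp
    show "cmod (e t \<omega>) = 1" for t \<omega> unfolding e_def by (simp add: norm_power)
    fix ts ts' assume *: "set ts \<subseteq> A" "set ts' \<subseteq> A" "length ts \<le> D" "length ts' \<le> D"
    define v where "v = (\<Sum>t\<leftarrow>ts. g t) - (\<Sum>t\<leftarrow>ts'. g t)"
    have "int (length ts) * int G \<le> int D * int G" "int (length ts') * int G \<le> int D * int G"
      using * by (auto intro!: mult_right_mono)
    then have "\<bar>v\<bar> \<le> 2 * (int D * int G)" using gs[OF *(1)] gs[OF *(2)] unfolding v_def by linarith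
    then have vN: "\<bar>v\<bar> < int N" unfolding N_def by simp
    have pt: "(\<Prod>t\<leftarrow>ts. e t \<omega>) * cnj (\<Prod>t\<leftarrow>ts'. e t \<omega>) = cis (2 * pi * of_int v / real N) ^ \<omega>" for \<omega>
    proof -
      have "2 * pi * of_int (\<Sum>t\<leftarrow>ts. g t) / real N + - (2 * pi * of_int (\<Sum>t\<leftarrow>ts'. g t) / real N)
          = 2 * pi * of_int v / real N"
        unfolding v_def by (simp add: diff_divide_distrib[symmetric] right_diff_distrib[symmetric])
      then show ?thesis
        unfolding e_def prod_list_cis_power complex_cnj_power cis_cnj power_mult_distrib[symmetric] cis_mult
        by simp
    qed
    have "(\<Sum>\<omega><N. complex_of_real (1 / real N) * ((\<Prod>t\<leftarrow>ts. e t \<omega>) * cnj (\<Prod>t\<leftarrow>ts'. e t \<omega>)))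
        = complex_of_real (1 / real N) * (if v = 0 then of_nat N else 0)"
      unfolding pt sum_distrib_left[symmetric] sum_roots_of_unity[OF N0 vN] ..
    also have "\<dots> = (if v = 0 then 1 else 0)" using N0 by simp
    also have "v = 0 \<longleftrightarrow> (\<forall>j\<in>{1..k}. (\<Sum>t\<leftarrow>ts. t ^ j) = (\<Sum>t\<leftarrow>ts'. t ^ j))"
      using g[OF *] unfolding v_def by simp
    finally show "(\<Sum>\<omega><N. complex_of_real (1 / real N) * ((\<Prod>t\<leftarrow>ts. e t \<omega>) * cnj (\<Prod>t\<leftarrow>ts'. e t \<omega>)))
        = (if \<forall>j\<in>{1..k}. (\<Sum>t\<leftarrow>ts. t ^ j) = (\<Sum>t\<leftarrow>ts'. t ^ j) then 1 else 0)" .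
  qed
qed

text \<open>Expanding the d-th power of the exponential sum over all d-tuples, orthogonality keeps
  precisely the pairs with equal power sums.\<close>

lemma vinogradov_J_eq_moment:
  assumes fin: "finite A" and N: "N > 0"
    and orth: "\<And>ts ts'. set ts \<subseteq> A \<Longrightarrow> set ts' \<subseteq> A \<Longrightarrow> length ts \<le> d \<Longrightarrow> length ts' \<le> d \<Longrightarrow>
      (\<Sum>\<omega><N. complex_of_real (1 / real N) * ((\<Prod>t\<leftarrow>ts. e t \<omega>) * cnj (\<Prod>t\<leftarrow>ts'. e t \<omega>)))
        = (if \<forall>j\<in>{1..k}. (\<Sum>t\<leftarrow>ts. t ^ j) = (\<Sum>t\<leftarrow>ts'. t ^ j) then 1 else 0)"
  shows "real (vinogradov_J d k A) = moment {..<N} (\<lambda>_. 1 / real N) (2 * d) (expsum e A)"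
proof -
  define P where "P = {1..d} \<rightarrow>\<^sub>E A"
  have finP: "finite P" unfolding P_def using fin by (intro finite_PiE) auto
  define E where "E x \<omega> = (\<Prod>i\<in>{1..d}. e (x i) \<omega>)" for x \<omega>
  define sol where "sol p \<longleftrightarrow> (\<forall>j\<in>{1..k}. (\<Sum>i=1..d. fst p i ^ j) = (\<Sum>i=1..d. snd p i ^ j))"
    for p :: "(nat \<Rightarrow> real) \<times> (nat \<Rightarrow> real)"
  have pow: "expsum e A \<omega> ^ d = (\<Sum>x\<in>P. E x \<omega>)" for \<omega>
  proof -
    have "expsum e A \<omega> ^ d = (\<Prod>i\<in>{1..d}. \<Sum>a\<in>A. e a \<omega>)" unfolding expsum_def by simp
    also have "\<dots> = (\<Sum>x\<in>P. E x \<omega>)" unfolding P_def E_def using fin by (intro prod_sum_PiE) auto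
    finally show ?thesis .
  qed
  have Esum: "(\<Sum>\<omega><N. complex_of_real (1 / real N) * (E x \<omega> * cnj (E y \<omega>))) = (if sol (x, y) then 1 else 0)"
    if "x \<in> P" "y \<in> P" for x y
  proof -
    have l: "(\<Sum>t\<leftarrow>map x [1..<Suc d]. h t) = (\<Sum>i=1..d. h (x i))" for h :: "real \<Rightarrow> real" and x
      unfolding map_map o_def interv_sum_list_conv_sum_set_nat by (intro sum.cong) auto
    have e: "(\<Prod>t\<leftarrow>map x [1..<Suc d]. e t \<omega>) = E x \<omega>" for x \<omega>
      unfolding E_def map_map o_def prod.distinct_set_conv_list[symmetric, OF distinct_upt]
      by (intro prod.cong) auto
    have sub: "set (map x [1..<Suc d]) \<subseteq> A" "length (map x [1..<Suc d]) \<le> d" if "x \<in> P" for x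
      using that unfolding P_def by auto
    show ?thesis
      using orth[OF sub(1)[OF that(1)] sub(1)[OF that(2)] sub(2)[OF that(1)] sub(2)[OF that(2)]]
      unfolding e l sol_def by simp
  qed
  have "complex_of_real (moment {..<N} (\<lambda>_. 1 / real N) (2 * d) (expsum e A))
      = (\<Sum>\<omega><N. complex_of_real (1 / real N) * (expsum e A \<omega> ^ d * cnj (expsum e A \<omega> ^ d)))"
    unfolding moment_def of_real_sum
  proof (intro sum.cong refl)
    fix \<omega>
    have "complex_of_real (cmod (expsum e A \<omega>) ^ (2 * d)) = complex_of_real (cmod (expsum e A \<omega> ^ d) ^ 2)"
      by (simp add: norm_power power_even_eq)
    also have "\<dots> = expsum e A \<omega> ^ d * cnj (expsum e A \<omega> ^ d)"
      using complex_norm_square by simp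
    finally show "complex_of_real (1 / real N * cmod (expsum e A \<omega>) ^ (2 * d))
        = complex_of_real (1 / real N) * (expsum e A \<omega> ^ d * cnj (expsum e A \<omega> ^ d))"
      unfolding of_real_mult by simp
  qed
  also have "\<dots> = (\<Sum>\<omega><N. \<Sum>x\<in>P. \<Sum>y\<in>P. complex_of_real (1 / real N) * (E x \<omega> * cnj (E y \<omega>)))"
    unfolding pow cnj_sum sum_product
    unfolding sum_distrib_left ..
  also have "\<dots> = (\<Sum>x\<in>P. \<Sum>y\<in>P. \<Sum>\<omega><N. complex_of_real (1 / real N) * (E x \<omega> * cnj (E y \<omega>)))"
    by (rule sym, rule trans[OF sum.cong[OF refl sum.swap] sum.swap])
  also have "\<dots> = (\<Sum>x\<in>P. \<Sum>y\<in>P. if sol (x, y) then 1 else 0)"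
    using Esum by (intro sum.cong refl) auto
  also have "\<dots> = (\<Sum>p\<in>P \<times> P. if sol p then 1 else 0)"
    by (simp add: sum.cartesian_product split_def)
  also have "\<dots> = of_nat (card {p \<in> P \<times> P. sol p})"
    using finP by (simp add: sum.If_cases Int_def)
  also have "{p \<in> P \<times> P. sol p} = vinogradov_solutions d k A"
    unfolding vinogradov_solutions_def P_def sol_def by auto
  finally have "complex_of_real (moment {..<N} (\<lambda>_. 1 / real N) (2 * d) (expsum e A))
      = complex_of_real (real (vinogradov_J d k A))"
    unfolding vinogradov_J_def by simp
  then show ?thesis by (simp only: of_real_eq_iff)
qed

section \<open>Mean values at the critical exponent\<close>

text \<open>Translation-dilation invariance of the Vinogradov system, by the binomial theorem. Equal
  lengths supply the power sum of degree 0 that the expansion produces.\<close>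

lemma power_sums_affine:
  fixes ts ts' :: "real list"
  assumes "length ts = length ts'" "\<And>j. 1 \<le> j \<Longrightarrow> j \<le> k \<Longrightarrow> (\<Sum>t\<leftarrow>ts. t ^ j) = (\<Sum>t\<leftarrow>ts'. t ^ j)" "j \<le> k"
  shows "(\<Sum>t\<leftarrow>ts. ((t + a) / M) ^ j) = (\<Sum>t\<leftarrow>ts'. ((t + a) / M) ^ j)"
proof -
  have eq: "(\<Sum>t\<leftarrow>us. ((t + a) / M) ^ j) = (\<Sum>i\<le>j. of_nat (j choose i) * a ^ (j - i) / M ^ j * (\<Sum>t\<leftarrow>us. t ^ i))" for us
  proof -
    have "((t + a) / M) ^ j = (\<Sum>i\<le>j. of_nat (j choose i) * a ^ (j - i) / M ^ j * t ^ i)" for t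
      unfolding power_divide binomial_ring sum_divide_distrib
      by (intro sum.cong refl) (simp add: mult_ac)
    then show ?thesis unfolding sum_list_power_sums_poly[symmetric] by simp
  qed
  have "(\<Sum>t\<leftarrow>ts. t ^ i) = (\<Sum>t\<leftarrow>ts'. t ^ i)" if "i \<le> j" for i
  proof (cases "i = 0")
    case True
    then show ?thesis using assms(1) by (simp add: sum_list_triv)
  qed (use assms that in auto)
  then show ?thesis unfolding eq by (intro sum.cong refl) auto
qed

lemma degree_prod_list_linear: "degree (\<Prod>\<xi>\<leftarrow>\<xi>s. [:- \<xi>, 1:]) \<le> length \<xi>s"
proof (induction \<xi>s)
  case (Cons \<xi> \<xi>s)
  have "degree ([:- \<xi>, 1:] * (\<Prod>\<xi>\<leftarrow>\<xi>s. [:- \<xi>, 1:])) \<le> degree [:- \<xi>, 1:] + degree (\<Prod>\<xi>\<leftarrow>\<xi>s. [:- \<xi>, 1:])"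
    by (rule degree_mult_le)
  then show ?case using Cons by simp
qed simp

text \<open>Scaling A into the unit interval gives the moment curve itself, with weight 1 and
  tolerance 0. Its cells at scale n are unit intervals of the original line counted from
  \<open>Inf A\<close>; each holds at most two points, so the square sum is comparable to
  |A|.\<close>

theorem vinogradov_mean_value:
  assumes k: "k \<ge> 1" and dec: "decoupling k 1 0 n B" and B: "B \<ge> 0"
    and fin: "finite A" and ne: "A \<noteq> {}" and diam: "Sup A - Inf A < 2 ^ n"
    and spaced: "\<And>i. card {t \<in> A. \<lfloor>t - Inf A\<rfloor> = i} \<le> 2"
  shows "real (vinogradov_J (moment_degree k) k A) \<le> (B * (2 * real (card A))) ^ moment_degree k"
proof -
  define d where "d = moment_degree k"
  have d: "d \<ge> 1" unfolding d_def by (rule moment_degree_pos[OF k])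
  obtain N :: nat and e :: "real \<Rightarrow> nat \<Rightarrow> complex" where N: "N > 0" and e1: "\<And>t \<omega>. cmod (e t \<omega>) = 1"
    and orth: "\<And>ts ts'. set ts \<subseteq> A \<Longrightarrow> set ts' \<subseteq> A \<Longrightarrow> length ts \<le> d \<Longrightarrow> length ts' \<le> d \<Longrightarrow>
      (\<Sum>\<omega><N. complex_of_real (1 / real N) * ((\<Prod>t\<leftarrow>ts. e t \<omega>) * cnj (\<Prod>t\<leftarrow>ts'. e t \<omega>)))
        = (if \<forall>j\<in>{1..k}. (\<Sum>t\<leftarrow>ts. t ^ j) = (\<Sum>t\<leftarrow>ts'. t ^ j) then 1 else 0)"
    using exists_character_model[OF fin, of d k] by blast
  define x where "x t = (t + - Inf A) / 2 ^ n" for t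
  define p where "p \<xi>s = (\<Prod>\<xi>\<leftarrow>\<xi>s. [:- \<xi>, 1:])" for \<xi>s :: "real list"
  define \<Phi> where "\<Phi> \<xi>s u = (\<Sum>i<k. coeff (p \<xi>s) i / (real i + 1) * u ^ (i + 1))" for \<xi>s u
  have sys: "vsystem k 1 0 n {..<N} (\<lambda>_. 1 / real N) A x e"
  proof (rule vsystemI[where w = "\<lambda>_. 1" and \<Phi> = \<Phi>])
    fix t assume t: "t \<in> A"
    have "Inf A \<le> t" "t \<le> Sup A" using t fin by (auto intro: cInf_lower cSup_upper)
    then have "0 \<le> t + - Inf A" "t + - Inf A < 2 ^ n" using diam by linarith+
    then show "0 \<le> x t \<and> x t < 1" unfolding x_def by simp
  next
    fix \<xi>s :: "real list" and u :: real assume len: "length \<xi>s < k"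
    have "((\<lambda>u. coeff (p \<xi>s) i / (real i + 1) * u ^ (i + 1)) has_real_derivative
        coeff (p \<xi>s) i / (real i + 1) * (real (i + 1) * u ^ i)) (at u)" for i
      by (rule DERIV_cmult) (use DERIV_pow[of "i + 1" u] in simp)
    then have "(\<Phi> \<xi>s has_real_derivative (\<Sum>i<k. coeff (p \<xi>s) i / (real i + 1) * (real (i + 1) * u ^ i))) (at u)"
      unfolding \<Phi>_def by (intro DERIV_sum) auto
    also have "(\<Sum>i<k. coeff (p \<xi>s) i / (real i + 1) * (real (i + 1) * u ^ i)) = (\<Sum>i<k. coeff (p \<xi>s) i * u ^ i)"
    proof (intro sum.cong refl)
      fix i
      have "z \<noteq> 0 \<Longrightarrow> y / z * (z * v) = y * v" for y z v :: real by simp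
      moreover have "real (i + 1) = real i + 1" "real i + 1 \<noteq> 0" by auto
      ultimately show "coeff (p \<xi>s) i / (real i + 1) * (real (i + 1) * u ^ i) = coeff (p \<xi>s) i * u ^ i"
        by (simp only:)
    qed
    also have "\<dots> = poly (p \<xi>s) u"
    proof -
      have "degree (p \<xi>s) < k" using degree_prod_list_linear[of \<xi>s] len unfolding p_def by linarith
      then show ?thesis unfolding poly_altdef
        by (intro sum.mono_neutral_right) (auto simp: coeff_eq_0 not_le)
    qed
    also have "poly (p \<xi>s) u = 1 * (\<Prod>\<xi>\<leftarrow>\<xi>s. u - \<xi>)" unfolding p_def by (induction \<xi>s) (auto simp: algebra_simps)
    finally show "(\<Phi> \<xi>s has_real_derivative 1 * (\<Prod>\<xi>\<leftarrow>\<xi>s. u - \<xi>)) (at u)" .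
  next
    fix ts ts' \<xi>s
    assume *: "length ts = length ts'" "length ts \<le> moment_degree k" "set ts \<subseteq> A" "set ts' \<subseteq> A"
      and nz: "(\<Sum>\<omega>\<in>{..<N}. complex_of_real (1 / real N) * ((\<Prod>t\<leftarrow>ts. e t \<omega>) * cnj (\<Prod>t\<leftarrow>ts'. e t \<omega>))) \<noteq> 0"
    have "\<forall>j\<in>{1..k}. (\<Sum>t\<leftarrow>ts. t ^ j) = (\<Sum>t\<leftarrow>ts'. t ^ j)"
      using nz orth[of ts ts'] * unfolding d_def by (auto split: if_splits)
    then have eq: "(\<Sum>t\<leftarrow>ts. x t ^ j) = (\<Sum>t\<leftarrow>ts'. x t ^ j)" if "j \<le> k" for j
      unfolding x_def using * that by (intro power_sums_affine) auto
    have "(\<Sum>t\<leftarrow>ts. \<Phi> \<xi>s (x t)) = (\<Sum>t\<leftarrow>ts'. \<Phi> \<xi>s (x t))"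
      unfolding \<Phi>_def sum_list_power_sums_poly
    proof (intro sum.cong refl)
      fix i assume "i \<in> {..<k}"
      then have "i + 1 \<le> k" by simp
      from eq[OF this] show "coeff (p \<xi>s) i / (real i + 1) * (\<Sum>t\<leftarrow>ts. x t ^ (i + 1))
          = coeff (p \<xi>s) i / (real i + 1) * (\<Sum>t\<leftarrow>ts'. x t ^ (i + 1))" by (simp only:)
    qed
    then show "\<bar>(\<Sum>t\<leftarrow>ts. \<Phi> \<xi>s (x t)) - (\<Sum>t\<leftarrow>ts'. \<Phi> \<xi>s (x t))\<bar> \<le> 0 * (1 / 2) ^ (n * k)" by simp
  qed (use fin in auto)
  have cellcard: "card (cell x A n i) \<le> 2" for i
  proof -
    have "2 ^ n * x t = t - Inf A" for t unfolding x_def by simp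
    then show ?thesis using spaced[of i] unfolding cell_def by simp
  qed
  have each: "moment {..<N} (\<lambda>_. 1 / real N) (2 * d) (expsum e (cell x A n i)) powr (1 / real d) \<le> 2 * real (card (cell x A n i))" for i
  proof -
    define z where "z = real (card (cell x A n i))"
    have z: "0 \<le> z" "z \<le> 2" unfolding z_def using cellcard[of i] by auto
    have "moment {..<N} (\<lambda>_. 1 / real N) (2 * d) (expsum e (cell x A n i)) powr (1 / real d) \<le> z ^ 2"
    proof (rule powr_inverse_le)
      have "cmod (expsum e (cell x A n i) \<omega>) \<le> z" for \<omega>
        using norm_sum[of "\<lambda>t. e t \<omega>" "cell x A n i"] unfolding expsum_def z_def by (simp add: e1)
      then have "moment {..<N} (\<lambda>_. 1 / real N) (2 * d) (expsum e (cell x A n i)) \<le> (\<Sum>\<omega><N. 1 / real N * z ^ (2 * d))"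
        unfolding moment_def by (intro sum_mono mult_left_mono power_mono) auto
      also have "\<dots> = (z ^ 2) ^ d" using N by (simp add: power_mult)
      finally show "moment {..<N} (\<lambda>_. 1 / real N) (2 * d) (expsum e (cell x A n i)) \<le> (z ^ 2) ^ d" .
    qed (use d in \<open>auto intro: moment_nonneg\<close>)
    \<comment> \<open>At most two points per cell turn the sum of squared cell sizes into 2
      |A|.\<close>
    also have "z ^ 2 \<le> 2 * z" unfolding power2_eq_square using z by (intro mult_right_mono) auto
    finally show ?thesis unfolding z_def .
  qed
  have "sqsum {..<N} (\<lambda>_. 1 / real N) x e d n A \<le> (\<Sum>i\<in>{0..<2 ^ n}. 2 * real (card (cell x A n i)))"
    unfolding sqsum_def using each by (intro sum_mono)
  also have "\<dots> \<le> 2 * real (card A)"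
  proof -
    have "(\<Sum>i\<in>{0..<2 ^ n}. card (cell x A n i)) = card (\<Union>i\<in>{0..<2 ^ n}. cell x A n i)"
      using fin by (intro card_UN_disjoint[symmetric]) (auto simp: cell_def)
    also have "\<dots> \<le> card A" using fin by (intro card_mono) (auto simp: cell_def)
    finally have "(\<Sum>i\<in>{0..<2 ^ n}. real (card (cell x A n i))) \<le> real (card A)"
      by (simp only: of_nat_sum[symmetric] of_nat_le_iff)
    then show ?thesis by (simp add: sum_distrib_left[symmetric])
  qed
  finally have sq: "sqsum {..<N} (\<lambda>_. 1 / real N) x e d n A \<le> 2 * real (card A)" .
  have "real (vinogradov_J d k A) = moment {..<N} (\<lambda>_. 1 / real N) (2 * d) (expsum e A)"
    by (rule vinogradov_J_eq_moment[OF fin N orth])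
  also have "\<dots> \<le> (B * sqsum {..<N} (\<lambda>_. 1 / real N) x e d n A) ^ d"
    unfolding d_def by (rule decouplingD[OF dec sys])
  also have "\<dots> \<le> (B * (2 * real (card A))) ^ d"
    using sq B sqsum_nonneg by (intro power_mono mult_left_mono mult_nonneg_nonneg) auto
  finally show ?thesis unfolding d_def .
qed

text \<open>An interval [y, y + 1) is covered by two consecutive intervals (j, j + 1] with integral
  j, each of which holds at most one point.\<close>

lemma well_spaced_unit_cell:
  assumes ws: "well_spaced A" and ne: "A \<noteq> {}"
  shows "card {t \<in> A. \<lfloor>t - Inf A\<rfloor> = i} \<le> 2"
proof (cases "{t \<in> A. \<lfloor>t - Inf A\<rfloor> = i} = {}")
  case False
  have fin: "finite A" using ws unfolding well_spaced_def by simp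
  obtain a where a: "a \<in> A" "\<lfloor>a - Inf A\<rfloor> = i" using False by auto
  have Inf: "Inf A \<le> t" "t \<le> Sup A" if "t \<in> A" for t
    using that fin by (auto intro: cInf_lower cSup_upper)
  define y where "y = Inf A + of_int i"
  define j where "j = \<lceil>y\<rceil> - 1"
  have i0: "i \<ge> 0" using a Inf[OF a(1)] by (auto simp: le_floor_iff)
  have j: "of_int j < y" "y \<le> of_int j + 1" unfolding j_def by linarith+
  have ya: "y \<le> t" "t < y + 1" if "t \<in> A" "\<lfloor>t - Inf A\<rfloor> = i" for t
    using that unfolding y_def by linarith+
  \<comment> \<open>Well-spacedness speaks of integers in a bounded range; the upper of the two
    intervals may lie beyond \<open>Sup A\<close>, where it contains no point.\<close>
  have one: "card (A \<inter> {of_int j' <.. of_int j' + 1}) \<le> 1" if "j' \<in> {j, j + 1}" for j' :: int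
  proof (cases "of_int j' \<le> Sup A")
    case True
    have "y \<ge> Inf A" unfolding y_def using i0 by simp
    then have "Inf A - 1 \<le> of_int j'" using j that by auto
    then show ?thesis using ws True unfolding well_spaced_def by blast
  next
    case False
    then have "A \<inter> {of_int j' <.. of_int j' + 1} = {}" using Inf(2) by force
    then show ?thesis by simp
  qed
  have "{t \<in> A. \<lfloor>t - Inf A\<rfloor> = i} \<subseteq> (A \<inter> {of_int j <.. of_int j + 1}) \<union> (A \<inter> {of_int (j + 1) <.. of_int (j + 1) + 1})"
  proof
    fix t assume "t \<in> {t \<in> A. \<lfloor>t - Inf A\<rfloor> = i}"
    then have t: "t \<in> A" "y \<le> t" "t < y + 1" using ya by auto
    have "of_int j < t" "t \<le> of_int j + 1 + 1" using t j by linarith+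
    then show "t \<in> (A \<inter> {of_int j <.. of_int j + 1}) \<union> (A \<inter> {of_int (j + 1) <.. of_int (j + 1) + 1})"
      using t(1) by (cases "t \<le> of_int j + 1") auto
  qed
  then have "card {t \<in> A. \<lfloor>t - Inf A\<rfloor> = i}
      \<le> card ((A \<inter> {of_int j <.. of_int j + 1}) \<union> (A \<inter> {of_int (j + 1) <.. of_int (j + 1) + 1}))"
    using fin by (intro card_mono) auto
  also have "\<dots> \<le> card (A \<inter> {of_int j <.. of_int j + 1}) + card (A \<inter> {of_int (j + 1) <.. of_int (j + 1) + 1})"
    by (rule card_Un_le)
  also have "\<dots> \<le> 1 + 1" using one[of j] one[of "j + 1"] by (intro add_mono) auto
  finally show ?thesis by simp
qed (simp only: card.empty)

text \<open>Since 2^n is about |A|^m, the loss 2^(\<eta> n d) is about |A|^(m \<eta> d). With \<eta>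
  = \<delta> / (2 m d) this is half of the allowed \<delta>; the other half absorbs the constants
  once |A| is large.\<close>

theorem vinogradov_mean_value_well_spaced:
  assumes k: "k \<ge> 1" and \<delta>: "\<delta> > 0" and m: "m \<ge> 1"
  shows "\<exists>N::nat. \<forall>A. well_spaced A \<and> card A \<ge> N \<and> real_diam A \<le> real (card A) powr m \<longrightarrow>
    real (vinogradov_J (moment_degree k) k A) \<le> real (card A) powr (real (moment_degree k) + \<delta>)"
proof -
  define d where "d = moment_degree k"
  have d: "d \<ge> 1" unfolding d_def by (rule moment_degree_pos[OF k])
  define \<eta> where "\<eta> = \<delta> / (2 * m * real d)"
  have \<eta>: "\<eta> > 0" unfolding \<eta>_def using \<delta> m d by simp
  obtain C where C: "C \<ge> 1" and dec: "\<And>n. decoupling k 1 0 n (C * 2 powr (\<eta> * real n))"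
    using decoupling_moment_curve[OF k, of 1 0 \<eta>] \<eta> by auto
  define W where "W = (C * 4 powr \<eta> * 2) ^ d"
  obtain N :: nat where N: "W powr (2 / \<delta>) + 1 < real N" using reals_Archimedean2 by blast
  have "real (vinogradov_J d k A) \<le> real (card A) powr (real d + \<delta>)"
    if ws: "well_spaced A" and cardN: "card A \<ge> N" and diam: "real_diam A \<le> real (card A) powr m" for A
  proof -
    define X where "X = real (card A)"
    have XN: "W powr (2 / \<delta>) + 1 < X" using N cardN unfolding X_def by linarith
    have X1: "X > 1" using XN by (smt (verit) powr_ge_zero)
    have fin: "finite A" using ws unfolding well_spaced_def by simp
    have ne: "A \<noteq> {}" using X1 unfolding X_def by auto
    have XA: "Sup A - Inf A \<le> X powr m" using diam unfolding real_diam_def X_def by linarith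
    have Xm: "X powr m \<ge> 1" using X1 m by (intro ge_one_powr_ge_zero) auto
    \<comment> \<open>The factor 2 makes 2^n exceed the diameter strictly, as the half-open unit
      interval requires.\<close>
    define n where "n = nat \<lceil>log 2 (2 * X powr m)\<rceil>"
    have log0: "log 2 (2 * X powr m) \<ge> 0" using Xm by (subst zero_le_log_cancel_iff) auto
    have n1: "log 2 (2 * X powr m) \<le> real n" and n2: "real n \<le> log 2 (2 * X powr m) + 1"
      unfolding n_def using log0 by linarith+
    have pos: "2 * X powr m > 0" using Xm by linarith
    have "2 * X powr m \<le> 2 powr real n" by (rule iffD1[OF log_le_iff[OF _ pos] n1]) simp
    then have "2 * X powr m \<le> 2 ^ n" by (simp add: powr_realpow)
    then have diam': "Sup A - Inf A < 2 ^ n" using XA Xm by linarith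
    have "2 powr (\<eta> * real n) \<le> 2 powr (\<eta> * (log 2 (2 * X powr m) + 1))"
      using n2 \<eta> by (intro powr_mono mult_left_mono) auto
    also have "\<dots> = (2 powr (log 2 (2 * X powr m) + 1)) powr \<eta>" by (simp add: powr_powr mult.commute)
    also have "2 powr (log 2 (2 * X powr m) + 1) = 4 * X powr m" using pos X1 by (simp add: powr_add)
    also have "(4 * X powr m) powr \<eta> = 4 powr \<eta> * X powr (m * \<eta>)" using X1 by (simp add: powr_mult powr_powr)
    finally have 2: "2 powr (\<eta> * real n) \<le> 4 powr \<eta> * X powr (m * \<eta>)" .
    have "real (vinogradov_J d k A) \<le> (C * 2 powr (\<eta> * real n) * (2 * X)) ^ d"
      unfolding d_def X_def
      by (rule vinogradov_mean_value[OF k dec _ fin ne diam' well_spaced_unit_cell[OF ws ne]]) (use C in auto)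
    also have "\<dots> \<le> (C * (4 powr \<eta> * X powr (m * \<eta>)) * (2 * X)) ^ d"
      using 2 C X1 by (intro power_mono mult_right_mono mult_left_mono) auto
    also have "\<dots> = W * (X powr (m * \<eta>)) ^ d * X ^ d"
      unfolding W_def by (simp add: power_mult_distrib)
    also have "(X powr (m * \<eta>)) ^ d = X powr (\<delta> / 2)"
    proof -
      have "(X powr (m * \<eta>)) ^ d = X powr (real d * (m * \<eta>))"
        using X1 by (simp add: powr_powr mult_ac flip: powr_realpow)
      also have "real d * (m * \<eta>) = \<delta> / 2" unfolding \<eta>_def using m d by simp
      finally show ?thesis .
    qed
    also have "X ^ d = X powr real d" using X1 by (simp add: powr_realpow)
    also have "W * X powr (\<delta> / 2) * X powr real d \<le> X powr (\<delta> / 2) * X powr (\<delta> / 2) * X powr real d"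
    proof (intro mult_right_mono)
      have "W > 0" unfolding W_def using C by simp
      then have "W = (W powr (2 / \<delta>)) powr (\<delta> / 2)" using \<delta> by (simp add: powr_powr)
      also have "\<dots> \<le> X powr (\<delta> / 2)" using XN \<delta> by (intro powr_mono2) auto
      finally show "W \<le> X powr (\<delta> / 2)" .
    qed auto
    also have "\<dots> = X powr (real d + \<delta>)" by (simp add: powr_add[symmetric] add.commute)
    finally show ?thesis unfolding X_def .
  qed
  then show ?thesis unfolding d_def by blast
qed

section \<open>Sumsets and energies\<close>

definition sumset :: "'a::ab_group_add set \<Rightarrow> 'a set \<Rightarrow> 'a set" where
  "sumset A B = (\<lambda>(a, b). a + b) ` (A \<times> B)"

lemma finite_sumset: "finite A \<Longrightarrow> finite B \<Longrightarrow> finite (sumset A B)"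
  unfolding sumset_def by auto

lemma sumsetI: "a \<in> A \<Longrightarrow> b \<in> B \<Longrightarrow> a + b \<in> sumset A B"
  unfolding sumset_def by force

lemma sumsetE:
  assumes "v \<in> sumset A B"
  obtains a b where "a \<in> A" "b \<in> B" "v = a + b"
  using assms unfolding sumset_def by auto

lemma sumset_mono: "A \<subseteq> A' \<Longrightarrow> sumset A B \<subseteq> sumset A' B"
  unfolding sumset_def by auto

text \<open>Petridis' argument: the nonempty subset of \<open>A\<close> with the least expansion works.\<close>

lemma petridis:
  fixes A B :: "'a::ab_group_add set"
  assumes fin: "finite A" "finite B" and ne: "A \<noteq> {}"
    and K: "real (card (sumset A B)) \<le> K * real (card A)"
  obtains X where "X \<subseteq> A" "X \<noteq> {}"
    "\<And>C. finite C \<Longrightarrow> real (card (sumset X (sumset B C))) \<le> K * real (card (sumset X C))"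
proof -
  define f where "f Y = real (card (sumset Y B)) / real (card Y)" for Y :: "'a set"
  define S where "S = {Y. Y \<subseteq> A \<and> Y \<noteq> {}}"
  have "finite S" "S \<noteq> {}" unfolding S_def using fin ne by auto
  from arg_min_if_finite[OF this, of f] obtain X where X: "X \<in> S" "\<And>Y. Y \<in> S \<Longrightarrow> f X \<le> f Y"
    by (meson not_le)
  define K0 where "K0 = f X"
  have XA: "X \<subseteq> A" "X \<noteq> {}" using X unfolding S_def by auto
  have finX: "finite X" using XA fin finite_subset by blast
  have cX: "real (card X) > 0" using XA finX by (simp add: card_gt_0_iff)
  have K0: "K0 \<ge> 0" unfolding K0_def f_def by simp
  have K0K: "K0 \<le> K"
  proof -
    have "A \<in> S" unfolding S_def using ne by auto
    then have "K0 \<le> f A" unfolding K0_def by (rule X(2))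
    also have "\<dots> \<le> K" unfolding f_def using K ne fin by (simp add: divide_le_eq card_gt_0_iff)
    finally show ?thesis .
  qed
  have XB: "real (card (sumset X B)) = K0 * real (card X)"
    unfolding K0_def f_def using cX by simp
  have YB: "real (card (sumset Y B)) \<ge> K0 * real (card Y)" if "Y \<subseteq> X" for Y
  proof (cases "Y = {}")
    case False
    then have "Y \<in> S" unfolding S_def using that XA by auto
    then have "K0 \<le> f Y" unfolding K0_def by (rule X(2))
    moreover have "real (card Y) > 0" using False that finX finite_subset by (auto simp: card_gt_0_iff)
    ultimately show ?thesis unfolding f_def by (simp add: le_divide_eq)
  qed simp
  have main: "real (card (sumset X (sumset B C))) \<le> K0 * real (card (sumset X C))" if "finite C" for C
    using that
  proof (induction C rule: finite_induct)
    case empty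
    then show ?case by (simp add: sumset_def)
  next
    case (insert c C)
    define U where "U = sumset X (sumset B C)"
    \<comment> \<open>For x in \<open>Y\<close> the translate x + B + c is already in
      \<open>U\<close>, so new points arise only from X + B without Y + B, and minimality bounds |Y
      + B| below by K0 |Y|. The set \<open>Z\<close> of those x for which x + c is already in X + C
      lies in \<open>Y\<close>, so the count of new points matches the growth of X + C.\<close>
    define Y where "Y = {x \<in> X. \<forall>b\<in>B. x + (b + c) \<in> U}"
    define Z where "Z = {x \<in> X. x + c \<in> sumset X C}"
    have finU: "finite U" unfolding U_def by (intro finite_sumset finX fin insert)
    have YX: "Y \<subseteq> X" unfolding Y_def by auto
    have ZY: "Z \<subseteq> Y"
    proof
      fix x assume x: "x \<in> Z"
      then have xX: "x \<in> X" and xc: "x + c \<in> sumset X C" unfolding Z_def by auto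
      from xc obtain x' c' where x': "x' \<in> X" "c' \<in> C" "x + c = x' + c'" by (rule sumsetE)
      have "x + (b + c) \<in> U" if "b \<in> B" for b
      proof -
        have "x + (b + c) = x' + (b + c')" using x'(3) by (metis add.left_commute)
        moreover have "x' + (b + c') \<in> U" unfolding U_def using x' that by (intro sumsetI)
        ultimately show ?thesis by (simp only:)
      qed
      then show "x \<in> Y" unfolding Y_def using xX by auto
    qed
    have sub: "sumset X (sumset B (insert c C)) \<subseteq> U \<union> (\<lambda>v. v + c) ` (sumset X B - sumset Y B)"
    proof
      fix v assume "v \<in> sumset X (sumset B (insert c C))"
      then obtain x w where x: "x \<in> X" "w \<in> sumset B (insert c C)" "v = x + w" by (rule sumsetE)
      from x(2) obtain b c' where b: "b \<in> B" "c' \<in> insert c C" "w = b + c'" by (rule sumsetE)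
      show "v \<in> U \<union> (\<lambda>v. v + c) ` (sumset X B - sumset Y B)"
      proof (cases "v \<in> U")
        case False
        have "c' \<notin> C"
        proof
          assume "c' \<in> C"
          then have "x + (b + c') \<in> U" unfolding U_def using x b by (intro sumsetI)
          then show False using False x b by simp
        qed
        then have "c' = c" using b by simp
        then have v: "v = (x + b) + c" using x b by (simp add: add.assoc)
        have "x + b \<notin> sumset Y B"
        proof
          assume "x + b \<in> sumset Y B"
          then obtain y b' where y: "y \<in> Y" "b' \<in> B" "x + b = y + b'" by (rule sumsetE)
          then have "v = y + (b' + c)" using v by (simp add: add.assoc)
          then show False using y False unfolding Y_def by auto
        qed
        then have "x + b \<in> sumset X B - sumset Y B" using x b by (simp add: sumsetI)
        then show ?thesis unfolding v by (intro UnI2 imageI)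
      qed simp
    qed
    have "card (sumset X (sumset B (insert c C))) \<le> card (U \<union> (\<lambda>v. v + c) ` (sumset X B - sumset Y B))"
      using sub finU finite_sumset[OF finX fin(2)] by (intro card_mono) auto
    also have "\<dots> \<le> card U + card ((\<lambda>v. v + c) ` (sumset X B - sumset Y B))" by (rule card_Un_le)
    also have "card ((\<lambda>v. v + c) ` (sumset X B - sumset Y B)) \<le> card (sumset X B - sumset Y B)"
      by (rule card_image_le) (use finite_sumset[OF finX fin(2)] in auto)
    finally have "card (sumset X (sumset B (insert c C))) \<le> card U + card (sumset X B - sumset Y B)" by simp
    moreover have "card (sumset X B - sumset Y B) + card (sumset Y B) = card (sumset X B)"
      using card_Diff_subset[OF finite_subset[OF sumset_mono[OF YX] finite_sumset[OF finX fin(2)]] sumset_mono[OF YX]]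
        card_mono[OF finite_sumset[OF finX fin(2)] sumset_mono[OF YX]] by simp
    ultimately have "real (card (sumset X (sumset B (insert c C))))
        \<le> real (card U) + real (card (sumset X B)) - real (card (sumset Y B))" by linarith
    also have "\<dots> \<le> K0 * real (card (sumset X C)) + K0 * real (card X) - K0 * real (card Z)"
    proof -
      have "K0 * real (card Z) \<le> K0 * real (card Y)"
        using ZY K0 YX finX by (intro mult_left_mono) (auto intro!: card_mono finite_subset[OF YX])
      then show ?thesis using insert.IH YB[OF YX] XB unfolding U_def by linarith
    qed
    also have "\<dots> = K0 * (real (card (sumset X C)) + real (card X) - real (card Z))"
      by (simp add: algebra_simps)
    also have "real (card (sumset X C)) + real (card X) - real (card Z) \<le> real (card (sumset X (insert c C)))"
    proof -
      have dj: "sumset X C \<inter> (\<lambda>x. x + c) ` (X - Z) = {}" unfolding Z_def by auto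
      have "card (sumset X C) + card ((\<lambda>x. x + c) ` (X - Z)) = card (sumset X C \<union> (\<lambda>x. x + c) ` (X - Z))"
        using finite_sumset[OF finX insert(1)] finX dj by (intro card_Un_disjoint[symmetric]) auto
      also have "\<dots> \<le> card (sumset X (insert c C))"
        using finX insert(1) by (intro card_mono finite_sumset) (auto simp: sumset_def)
      finally have 1: "card (sumset X C) + card ((\<lambda>x. x + c) ` (X - Z)) \<le> card (sumset X (insert c C))" .
      have "card ((\<lambda>x. x + c) ` (X - Z)) = card (X - Z)" by (intro card_image) auto
      moreover have "card (X - Z) + card Z = card X"
        using ZY YX finX card_mono[of X Z] by (subst card_Diff_subset) (auto intro: finite_subset)
      ultimately show ?thesis using 1 by linarith
    qed
    finally show ?case using K0 by (simp add: mult_left_mono)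
  qed
  show thesis
  proof (rule that[OF XA])
    fix C :: "'a set" assume "finite C"
    then have "real (card (sumset X (sumset B C))) \<le> K0 * real (card (sumset X C))" by (rule main)
    also have "\<dots> \<le> K * real (card (sumset X C))" using K0K by (intro mult_right_mono) auto
    finally show "real (card (sumset X (sumset B C))) \<le> K * real (card (sumset X C))" .
  qed
qed

lemma fold_sumset_0: "fold_sumset 0 B = {0}"
  unfolding fold_sumset_def by auto

lemma fold_sumset_Suc: "fold_sumset (Suc l) B = sumset B (fold_sumset l B)" for B :: "'a::ab_group_add set"
proof (intro equalityI subsetI)
  fix v assume "v \<in> fold_sumset (Suc l) B"
  then obtain b where b: "v = (\<Sum>i=1..Suc l. b i)" "\<forall>i\<in>{1..Suc l}. b i \<in> B"
    unfolding fold_sumset_def by blast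
  have "v = b (Suc l) + (\<Sum>i=1..l. b i)" using b by (simp add: add.commute)
  moreover have "(\<Sum>i=1..l. b i) \<in> fold_sumset l B" unfolding fold_sumset_def using b by auto
  moreover have "b (Suc l) \<in> B" using b by auto
  ultimately show "v \<in> sumset B (fold_sumset l B)" by (simp only: sumsetI)
next
  fix v assume "v \<in> sumset B (fold_sumset l B)"
  then obtain b0 w where b0: "b0 \<in> B" "w \<in> fold_sumset l B" "v = b0 + w" by (rule sumsetE)
  then obtain b where b: "w = (\<Sum>i=1..l. b i)" "\<forall>i\<in>{1..l}. b i \<in> B"
    unfolding fold_sumset_def by blast
  have "(\<Sum>i=1..Suc l. (b(Suc l := b0)) i) = (\<Sum>i=1..l. b i) + b0" by simp
  then have "v = (\<Sum>i=1..Suc l. (b(Suc l := b0)) i)" using b b0 by (simp add: add.commute)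
  moreover have "\<forall>i\<in>{1..Suc l}. (b(Suc l := b0)) i \<in> B" using b b0 by auto
  ultimately show "v \<in> fold_sumset (Suc l) B" unfolding fold_sumset_def by blast
qed

lemma finite_fold_sumset: "finite B \<Longrightarrow> finite (fold_sumset l B)" for B :: "'a::ab_group_add set"
  by (induction l) (auto simp: fold_sumset_0 fold_sumset_Suc finite_sumset)

text \<open>Petridis' subset X grows by at most the factor K with every further summand B, and X
  plus the iterated sumset contains a translate of the latter.\<close>

lemma card_fold_sumset_le:
  fixes A B :: "'a::ab_group_add set"
  assumes fin: "finite A" "finite B" and ne: "A \<noteq> {}"
    and K: "real (card (sumset A B)) \<le> K * real (card A)" "K \<ge> 0"
  shows "real (card (fold_sumset l B)) \<le> K ^ l * real (card A)"
proof -
  obtain X where X: "X \<subseteq> A" "X \<noteq> {}"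
    "\<And>C. finite C \<Longrightarrow> real (card (sumset X (sumset B C))) \<le> K * real (card (sumset X C))"
    using petridis[OF fin ne K(1)] by blast
  have finX: "finite X" using X fin finite_subset by blast
  have X0: "sumset X {0} = X" unfolding sumset_def by force
  have it: "real (card (sumset X (fold_sumset l B))) \<le> K ^ l * real (card X)"
  proof (induction l)
    case 0
    then show ?case by (simp add: fold_sumset_0 X0)
  next
    case (Suc l)
    have "real (card (sumset X (fold_sumset (Suc l) B))) \<le> K * real (card (sumset X (fold_sumset l B)))"
      unfolding fold_sumset_Suc by (rule X(3)[OF finite_fold_sumset[OF fin(2)]])
    also have "\<dots> \<le> K * (K ^ l * real (card X))" using Suc K by (intro mult_left_mono)
    finally show ?case by simp
  qed
  obtain x where x: "x \<in> X" using X by auto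
  have "card (fold_sumset l B) = card ((\<lambda>v. x + v) ` fold_sumset l B)"
    by (intro card_image[symmetric]) auto
  also have "\<dots> \<le> card (sumset X (fold_sumset l B))"
    using x finX finite_fold_sumset[OF fin(2)] by (intro card_mono finite_sumset) (auto intro: sumsetI)
  finally have "real (card (fold_sumset l B)) \<le> real (card (sumset X (fold_sumset l B)))" by simp
  also have "\<dots> \<le> K ^ l * real (card X)" by (rule it)
  also have "\<dots> \<le> K ^ l * real (card A)" using K X fin by (intro mult_left_mono) (auto intro: card_mono)
  finally show ?thesis .
qed

section \<open>Counting in dense bipartite graphs\<close>

lemma card_eq_sum_fibres:
  assumes "finite S" "finite V" "f ` S \<subseteq> V"
  shows "card S = (\<Sum>v\<in>V. card {z \<in> S. f z = v})"
  unfolding card_eq_sum using sum.group[OF assms, of "\<lambda>_. 1::nat"] by (rule sym)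

lemma card_pairs_eq_sum:
  assumes "finite A" "finite B" "G \<subseteq> A \<times> B"
  shows "card G = (\<Sum>a\<in>A. card {b \<in> B. (a, b) \<in> G})"
    and "card G = (\<Sum>b\<in>B. card {a \<in> A. (a, b) \<in> G})"
proof -
  have fG: "finite G" using assms finite_subset by blast
  have "card G = (\<Sum>a\<in>A. card {z \<in> G. fst z = a})"
    using assms fG by (intro card_eq_sum_fibres) auto
  also have "\<dots> = (\<Sum>a\<in>A. card {b \<in> B. (a, b) \<in> G})"
  proof (intro sum.cong refl)
    fix a
    have "{z \<in> G. fst z = a} = Pair a ` {b \<in> B. (a, b) \<in> G}" using assms(3) by force
    then show "card {z \<in> G. fst z = a} = card {b \<in> B. (a, b) \<in> G}" by (simp add: card_image inj_on_def)
  qed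
  finally show "card G = (\<Sum>a\<in>A. card {b \<in> B. (a, b) \<in> G})" .
  have "card G = (\<Sum>b\<in>B. card {z \<in> G. snd z = b})"
    using assms fG by (intro card_eq_sum_fibres) auto
  also have "\<dots> = (\<Sum>b\<in>B. card {a \<in> A. (a, b) \<in> G})"
  proof (intro sum.cong refl)
    fix b
    have "{z \<in> G. snd z = b} = (\<lambda>a. (a, b)) ` {a \<in> A. (a, b) \<in> G}" using assms(3) by force
    then show "card {z \<in> G. snd z = b} = card {a \<in> A. (a, b) \<in> G}" by (simp add: card_image inj_on_def)
  qed
  finally show "card G = (\<Sum>b\<in>B. card {a \<in> A. (a, b) \<in> G})" .
qed

text \<open>Dependent random choice: the neighbourhood of a suitable \<open>b \<in> B\<close> has few pairs of small
  codegree.\<close>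

lemma paths_of_length_two:
  fixes \<kappa> \<epsilon> :: real
  assumes fin: "finite A" "finite B" and G: "G \<subseteq> A \<times> B" and ne: "B \<noteq> {}"
    and \<kappa>: "\<kappa> > 0" and \<epsilon>: "\<epsilon> > 0" and dense: "real (card A) * real (card B) \<le> \<kappa> * real (card G)"
  obtains A2 where "A2 \<subseteq> A" "real (card A) ^ 2 \<le> 2 * \<kappa> ^ 2 * real (card A2) ^ 2"
    "real (card {(a, a') \<in> A2 \<times> A2. 2 * \<kappa> ^ 2 * real (card {b \<in> B. (a, b) \<in> G \<and> (a', b) \<in> G}) < \<epsilon> * real (card B)})
      \<le> \<epsilon> * real (card A2) ^ 2"
proof -
  define N where "N b = {a \<in> A. (a, b) \<in> G}" for b
  define cod where "cod a a' = card {b \<in> B. (a, b) \<in> G \<and> (a', b) \<in> G}" for a a'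
  define bad where "bad = {(a, a') \<in> A \<times> A. 2 * \<kappa> ^ 2 * real (cod a a') < \<epsilon> * real (card B)}"
  have finbad: "finite bad" unfolding bad_def by (rule finite_subset[of _ "A \<times> A"]) (use fin in auto)
  have cB: "real (card B) > 0" using fin ne by (simp add: card_gt_0_iff)
  have sumN: "real (card G) = (\<Sum>b\<in>B. real (card (N b)))"
    using card_pairs_eq_sum(2)[OF fin G] unfolding N_def by simp
  have sq: "real (card G) ^ 2 \<le> real (card B) * (\<Sum>b\<in>B. real (card (N b)) ^ 2)"
    using Cauchy_Schwarz_ineq_sum[of "\<lambda>_. 1" "\<lambda>b. real (card (N b))" B] unfolding sumN by simp
  define badN where "badN b = {z \<in> bad. z \<in> N b \<times> N b}" for b
  have sumbad: "(\<Sum>b\<in>B. real (card (badN b))) = (\<Sum>(a, a')\<in>bad. real (cod a a'))"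
  proof -
    define H where "H = {(z, b) \<in> bad \<times> B. z \<in> N b \<times> N b}"
    have HS: "H \<subseteq> bad \<times> B" unfolding H_def by auto
    have "(\<Sum>b\<in>B. card (badN b)) = card H"
      unfolding card_pairs_eq_sum(2)[OF finbad fin(2) HS] badN_def
      by (intro sum.cong refl arg_cong[of _ _ card]) (auto simp: H_def)
    also have "\<dots> = (\<Sum>z\<in>bad. cod (fst z) (snd z))"
      unfolding card_pairs_eq_sum(1)[OF finbad fin(2) HS] cod_def
      by (intro sum.cong refl arg_cong[of _ _ card]) (auto simp: H_def N_def bad_def)
    finally have "real (\<Sum>b\<in>B. card (badN b)) = real (\<Sum>z\<in>bad. cod (fst z) (snd z))" by simp
    then show ?thesis by (simp add: split_def)
  qed
  have "(\<Sum>(a, a')\<in>bad. real (cod a a')) \<le> (\<Sum>z\<in>bad. \<epsilon> * real (card B) / (2 * \<kappa> ^ 2))"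
    using \<kappa> by (intro sum_mono) (auto simp: bad_def le_divide_eq mult.commute)
  also have "\<dots> \<le> real (card A) ^ 2 * (\<epsilon> * real (card B) / (2 * \<kappa> ^ 2))"
  proof -
    have "card bad \<le> card (A \<times> A)" unfolding bad_def using fin by (intro card_mono) auto
    then have "real (card bad) \<le> real (card A) ^ 2"
      by (simp only: card_cartesian_product power2_eq_square of_nat_mult[symmetric] of_nat_le_iff)
    then have "real (card bad) * (\<epsilon> * real (card B) / (2 * \<kappa> ^ 2)) \<le> real (card A) ^ 2 * (\<epsilon> * real (card B) / (2 * \<kappa> ^ 2))"
      using \<epsilon> by (intro mult_right_mono) auto
    then show ?thesis by simp
  qed
  finally have badle: "(\<Sum>b\<in>B. real (card (badN b))) \<le> real (card A) ^ 2 * (\<epsilon> * real (card B) / (2 * \<kappa> ^ 2))"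
    unfolding sumbad .
  have "real (card A) ^ 2 * real (card B) / \<kappa> ^ 2 \<le> (\<Sum>b\<in>B. real (card (N b)) ^ 2)"
  proof -
    have "(real (card A) * real (card B)) ^ 2 \<le> (\<kappa> * real (card G)) ^ 2"
      using dense by (intro power_mono) auto
    also have "\<dots> \<le> \<kappa> ^ 2 * (real (card B) * (\<Sum>b\<in>B. real (card (N b)) ^ 2))"
      unfolding power_mult_distrib using sq by (intro mult_left_mono) auto
    finally have "real (card B) * (real (card A) ^ 2 * real (card B)) \<le> real (card B) * ((\<Sum>b\<in>B. real (card (N b)) ^ 2) * \<kappa> ^ 2)"
      by (simp add: power_mult_distrib power2_eq_square mult_ac)
    then have "real (card A) ^ 2 * real (card B) \<le> (\<Sum>b\<in>B. real (card (N b)) ^ 2) * \<kappa> ^ 2"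
      using cB by (simp only: mult_le_cancel_left_pos)
    then show ?thesis using \<kappa> by (simp add: divide_le_eq)
  qed
  moreover have "(\<Sum>b\<in>B. real (card (badN b))) / \<epsilon> \<le> real (card A) ^ 2 * real (card B) / (2 * \<kappa> ^ 2)"
  proof -
    have "(\<Sum>b\<in>B. real (card (badN b))) / \<epsilon> \<le> real (card A) ^ 2 * (\<epsilon> * real (card B) / (2 * \<kappa> ^ 2)) / \<epsilon>"
      using badle \<epsilon> by (intro divide_right_mono) auto
    then show ?thesis using \<epsilon> by simp
  qed
  moreover have "real (card A) ^ 2 * real (card B) / \<kappa> ^ 2 = 2 * (real (card A) ^ 2 * real (card B) / (2 * \<kappa> ^ 2))"
    by simp
  ultimately have "real (card A) ^ 2 * real (card B) / (2 * \<kappa> ^ 2)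
      \<le> (\<Sum>b\<in>B. real (card (N b)) ^ 2) - (\<Sum>b\<in>B. real (card (badN b))) / \<epsilon>" by linarith
  also have "\<dots> = (\<Sum>b\<in>B. real (card (N b)) ^ 2 - real (card (badN b)) / \<epsilon>)"
    by (simp add: sum_subtractf sum_divide_distrib)
  finally have tot: "(\<Sum>b\<in>B. real (card A) ^ 2 / (2 * \<kappa> ^ 2)) \<le> (\<Sum>b\<in>B. real (card (N b)) ^ 2 - real (card (badN b)) / \<epsilon>)"
    by (simp add: mult.commute)
  \<comment> \<open>Averaging the single quantity |N b|^2 - |badN b| / \<epsilon> gives one b that
    serves both purposes: its neighbourhood is large and the proportion of bad pairs in it is at
    most \<epsilon>.\<close>
  have "\<exists>b\<in>B. real (card A) ^ 2 / (2 * \<kappa> ^ 2) \<le> real (card (N b)) ^ 2 - real (card (badN b)) / \<epsilon>"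
  proof (rule ccontr)
    assume "\<not> ?thesis"
    then have "(\<Sum>b\<in>B. real (card (N b)) ^ 2 - real (card (badN b)) / \<epsilon>) < (\<Sum>b\<in>B. real (card A) ^ 2 / (2 * \<kappa> ^ 2))"
      using fin ne by (intro sum_strict_mono) (auto simp: not_le)
    then show False using tot by linarith
  qed
  then obtain b where b: "b \<in> B" "real (card A) ^ 2 / (2 * \<kappa> ^ 2) \<le> real (card (N b)) ^ 2 - real (card (badN b)) / \<epsilon>" by blast
  show thesis
  proof (rule that[of "N b"])
    show "N b \<subseteq> A" unfolding N_def by auto
    have "0 \<le> real (card (badN b)) / \<epsilon>" using \<epsilon> by simp
    then have "real (card A) ^ 2 / (2 * \<kappa> ^ 2) \<le> real (card (N b)) ^ 2" using b by linarith
    then show "real (card A) ^ 2 \<le> 2 * \<kappa> ^ 2 * real (card (N b)) ^ 2"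
      using \<kappa> by (simp add: pos_divide_le_eq mult.commute)
    have "0 \<le> real (card A) ^ 2 / (2 * \<kappa> ^ 2)" by simp
    then have "real (card (badN b)) / \<epsilon> \<le> real (card (N b)) ^ 2" using b by linarith
    then have "real (card (badN b)) \<le> \<epsilon> * real (card (N b)) ^ 2"
      using \<epsilon> by (simp add: pos_divide_le_eq mult.commute)
    moreover have "{(a, a') \<in> N b \<times> N b. 2 * \<kappa> ^ 2 * real (card {b \<in> B. (a, b) \<in> G \<and> (a', b) \<in> G}) < \<epsilon> * real (card B)} = badN b"
      unfolding badN_def bad_def cod_def N_def by auto
    ultimately show "real (card {(a, a') \<in> N b \<times> N b. 2 * \<kappa> ^ 2 * real (card {b \<in> B. (a, b) \<in> G \<and> (a', b) \<in> G}) < \<epsilon> * real (card B)})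
      \<le> \<epsilon> * real (card (N b)) ^ 2" by simp
  qed
qed

text \<open>Dependent random choice among the vertices of large degree gives \<open>A2\<close> with
  few pairs of small codegree. \<open>A'\<close> keeps the vertices in few such pairs,
  \<open>B'\<close> those with many neighbours in \<open>A2\<close>. For a in \<open>A'\<close> and
  b in \<open>B'\<close>, many neighbours a1 of b are then good partners of a, and each of them
  shares many neighbours b1 with a. The constant 6400 is 80 * 80.\<close>

lemma paths_of_length_three:
  fixes \<kappa> :: real
  assumes fin: "finite P" and ne: "P \<noteq> {}" and G: "G \<subseteq> P \<times> P" and \<kappa>: "\<kappa> \<ge> 1"
    and dense: "real (card P) ^ 2 \<le> \<kappa> * real (card G)"
  obtains A' B' where "A' \<subseteq> P" "B' \<subseteq> P" "real (card P) \<le> 8 * \<kappa> * real (card A')"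
    "real (card P) \<le> 4 * \<kappa> * real (card B')"
    "\<And>a b. a \<in> A' \<Longrightarrow> b \<in> B' \<Longrightarrow> real (card P) ^ 2
       \<le> 6400 * \<kappa> ^ 5 * real (card {(b1, a1) \<in> P \<times> P. (a, b1) \<in> G \<and> (a1, b1) \<in> G \<and> (a1, b) \<in> G})"
proof -
  define n where "n = real (card P)"
  have n: "n > 0" unfolding n_def using fin ne by (simp add: card_gt_0_iff)
  have \<kappa>0: "\<kappa> > 0" using \<kappa> by simp
  define deg where "deg a = card {b \<in> P. (a, b) \<in> G}" for a
  define A1 where "A1 = {a \<in> P. n \<le> 2 * \<kappa> * real (deg a)}"
  have finA1: "finite A1" "A1 \<subseteq> P" unfolding A1_def using fin by auto
  define G1 where "G1 = G \<inter> (A1 \<times> P)"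
  have G1: "n ^ 2 \<le> 2 * \<kappa> * real (card G1)"
  proof -
    have "real (card G) = (\<Sum>a\<in>P. real (deg a))"
      using card_pairs_eq_sum(1)[OF fin fin G] unfolding deg_def by simp
    also have "\<dots> = (\<Sum>a\<in>A1. real (deg a)) + (\<Sum>a\<in>P - A1. real (deg a))"
      using sum.subset_diff[OF finA1(2) fin] by (simp add: add.commute)
    also have "(\<Sum>a\<in>A1. real (deg a)) = real (card G1)"
    proof -
      have "card G1 = (\<Sum>a\<in>A1. card {b \<in> P. (a, b) \<in> G1})"
        by (rule card_pairs_eq_sum(1)[OF finA1(1) fin]) (auto simp: G1_def)
      also have "\<dots> = (\<Sum>a\<in>A1. deg a)" unfolding deg_def
        by (intro sum.cong refl arg_cong[of _ _ card]) (auto simp: G1_def)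
      finally show ?thesis by simp
    qed
    also have "(\<Sum>a\<in>P - A1. real (deg a)) \<le> (\<Sum>a\<in>P - A1. n / (2 * \<kappa>))"
      using \<kappa>0 by (intro sum_mono) (auto simp: A1_def le_divide_eq mult.commute not_le)
    also have "\<dots> \<le> (\<Sum>a\<in>P. n / (2 * \<kappa>))"
      using \<kappa>0 n fin by (intro sum_mono2) auto
    also have "\<dots> = n * (n / (2 * \<kappa>))" unfolding n_def by simp
    finally have "real (card G) \<le> real (card G1) + n * (n / (2 * \<kappa>))" by simp
    then have "\<kappa> * real (card G) \<le> \<kappa> * (real (card G1) + n * (n / (2 * \<kappa>)))"
      using \<kappa>0 by (intro mult_left_mono) auto
    also have "\<dots> = \<kappa> * real (card G1) + n ^ 2 / 2" using \<kappa>0 by (simp add: distrib_left power2_eq_square)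
    finally show ?thesis using dense unfolding n_def[symmetric] by simp
  qed
  have "card G1 \<le> card (A1 \<times> P)" unfolding G1_def using finA1 fin by (intro card_mono) auto
  then have "real (card G1) \<le> real (card A1) * n"
    unfolding n_def by (simp only: card_cartesian_product of_nat_mult[symmetric] of_nat_le_iff)
  then have "2 * \<kappa> * real (card G1) \<le> 2 * \<kappa> * (real (card A1) * n)" using \<kappa>0 by (intro mult_left_mono) auto
  then have "n * n \<le> (2 * \<kappa> * real (card A1)) * n" using G1 by (simp add: power2_eq_square mult_ac)
  then have A1n: "n \<le> 2 * \<kappa> * real (card A1)" using n by (simp only: mult_le_cancel_right_pos)
  then have "0 < 2 * \<kappa> * real (card A1)" using n by linarith
  then have cA1: "real (card A1) > 0" using \<kappa>0 by (simp add: zero_less_mult_iff)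
  \<comment> \<open>The density constant of the graph on \<open>A1\<close>, taken as an exact ratio
    so that |A1| cancels in the lower bound for |A2|.\<close>
  define \<kappa>1 where "\<kappa>1 = 2 * \<kappa> * real (card A1) / n"
  have \<kappa>1: "\<kappa>1 > 0" unfolding \<kappa>1_def using \<kappa>0 n cA1 by simp
  have \<kappa>1n: "\<kappa>1 * n = 2 * \<kappa> * real (card A1)" unfolding \<kappa>1_def using n by simp
  have \<kappa>1le: "\<kappa>1 \<le> 2 * \<kappa>"
  proof -
    have "real (card A1) \<le> n" unfolding n_def using finA1 fin by (auto intro: card_mono)
    then have "2 * \<kappa> * real (card A1) \<le> 2 * \<kappa> * n" using \<kappa>0 by (intro mult_left_mono) auto
    then show ?thesis unfolding \<kappa>1_def using n by (simp add: divide_le_eq)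
  qed
  \<comment> \<open>A vertex of \<open>A'\<close> has at most 2 \<epsilon> m = m / (5 \<kappa>) bad
    partners, fewer than the m / (4 \<kappa>) neighbours that a vertex of \<open>B'\<close> has in
    \<open>A2\<close>; the difference m / (20 \<kappa>) survives.\<close>
  define \<epsilon> where "\<epsilon> = 1 / (10 * \<kappa>)"
  have \<epsilon>: "\<epsilon> > 0" unfolding \<epsilon>_def using \<kappa>0 by simp
  have dense1: "real (card A1) * real (card P) \<le> \<kappa>1 * real (card G1)"
  proof -
    have "(real (card A1) * n) * n \<le> real (card A1) * (2 * \<kappa> * real (card G1))"
      using G1 cA1 by (simp add: power2_eq_square mult.assoc mult_left_mono)
    also have "\<dots> = (\<kappa>1 * real (card G1)) * n" using \<kappa>1n by (simp add: mult_ac)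
    finally show ?thesis using n unfolding n_def[symmetric] by (simp only: mult_le_cancel_right_pos)
  qed
  have G1s: "G1 \<subseteq> A1 \<times> P" unfolding G1_def by auto
  obtain A2 where A2: "A2 \<subseteq> A1" "real (card A1) ^ 2 \<le> 2 * \<kappa>1 ^ 2 * real (card A2) ^ 2"
    "real (card {(a, a') \<in> A2 \<times> A2. 2 * \<kappa>1 ^ 2 * real (card {b \<in> P. (a, b) \<in> G1 \<and> (a', b) \<in> G1}) < \<epsilon> * real (card P)})
      \<le> \<epsilon> * real (card A2) ^ 2"
    by (rule paths_of_length_two[OF finA1(1) fin G1s ne \<kappa>1 \<epsilon> dense1])
  define m where "m = real (card A2)"
  have finA2: "finite A2" "A2 \<subseteq> P" using A2 finA1 finite_subset by blast+
  define bad where "bad = {(a, a') \<in> A2 \<times> A2. 2 * \<kappa>1 ^ 2 * real (card {b \<in> P. (a, b) \<in> G1 \<and> (a', b) \<in> G1}) < \<epsilon> * n}"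
  have badm: "real (card bad) \<le> \<epsilon> * m ^ 2" using A2(3) unfolding bad_def m_def n_def .
  have mn: "n \<le> 4 * \<kappa> * m"
  proof -
    have "n ^ 2 * real (card A1) ^ 2 \<le> n ^ 2 * (2 * \<kappa>1 ^ 2 * m ^ 2)"
      using A2(2) unfolding m_def by (intro mult_left_mono) auto
    also have "\<dots> = 2 * (\<kappa>1 * n) ^ 2 * m ^ 2" by (simp add: power_mult_distrib)
    also have "\<dots> = real (card A1) ^ 2 * (8 * \<kappa> ^ 2 * m ^ 2)" unfolding \<kappa>1n by (simp add: power_mult_distrib)
    finally have "n ^ 2 * real (card A1) ^ 2 \<le> (8 * \<kappa> ^ 2 * m ^ 2) * real (card A1) ^ 2" by (simp add: mult.commute)
    then have "n ^ 2 \<le> 8 * \<kappa> ^ 2 * m ^ 2" using cA1 by (simp only: mult_le_cancel_right_pos zero_less_power)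
    also have "\<dots> \<le> (4 * \<kappa> * m) ^ 2" by (simp add: power_mult_distrib)
    finally show ?thesis by (rule power2_le_imp_le) (use \<kappa>0 in \<open>simp add: m_def\<close>)
  qed
  have m: "m > 0"
  proof -
    have "0 < 4 * \<kappa> * m" using mn n by linarith
    then show ?thesis using \<kappa>0 by (simp add: zero_less_mult_iff)
  qed
  define A' where "A' = {a \<in> A2. real (card {a' \<in> A2. (a, a') \<in> bad}) \<le> 2 * \<epsilon> * m}"
  have A'm: "m \<le> 2 * real (card A')"
  proof -
    have badA2: "bad \<subseteq> A2 \<times> A2" unfolding bad_def by auto
    have "(\<Sum>a\<in>A2 - A'. 2 * \<epsilon> * m) \<le> (\<Sum>a\<in>A2 - A'. real (card {a' \<in> A2. (a, a') \<in> bad}))"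
      by (intro sum_mono) (auto simp: A'_def)
    also have "\<dots> \<le> (\<Sum>a\<in>A2. real (card {a' \<in> A2. (a, a') \<in> bad}))"
      using finA2 by (intro sum_mono2) auto
    also have "\<dots> = real (card bad)"
      using card_pairs_eq_sum(1)[OF finA2(1) finA2(1) badA2] by simp
    finally have "(2 * \<epsilon> * m) * real (card (A2 - A')) \<le> \<epsilon> * m ^ 2" using badm by (simp add: mult.commute)
    then have "(\<epsilon> * m) * (2 * real (card (A2 - A'))) \<le> (\<epsilon> * m) * m" by (simp add: power2_eq_square mult_ac)
    then have "2 * real (card (A2 - A')) \<le> m" using \<epsilon> m by (simp only: mult_le_cancel_left_pos mult_pos_pos)
    moreover have "card (A2 - A') + card A' = card A2"
      using finA2 card_mono[of A2 A'] by (subst card_Diff_subset) (auto simp: A'_def intro: finite_subset)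
    ultimately show ?thesis unfolding m_def by linarith
  qed
  define B' where "B' = {b \<in> P. m \<le> 4 * \<kappa> * real (card {a \<in> A2. (a, b) \<in> G})}"
  have B'n: "n \<le> 4 * \<kappa> * real (card B')"
  proof -
    define G2 where "G2 = G \<inter> (A2 \<times> P)"
    have G2s: "G2 \<subseteq> A2 \<times> P" unfolding G2_def by auto
    have "(\<Sum>a\<in>A2. n / (2 * \<kappa>)) \<le> (\<Sum>a\<in>A2. real (card {b \<in> P. (a, b) \<in> G2}))"
    proof (intro sum_mono)
      fix a assume a: "a \<in> A2"
      then have "n \<le> 2 * \<kappa> * real (deg a)" using A2(1) unfolding A1_def by auto
      moreover have "{b \<in> P. (a, b) \<in> G2} = {b \<in> P. (a, b) \<in> G}" unfolding G2_def using a by auto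
      ultimately show "n / (2 * \<kappa>) \<le> real (card {b \<in> P. (a, b) \<in> G2})"
        unfolding deg_def using \<kappa>0 by (simp add: divide_le_eq mult.commute)
    qed
    also have "\<dots> = real (card G2)" using card_pairs_eq_sum(1)[OF finA2(1) fin G2s] by simp
    also have "\<dots> = (\<Sum>b\<in>P. real (card {a \<in> A2. (a, b) \<in> G2}))"
      using card_pairs_eq_sum(2)[OF finA2(1) fin G2s] by simp
    also have "\<dots> = (\<Sum>b\<in>B'. real (card {a \<in> A2. (a, b) \<in> G2})) + (\<Sum>b\<in>P - B'. real (card {a \<in> A2. (a, b) \<in> G2}))"
      using sum.subset_diff[of B' P] fin by (simp add: B'_def add.commute)
    also have "\<dots> \<le> (\<Sum>b\<in>B'. m) + (\<Sum>b\<in>P. m / (4 * \<kappa>))"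
    proof (intro add_mono)
      show "(\<Sum>b\<in>B'. real (card {a \<in> A2. (a, b) \<in> G2})) \<le> (\<Sum>b\<in>B'. m)"
        unfolding m_def using finA2 by (intro sum_mono) (auto intro: card_mono)
      have "(\<Sum>b\<in>P - B'. real (card {a \<in> A2. (a, b) \<in> G2})) \<le> (\<Sum>b\<in>P - B'. m / (4 * \<kappa>))"
      proof (intro sum_mono)
        fix b assume b: "b \<in> P - B'"
        then have "4 * \<kappa> * real (card {a \<in> A2. (a, b) \<in> G}) < m" unfolding B'_def by auto
        moreover have "{a \<in> A2. (a, b) \<in> G2} = {a \<in> A2. (a, b) \<in> G}" unfolding G2_def using b by auto
        ultimately show "real (card {a \<in> A2. (a, b) \<in> G2}) \<le> m / (4 * \<kappa>)"
          using \<kappa>0 by (simp add: le_divide_eq mult.commute)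
      qed
      also have "\<dots> \<le> (\<Sum>b\<in>P. m / (4 * \<kappa>))" using fin m \<kappa>0 by (intro sum_mono2) auto
      finally show "(\<Sum>b\<in>P - B'. real (card {a \<in> A2. (a, b) \<in> G2})) \<le> (\<Sum>b\<in>P. m / (4 * \<kappa>))" .
    qed
    also have "\<dots> = real (card B') * m + n * (m / (4 * \<kappa>))" unfolding n_def by simp
    finally have "m * (n / (2 * \<kappa>)) \<le> real (card B') * m + n * (m / (4 * \<kappa>))" unfolding m_def by simp
    then have "(4 * \<kappa>) * (m * (n / (2 * \<kappa>))) \<le> (4 * \<kappa>) * (real (card B') * m + n * (m / (4 * \<kappa>)))"
      using \<kappa>0 by (intro mult_left_mono) auto
    also have "(4 * \<kappa>) * (m * (n / (2 * \<kappa>))) = 2 * (n * m)" using \<kappa>0 by simp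
    also have "(4 * \<kappa>) * (real (card B') * m + n * (m / (4 * \<kappa>))) = (4 * \<kappa> * real (card B')) * m + n * m"
      using \<kappa>0 by (simp add: distrib_left)
    finally have "n * m \<le> (4 * \<kappa> * real (card B')) * m" by (simp add: mult.commute[of n m])
    then show ?thesis using m by (simp only: mult_le_cancel_right_pos)
  qed
  show thesis
  proof (rule that[of A' B'])
    show "A' \<subseteq> P" "B' \<subseteq> P" unfolding A'_def B'_def using finA2 by auto
    have "4 * \<kappa> * m \<le> 4 * \<kappa> * (2 * real (card A'))" using A'm \<kappa>0 by (intro mult_left_mono) auto
    then show "real (card P) \<le> 8 * \<kappa> * real (card A')" using mn unfolding n_def by simp
    show "real (card P) \<le> 4 * \<kappa> * real (card B')" using B'n unfolding n_def .
    fix a b assume a: "a \<in> A'" and b: "b \<in> B'"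
    define W where "W = {(b1, a1) \<in> P \<times> P. (a, b1) \<in> G \<and> (a1, b1) \<in> G \<and> (a1, b) \<in> G}"
    define T where "T = {a1 \<in> A2. (a1, b) \<in> G \<and> (a, a1) \<notin> bad}"
    have finT: "finite T" "T \<subseteq> P" unfolding T_def using finA2 by auto
    have cT: "m \<le> 20 * \<kappa> * real (card T)"
    proof -
      have "{a1 \<in> A2. (a1, b) \<in> G} \<subseteq> T \<union> {a' \<in> A2. (a, a') \<in> bad}" unfolding T_def by auto
      then have "card {a1 \<in> A2. (a1, b) \<in> G} \<le> card (T \<union> {a' \<in> A2. (a, a') \<in> bad})"
        using finT finA2 by (intro card_mono) auto
      also have "\<dots> \<le> card T + card {a' \<in> A2. (a, a') \<in> bad}" by (rule card_Un_le)
      finally have "real (card {a1 \<in> A2. (a1, b) \<in> G}) \<le> real (card T) + 2 * \<epsilon> * m"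
        using a unfolding A'_def by auto
      then have "4 * \<kappa> * real (card {a1 \<in> A2. (a1, b) \<in> G}) \<le> 4 * \<kappa> * (real (card T) + 2 * \<epsilon> * m)"
        using \<kappa>0 by (intro mult_left_mono) auto
      moreover have "m \<le> 4 * \<kappa> * real (card {a1 \<in> A2. (a1, b) \<in> G})" using b unfolding B'_def by auto
      moreover have "4 * \<kappa> * (real (card T) + 2 * \<epsilon> * m) = 4 * \<kappa> * real (card T) + 4 / 5 * m"
        unfolding \<epsilon>_def using \<kappa>0 by (simp add: distrib_left)
      ultimately show ?thesis by linarith
    qed
    have cod: "n \<le> 80 * \<kappa> ^ 3 * real (card {b1 \<in> P. (b1, a1) \<in> W})" if a1: "a1 \<in> T" for a1
    proof -
      have aA2: "a \<in> A2" using a unfolding A'_def by auto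
      have "(a, a1) \<notin> bad" "a1 \<in> A2" using a1 unfolding T_def by auto
      then have "\<epsilon> * n \<le> 2 * \<kappa>1 ^ 2 * real (card {b \<in> P. (a, b) \<in> G1 \<and> (a1, b) \<in> G1})"
        using aA2 unfolding bad_def by auto
      also have "\<dots> \<le> 2 * (2 * \<kappa>) ^ 2 * real (card {b1 \<in> P. (b1, a1) \<in> W})"
      proof (intro mult_mono power_mono)
        have "{b \<in> P. (a, b) \<in> G1 \<and> (a1, b) \<in> G1} \<subseteq> {b1 \<in> P. (b1, a1) \<in> W}"
          using a1 finT unfolding W_def T_def G1_def by auto
        then show "real (card {b \<in> P. (a, b) \<in> G1 \<and> (a1, b) \<in> G1}) \<le> real (card {b1 \<in> P. (b1, a1) \<in> W})"
          using fin by (simp add: card_mono)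
      qed (use \<kappa>1le \<kappa>1 in auto)
      finally have "(10 * \<kappa>) * (\<epsilon> * n) \<le> (10 * \<kappa>) * (2 * (2 * \<kappa>) ^ 2 * real (card {b1 \<in> P. (b1, a1) \<in> W}))"
        using \<kappa>0 by (intro mult_left_mono) auto
      then show ?thesis unfolding \<epsilon>_def using \<kappa>0 by (simp add: power2_eq_square power3_eq_cube mult_ac)
    qed
    have "n * real (card T) = (\<Sum>a1\<in>T. n)" by simp
    also have "\<dots> \<le> (\<Sum>a1\<in>T. 80 * \<kappa> ^ 3 * real (card {b1 \<in> P. (b1, a1) \<in> W}))" using cod by (rule sum_mono)
    also have "\<dots> \<le> (\<Sum>a1\<in>P. 80 * \<kappa> ^ 3 * real (card {b1 \<in> P. (b1, a1) \<in> W}))"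
      using fin finT \<kappa>0 by (intro sum_mono2) auto
    also have "\<dots> = 80 * \<kappa> ^ 3 * real (card W)"
    proof -
      have "W \<subseteq> P \<times> P" unfolding W_def by auto
      from card_pairs_eq_sum(2)[OF fin fin this] show ?thesis by (simp add: sum_distrib_left)
    qed
    finally have nT: "n * real (card T) \<le> 80 * \<kappa> ^ 3 * real (card W)" .
    have "n * n \<le> n * (4 * \<kappa> * m)" using mn n by (intro mult_left_mono) auto
    also have "\<dots> \<le> n * (4 * \<kappa> * (20 * \<kappa> * real (card T)))" using cT n \<kappa>0 by (intro mult_left_mono) auto
    also have "\<dots> = 80 * \<kappa> ^ 2 * (n * real (card T))" by (simp add: power2_eq_square)
    also have "\<dots> \<le> 80 * \<kappa> ^ 2 * (80 * \<kappa> ^ 3 * real (card W))" using nT by (intro mult_left_mono) auto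
    also have "\<dots> = 6400 * \<kappa> ^ 5 * real (card W)" by (simp add: power_add[symmetric] mult.assoc[symmetric])
    finally show "real (card P) ^ 2 \<le> 6400 * \<kappa> ^ 5 * real (card {(b1, a1) \<in> P \<times> P. (a, b1) \<in> G \<and> (a1, b1) \<in> G \<and> (a1, b) \<in> G})"
      unfolding W_def n_def by (simp add: power2_eq_square)
  qed
qed

section \<open>Additive energy and the Balog-Szemeredi-Gowers argument\<close>

lemma coincidences_eq_sum:
  fixes f g :: "'i \<Rightarrow> 'a"
  assumes T: "finite T" and V: "finite V" "f ` T \<subseteq> V"
  shows "card {(x, y) \<in> T \<times> T. f x = g y} = (\<Sum>v\<in>V. card {x \<in> T. f x = v} * card {y \<in> T. g y = v})"
proof -
  let ?S = "{(x, y) \<in> T \<times> T. f x = g y}"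
  have "finite ?S" by (rule finite_subset[of _ "T \<times> T"]) (use T in auto)
  then have "card ?S = (\<Sum>v\<in>V. card {z \<in> ?S. f (fst z) = v})"
    using V by (intro card_eq_sum_fibres) auto
  also have "\<dots> = (\<Sum>v\<in>V. card {x \<in> T. f x = v} * card {y \<in> T. g y = v})"
    unfolding card_cartesian_product[symmetric]
    by (intro sum.cong refl arg_cong[of _ _ card]) auto
  finally show ?thesis .
qed

text \<open>By 2 x y \<le> x^2 + y^2 on each fibre. Taking g as a translate or reflection of f, it
  bounds shifted coincidence counts by the unshifted one.\<close>

lemma coincidences_le:
  fixes f g :: "'i \<Rightarrow> 'a"
  assumes T: "finite T"
  shows "2 * card {(x, y) \<in> T \<times> T. f x = g y}
    \<le> card {(x, y) \<in> T \<times> T. f x = f y} + card {(x, y) \<in> T \<times> T. g x = g y}"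
proof -
  define V where "V = f ` T \<union> g ` T"
  have V: "finite V" "f ` T \<subseteq> V" "g ` T \<subseteq> V" unfolding V_def using T by auto
  have "2 * (a * b) \<le> a * a + b * b" for a b :: nat
  proof -
    have "0 \<le> (int a - int b) * (int a - int b)" by (rule zero_le_square)
    then have "int (2 * (a * b)) \<le> int (a * a + b * b)" by (simp add: algebra_simps)
    then show ?thesis by (simp only: of_nat_le_iff)
  qed
  then show ?thesis
    unfolding coincidences_eq_sum[OF T V(1,2)] coincidences_eq_sum[OF T V(1) V(3)]
      sum_distrib_left sum.distrib[symmetric] by (intro sum_mono) auto
qed

text \<open>
  The graph of popular sums is restricted to indices \<open>p\<close> whose value \<open>\<sigma> p\<close> is attained by few indices,
  so that counting indices and counting values differ only by a bounded factor.
\<close>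

lemma balog_szemeredi_gowers:
  fixes \<sigma> :: "'p \<Rightarrow> 'a::ab_group_add" and L \<rho> :: real
  assumes fin: "finite P" and ne: "P \<noteq> {}" and L: "L \<ge> 1" and \<rho>: "\<rho> \<ge> 1"
    and J: "real (card {(p, q) \<in> P \<times> P. \<sigma> p = \<sigma> q}) \<le> \<rho> * real (card P)"
    and energy: "real (card P) ^ 3 \<le> L * real (card {(x, y) \<in> (P \<times> P) \<times> (P \<times> P).
        \<sigma> (fst x) + \<sigma> (snd x) = \<sigma> (fst y) + \<sigma> (snd y) + c})"
  obtains A' where "A' \<subseteq> P" "real (card P) \<le> 32 * \<rho> * L * real (card A')"
    "\<And>l. real (card (fold_sumset l (\<sigma> ` A'))) \<le> (429496729600 * \<rho> ^ 12 * L ^ 12) ^ l * real (card P)"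
proof -
  define n where "n = real (card P)"
  have n: "n > 0" unfolding n_def using fin ne by (simp add: card_gt_0_iff)
  define T where "T = P \<times> P"
  have finT: "finite T" unfolding T_def using fin by simp
  have cT: "real (card T) = n ^ 2" unfolding T_def n_def by (simp add: card_cartesian_product power2_eq_square)
  define \<tau> where "\<tau> x = \<sigma> (fst x) + \<sigma> (snd x)" for x
  define R where "R s = card {y \<in> T. \<tau> y = s}" for s
  define r where "r v = card {q \<in> P. \<sigma> q = v}" for v
  define J0 where "J0 = card {(p, q) \<in> P \<times> P. \<sigma> p = \<sigma> q}"
  have J0: "real J0 \<le> \<rho> * n" using J unfolding J0_def n_def .
  \<comment> \<open>The number of representations of one sum is itself a coincidence count, of
    \<sigma> p against s - \<sigma> q, hence at most \<open>J0\<close>.\<close>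
  have RJ: "R s \<le> J0" for s
  proof -
    have "{y \<in> T. \<tau> y = s} = {(p, q) \<in> P \<times> P. \<sigma> p = s - \<sigma> q}"
      unfolding T_def \<tau>_def by (auto simp: eq_diff_eq)
    then have "2 * R s \<le> J0 + card {(p, q) \<in> P \<times> P. s - \<sigma> p = s - \<sigma> q}"
      unfolding R_def J0_def using coincidences_le[OF fin, of \<sigma> "\<lambda>q. s - \<sigma> q"] by simp
    then show ?thesis unfolding J0_def by simp
  qed
  \<comment> \<open>The translation c disappears here: the shifted energy never exceeds the
    unshifted one.\<close>
  have E: "n ^ 3 \<le> L * (\<Sum>x\<in>T. real (R (\<tau> x)))"
  proof -
    have "2 * card {(x, y) \<in> T \<times> T. \<tau> x = \<tau> y + c}
        \<le> card {(x, y) \<in> T \<times> T. \<tau> x = \<tau> y} + card {(x, y) \<in> T \<times> T. \<tau> x + c = \<tau> y + c}"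
      using coincidences_le[OF finT, of \<tau> "\<lambda>y. \<tau> y + c"] .
    then have 1: "card {(x, y) \<in> T \<times> T. \<tau> x = \<tau> y + c} \<le> card {(x, y) \<in> T \<times> T. \<tau> x = \<tau> y}" by simp
    have "{(x, y) \<in> T \<times> T. \<tau> x = \<tau> y} \<subseteq> T \<times> T" by auto
    from card_pairs_eq_sum(1)[OF finT finT this]
    have "card {(x, y) \<in> T \<times> T. \<tau> x = \<tau> y} = (\<Sum>x\<in>T. card {y \<in> T. (x, y) \<in> {(x, y) \<in> T \<times> T. \<tau> x = \<tau> y}})" .
    also have "\<dots> = (\<Sum>x\<in>T. R (\<tau> x))"
      unfolding R_def by (intro sum.cong refl arg_cong[of _ _ card]) auto
    finally have "real (card {(x, y) \<in> T \<times> T. \<tau> x = \<tau> y + c}) \<le> (\<Sum>x\<in>T. real (R (\<tau> x)))"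
      using 1 by (simp only: of_nat_sum[symmetric] of_nat_le_iff)
    then have "L * real (card {(x, y) \<in> T \<times> T. \<tau> x = \<tau> y + c}) \<le> L * (\<Sum>x\<in>T. real (R (\<tau> x)))"
      using L by (intro mult_left_mono) auto
    then show ?thesis using energy unfolding T_def[symmetric] \<tau>_def[symmetric] n_def[symmetric] by linarith
  qed
  \<comment> \<open>Sums with fewer than n / (2 L) representations account for at most half of the
    energy. Each remaining pair contributes at most \<rho> n, which leaves at least n^2 / (2 L
    \<rho>) popular pairs.\<close>
  define Pop where "Pop = {x \<in> T. n \<le> 2 * L * real (R (\<tau> x))}"
  have PopT: "Pop \<subseteq> T" unfolding Pop_def by auto
  have finPop: "finite Pop" using PopT finT finite_subset by blast
  have cPop: "n ^ 2 \<le> 2 * L * \<rho> * real (card Pop)"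
  proof -
    have "(\<Sum>x\<in>T. real (R (\<tau> x))) = (\<Sum>x\<in>T - Pop. real (R (\<tau> x))) + (\<Sum>x\<in>Pop. real (R (\<tau> x)))"
      by (rule sum.subset_diff[OF PopT finT])
    also have "(\<Sum>x\<in>T - Pop. real (R (\<tau> x))) \<le> (\<Sum>x\<in>T - Pop. n / (2 * L))"
      using L by (intro sum_mono) (auto simp: Pop_def le_divide_eq mult.commute not_le)
    also have "\<dots> \<le> (\<Sum>x\<in>T. n / (2 * L))" using finT n L by (intro sum_mono2) auto
    also have "\<dots> = n ^ 2 * (n / (2 * L))" using cT by simp
    also have "(\<Sum>x\<in>Pop. real (R (\<tau> x))) \<le> (\<Sum>x\<in>Pop. \<rho> * n)"
    proof (intro sum_mono)
      fix x
      have "real (R (\<tau> x)) \<le> real J0" using RJ by simp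
      then show "real (R (\<tau> x)) \<le> \<rho> * n" using J0 by linarith
    qed
    finally have "(\<Sum>x\<in>T. real (R (\<tau> x))) \<le> n ^ 2 * (n / (2 * L)) + real (card Pop) * (\<rho> * n)" by simp
    then have "L * (\<Sum>x\<in>T. real (R (\<tau> x))) \<le> L * (n ^ 2 * (n / (2 * L)) + real (card Pop) * (\<rho> * n))"
      using L by (intro mult_left_mono) auto
    also have "\<dots> = n ^ 3 / 2 + L * (real (card Pop) * (\<rho> * n))"
      using L by (simp add: distrib_left power2_eq_square power3_eq_cube)
    finally have "n ^ 3 / 2 \<le> L * (real (card Pop) * (\<rho> * n))" using E by linarith
    then have "n ^ 2 * n \<le> (2 * L * \<rho> * real (card Pop)) * n"
      by (simp add: power2_eq_square power3_eq_cube mult_ac)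
    then show ?thesis using n by (simp only: mult_le_cancel_right_pos)
  qed
  \<comment> \<open>By Markov's inequality at most n / (8 \<rho> L) indices exceed this
    multiplicity. Pairs involving one of them number at most n^2 / (4 \<rho> L), half of the lower
    bound for \<open>Pop\<close>.\<close>
  define \<mu> where "\<mu> = 8 * \<rho> ^ 2 * L"
  have \<mu>: "\<mu> > 0" unfolding \<mu>_def using \<rho> L by simp
  define light where "light = {p \<in> P. real (r (\<sigma> p)) \<le> \<mu>}"
  have lightP: "light \<subseteq> P" "finite light" unfolding light_def using fin by auto
  define heavy where "heavy = P - light"
  have finH: "finite heavy" unfolding heavy_def using fin by simp
  have cheavy: "real (card heavy) * (8 * \<rho> * L) \<le> n"
  proof -
    have JS: "{(p, q) \<in> P \<times> P. \<sigma> p = \<sigma> q} \<subseteq> P \<times> P" by auto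
    have "real (card heavy) * \<mu> = (\<Sum>p\<in>heavy. \<mu>)" by simp
    also have "\<dots> \<le> (\<Sum>p\<in>heavy. real (r (\<sigma> p)))"
      by (intro sum_mono) (auto simp: heavy_def light_def)
    also have "\<dots> \<le> (\<Sum>p\<in>P. real (r (\<sigma> p)))"
      using fin by (intro sum_mono2) (auto simp: heavy_def)
    also have "\<dots> = real J0"
    proof -
      have "J0 = (\<Sum>p\<in>P. card {q \<in> P. (p, q) \<in> {(p, q) \<in> P \<times> P. \<sigma> p = \<sigma> q}})"
        unfolding J0_def by (rule card_pairs_eq_sum(1)[OF fin fin JS])
      also have "\<dots> = (\<Sum>p\<in>P. r (\<sigma> p))"
        unfolding r_def by (intro sum.cong refl arg_cong[of _ _ card]) auto
      finally show ?thesis by simp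
    qed
    also have "\<dots> \<le> \<rho> * n" by (rule J0)
    finally have "\<rho> * (real (card heavy) * (8 * \<rho> * L)) \<le> \<rho> * n"
      unfolding \<mu>_def by (simp add: power2_eq_square mult_ac)
    then show ?thesis using \<rho> by (simp only: mult_le_cancel_left_pos)
  qed
  define G where "G = Pop \<inter> (light \<times> light)"
  define \<kappa> where "\<kappa> = 4 * \<rho> * L"
  have \<rho>L: "\<rho> * L \<ge> 1" using mult_mono[of 1 \<rho> 1 L] \<rho> L by simp
  have \<kappa>: "\<kappa> \<ge> 1" unfolding \<kappa>_def using \<rho>L by simp
  have GP: "G \<subseteq> P \<times> P" unfolding G_def using lightP by auto
  have cG: "n ^ 2 \<le> \<kappa> * real (card G)"
  proof -
    have "Pop \<subseteq> G \<union> (heavy \<times> P \<union> P \<times> heavy)"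
      using PopT unfolding G_def heavy_def T_def by auto
    then have "card Pop \<le> card (G \<union> (heavy \<times> P \<union> P \<times> heavy))"
      using fin finH finPop by (intro card_mono) (auto simp: G_def)
    also have "\<dots> \<le> card G + (card (heavy \<times> P) + card (P \<times> heavy))"
      by (rule order_trans[OF card_Un_le add_left_mono[OF card_Un_le]])
    finally have "real (card Pop) \<le> real (card G + (card (heavy \<times> P) + card (P \<times> heavy)))"
      by (simp only: of_nat_le_iff)
    then have "real (card Pop) \<le> real (card G) + 2 * (real (card heavy) * n)"
      unfolding n_def by (simp add: card_cartesian_product mult.commute)
    then have "2 * L * \<rho> * real (card Pop) \<le> 2 * L * \<rho> * (real (card G) + 2 * (real (card heavy) * n))"
      using L \<rho> by (intro mult_left_mono) auto
    also have "\<dots> = 2 * L * \<rho> * real (card G) + (real (card heavy) * (8 * \<rho> * L)) * n / 2"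
      by (simp add: algebra_simps)
    also have "\<dots> \<le> 2 * L * \<rho> * real (card G) + n * n / 2"
      using cheavy n by (intro add_left_mono divide_right_mono mult_right_mono) auto
    finally have "n ^ 2 \<le> 2 * L * \<rho> * real (card G) + n ^ 2 / 2"
      using cPop by (simp add: power2_eq_square)
    then show ?thesis unfolding \<kappa>_def by (simp add: mult_ac)
  qed
  define S where "S = \<tau> ` Pop"
  have finS: "finite S" unfolding S_def using finPop by simp
  have cS: "real (card S) \<le> 2 * L * n"
  proof -
    have "real (card S) * n = (\<Sum>s\<in>S. n)" by simp
    also have "\<dots> \<le> (\<Sum>s\<in>S. 2 * L * real (R s))" by (intro sum_mono) (auto simp: S_def Pop_def)
    also have "\<dots> = 2 * L * real (\<Sum>s\<in>S. R s)" by (simp add: sum_distrib_left)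
    also have "\<dots> \<le> 2 * L * n ^ 2"
    proof -
      have "(\<Sum>s\<in>S. R s) \<le> (\<Sum>s\<in>\<tau> ` T. R s)"
        using finT PopT by (intro sum_mono2) (auto simp: S_def)
      also have "\<dots> = card T" unfolding R_def by (rule card_eq_sum_fibres[symmetric]) (use finT in auto)
      finally have "real (\<Sum>s\<in>S. R s) \<le> n ^ 2" unfolding cT[symmetric] by (simp only: of_nat_le_iff)
      then show ?thesis using L by (intro mult_left_mono) auto
    qed
    finally have "real (card S) * n \<le> (2 * L * n) * n" by (simp add: power2_eq_square mult_ac)
    then show ?thesis using n by (simp only: mult_le_cancel_right_pos)
  qed
  obtain A' B' where AB: "A' \<subseteq> P" "B' \<subseteq> P" "n \<le> 8 * \<kappa> * real (card A')" "n \<le> 4 * \<kappa> * real (card B')"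
    and paths: "\<And>a b. a \<in> A' \<Longrightarrow> b \<in> B' \<Longrightarrow> n ^ 2
       \<le> 6400 * \<kappa> ^ 5 * real (card {(b1, a1) \<in> P \<times> P. (a, b1) \<in> G \<and> (a1, b1) \<in> G \<and> (a1, b) \<in> G})"
    using paths_of_length_three[OF fin ne GP \<kappa> cG[unfolded n_def]] unfolding n_def by blast
  have finAB: "finite A'" "finite B'" using AB fin finite_subset by blast+
  have "A' \<noteq> {}" "B' \<noteq> {}" using AB n by auto
  then obtain a0 where a0: "a0 \<in> A'" by auto
  \<comment> \<open>Every vertex of \<open>B'\<close> ends a path in \<open>G\<close>, and the edges
    of \<open>G\<close> join light vertices only.\<close>
  have B'light: "b \<in> light" if "b \<in> B'" for b
  proof (rule ccontr)
    assume "b \<notin> light"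
    then have "{(b1, a1) \<in> P \<times> P. (a0, b1) \<in> G \<and> (a1, b1) \<in> G \<and> (a1, b) \<in> G} = {}"
      unfolding G_def by auto
    then have "n ^ 2 \<le> 6400 * \<kappa> ^ 5 * real (card ({} :: ('p \<times> 'p) set))"
      using paths[OF a0 that] by (simp only:)
    then show False using n by simp
  qed
  define \<sigma>B where "\<sigma>B = \<sigma> ` B'"
  have finsB: "finite \<sigma>B" unfolding \<sigma>B_def using finAB by simp
  have cB: "real (card B') \<le> \<mu> * real (card \<sigma>B)"
  proof -
    have "card B' = (\<Sum>v\<in>\<sigma>B. card {b \<in> B'. \<sigma> b = v})"
      unfolding \<sigma>B_def using finAB by (intro card_eq_sum_fibres) auto
    then have "real (card B') = (\<Sum>v\<in>\<sigma>B. real (card {b \<in> B'. \<sigma> b = v}))" by simp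
    also have "\<dots> \<le> (\<Sum>v\<in>\<sigma>B. \<mu>)"
    proof (intro sum_mono)
      fix v assume "v \<in> \<sigma>B"
      then obtain b where b: "b \<in> B'" "v = \<sigma> b" unfolding \<sigma>B_def by auto
      have "card {b \<in> B'. \<sigma> b = v} \<le> r v" unfolding r_def using AB fin by (intro card_mono) auto
      moreover have "real (r v) \<le> \<mu>" using B'light[OF b(1)] b(2) unfolding light_def by simp
      ultimately show "real (card {b \<in> B'. \<sigma> b = v}) \<le> \<mu>" by linarith
    qed
    finally show ?thesis by (simp add: mult.commute)
  qed
  define U where "U = sumset \<sigma>B (\<sigma> ` A')"
  have finU: "finite U" unfolding U_def using finsB finAB by (intro finite_sumset) auto
  \<comment> \<open>Along a path a, b1, a1, b one has \<sigma> a + \<sigma> b = \<tau> (a, b1) -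
    \<tau> (a1, b1) + \<tau> (a1, b), an alternating combination of three popular sums.\<close>
  define Tr where "Tr v = {t \<in> S \<times> S \<times> S. fst t - fst (snd t) + snd (snd t) = v}" for v
  have finTr: "finite (Tr v)" for v
    by (rule finite_subset[of _ "S \<times> S \<times> S"]) (use finS in \<open>auto simp: Tr_def\<close>)
  have cTr: "n ^ 2 \<le> 6400 * \<kappa> ^ 5 * \<mu> ^ 2 * real (card (Tr v))" if v: "v \<in> U" for v
  proof -
    from v obtain v1 v2 where "v1 \<in> \<sigma>B" "v2 \<in> \<sigma> ` A'" "v = v1 + v2" unfolding U_def by (rule sumsetE)
    then obtain a b where ab: "a \<in> A'" "b \<in> B'" "v = \<sigma> b + \<sigma> a" unfolding \<sigma>B_def by auto
    define W where "W = {(b1, a1) \<in> P \<times> P. (a, b1) \<in> G \<and> (a1, b1) \<in> G \<and> (a1, b) \<in> G}"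
    have finW: "finite W" by (rule finite_subset[of _ "P \<times> P"]) (use fin in \<open>auto simp: W_def\<close>)
    define h where "h z = (\<tau> (a, fst z), \<tau> (snd z, fst z), \<tau> (snd z, b))" for z
    have hW: "h ` W \<subseteq> Tr v"
    proof
      fix t assume "t \<in> h ` W"
      then obtain z where z: "z \<in> W" "t = h z" by auto
      have zG: "(a, fst z) \<in> G" "(snd z, fst z) \<in> G" "(snd z, b) \<in> G" using z unfolding W_def by auto
      then have "h z \<in> S \<times> S \<times> S" unfolding h_def S_def G_def by auto
      moreover have "\<tau> (a, fst z) - \<tau> (snd z, fst z) + \<tau> (snd z, b) = v"
        unfolding \<tau>_def ab(3) by (simp add: algebra_simps)
      ultimately show "t \<in> Tr v" unfolding Tr_def z(2) by (simp add: h_def)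
    qed
    \<comment> \<open>The first entry of a triple determines \<sigma> b1 and the last one \<sigma>
      a1; both vertices are light, so at most \<mu>^2 paths yield the same triple.\<close>
    have "real (card W) = (\<Sum>t\<in>Tr v. real (card {z \<in> W. h z = t}))"
      using card_eq_sum_fibres[OF finW finTr hW] by simp
    also have "\<dots> \<le> (\<Sum>t\<in>Tr v. \<mu> ^ 2)"
    proof (intro sum_mono)
      fix t
      show "real (card {z \<in> W. h z = t}) \<le> \<mu> ^ 2"
      proof (cases "{z \<in> W. h z = t} = {}")
        case False
        then obtain z0 where z0: "z0 \<in> W" "h z0 = t" by auto
        have l: "fst z0 \<in> light" "snd z0 \<in> light" using z0(1) unfolding W_def G_def by auto
        have "{z \<in> W. h z = t} \<subseteq> {q \<in> P. \<sigma> q = \<sigma> (fst z0)} \<times> {q \<in> P. \<sigma> q = \<sigma> (snd z0)}"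
          using z0(2)[symmetric] unfolding W_def h_def \<tau>_def by auto
        then have "card {z \<in> W. h z = t} \<le> card ({q \<in> P. \<sigma> q = \<sigma> (fst z0)} \<times> {q \<in> P. \<sigma> q = \<sigma> (snd z0)})"
          using fin by (intro card_mono) auto
        also have "\<dots> = r (\<sigma> (fst z0)) * r (\<sigma> (snd z0))" unfolding r_def by (rule card_cartesian_product)
        finally have "real (card {z \<in> W. h z = t}) \<le> real (r (\<sigma> (fst z0)) * r (\<sigma> (snd z0)))"
          by (simp only: of_nat_le_iff)
        also have "\<dots> = real (r (\<sigma> (fst z0))) * real (r (\<sigma> (snd z0)))" by simp
        also have "\<dots> \<le> \<mu> * \<mu>"
          using l \<mu> unfolding light_def by (intro mult_mono) auto
        finally show ?thesis by (simp add: power2_eq_square)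
      next
        case True
        show ?thesis unfolding True by simp
      qed
    qed
    finally have "real (card W) \<le> \<mu> ^ 2 * real (card (Tr v))" by (simp add: mult.commute)
    then have "6400 * \<kappa> ^ 5 * real (card W) \<le> 6400 * \<kappa> ^ 5 * (\<mu> ^ 2 * real (card (Tr v)))"
      using \<kappa> by (intro mult_left_mono) auto
    then show ?thesis using paths[OF ab(1,2)] unfolding W_def[symmetric] by (simp add: mult.assoc)
  qed
  have "(\<Sum>v\<in>U. real (card (Tr v))) \<le> real (card S) ^ 3"
  proof -
    have "(\<Sum>v\<in>U. card (Tr v)) = card (\<Union>v\<in>U. Tr v)"
      using finU finTr by (intro card_UN_disjoint[symmetric]) (auto simp: Tr_def)
    also have "\<dots> \<le> card (S \<times> S \<times> S)" using finS by (intro card_mono) (auto simp: Tr_def)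
    finally have "real (\<Sum>v\<in>U. card (Tr v)) \<le> real (card (S \<times> S \<times> S))" by (simp only: of_nat_le_iff)
    then show ?thesis by (simp add: card_cartesian_product power3_eq_cube mult.assoc)
  qed
  also have "\<dots> \<le> (2 * L * n) ^ 3" using cS by (intro power_mono) auto
  finally have TrU: "(\<Sum>v\<in>U. real (card (Tr v))) \<le> (2 * L * n) ^ 3" .
  \<comment> \<open>The bound 51200 \<kappa>^5 \<mu>^2 L^3 n for |U| combined with n \<le> 4
    \<kappa> \<mu> |\<sigma>B|. Substituting \<kappa> = 4 \<rho> L and \<mu> = 8 \<rho>^2 L gives
    the numerical constant and the twelfth powers of the conclusion.\<close>
  define K where "K = 204800 * \<kappa> ^ 6 * \<mu> ^ 3 * L ^ 3"
  have K0: "K \<ge> 0" unfolding K_def using \<kappa> \<mu> L by simp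
  have Un: "real (card U) \<le> 51200 * \<kappa> ^ 5 * \<mu> ^ 2 * L ^ 3 * n"
  proof -
    have "real (card U) * n ^ 2 = (\<Sum>v\<in>U. n ^ 2)" by simp
    also have "\<dots> \<le> (\<Sum>v\<in>U. 6400 * \<kappa> ^ 5 * \<mu> ^ 2 * real (card (Tr v)))" using cTr by (rule sum_mono)
    also have "\<dots> = 6400 * \<kappa> ^ 5 * \<mu> ^ 2 * (\<Sum>v\<in>U. real (card (Tr v)))" by (simp add: sum_distrib_left)
    also have "\<dots> \<le> 6400 * \<kappa> ^ 5 * \<mu> ^ 2 * (2 * L * n) ^ 3" using TrU \<kappa> by (intro mult_left_mono) auto
    also have "\<dots> = (51200 * \<kappa> ^ 5 * \<mu> ^ 2 * L ^ 3 * n) * n ^ 2"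
      by (simp add: power_mult_distrib power2_eq_square power3_eq_cube)
    finally show ?thesis using n by (simp only: mult_le_cancel_right_pos zero_less_power)
  qed
  have "n \<le> 4 * \<kappa> * (\<mu> * real (card \<sigma>B))"
  proof -
    have "4 * \<kappa> * real (card B') \<le> 4 * \<kappa> * (\<mu> * real (card \<sigma>B))"
      by (rule mult_left_mono[OF cB]) (use \<kappa> in simp)
    then show ?thesis using AB(4) by linarith
  qed
  then have "51200 * \<kappa> ^ 5 * \<mu> ^ 2 * L ^ 3 * n \<le> 51200 * \<kappa> ^ 5 * \<mu> ^ 2 * L ^ 3 * (4 * \<kappa> * (\<mu> * real (card \<sigma>B)))"
    using \<kappa> L by (intro mult_left_mono) auto
  also have "\<dots> = K * real (card \<sigma>B)" unfolding K_def by (simp add: eval_nat_numeral mult_ac)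
  finally have UK: "real (card (sumset \<sigma>B (\<sigma> ` A'))) \<le> K * real (card \<sigma>B)" using Un unfolding U_def by linarith
  have sBne: "\<sigma>B \<noteq> {}" unfolding \<sigma>B_def using \<open>B' \<noteq> {}\<close> by simp
  have Keq: "K = 429496729600 * \<rho> ^ 12 * L ^ 12"
    unfolding K_def \<kappa>_def \<mu>_def power_mult_distrib by (simp add: power_mult[symmetric] power_add[symmetric] mult_ac)
  show thesis
  proof (rule that[OF AB(1)])
    show "real (card P) \<le> 32 * \<rho> * L * real (card A')" using AB(3) unfolding n_def \<kappa>_def by simp
    fix l
    have "card \<sigma>B \<le> card P"
    proof -
      have "card \<sigma>B \<le> card B'" unfolding \<sigma>B_def by (rule card_image_le[OF finAB(2)])
      also have "\<dots> \<le> card P" by (rule card_mono[OF fin AB(2)])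
      finally show ?thesis .
    qed
    then have "K ^ l * real (card \<sigma>B) \<le> K ^ l * real (card P)" using K0 by (intro mult_left_mono) auto
    moreover have "real (card (fold_sumset l (\<sigma> ` A'))) \<le> K ^ l * real (card \<sigma>B)"
      by (rule card_fold_sumset_le[OF finsB _ sBne UK K0]) (use finAB in simp)
    ultimately show "real (card (fold_sumset l (\<sigma> ` A'))) \<le> (429496729600 * \<rho> ^ 12 * L ^ 12) ^ l * real (card P)"
      unfolding Keq by linarith
  qed
qed

section \<open>Passing between solutions, tuples and points\<close>

lemma exists_large_fibre:
  assumes "finite S" "finite V" "V \<noteq> {}" "f ` S \<subseteq> V"
  obtains v where "v \<in> V" "card S \<le> card V * card {z \<in> S. f z = v}"
proof -
  have "\<exists>v\<in>V. \<forall>u\<in>V. card {z \<in> S. f z = u} \<le> card {z \<in> S. f z = v}"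
  proof -
    have "Max ((\<lambda>v. card {z \<in> S. f z = v}) ` V) \<in> (\<lambda>v. card {z \<in> S. f z = v}) ` V"
      using assms by (intro Max_in) auto
    then obtain v where "v \<in> V" "card {z \<in> S. f z = v} = Max ((\<lambda>v. card {z \<in> S. f z = v}) ` V)" by auto
    then show ?thesis using assms by (intro bexI[of _ v]) auto
  qed
  then obtain v where v: "v \<in> V" "\<And>u. u \<in> V \<Longrightarrow> card {z \<in> S. f z = u} \<le> card {z \<in> S. f z = v}" by blast
  have "card S = (\<Sum>u\<in>V. card {z \<in> S. f z = u})" by (rule card_eq_sum_fibres[OF assms(1,2,4)])
  also have "\<dots> \<le> card V * card {z \<in> S. f z = v}"
    using sum_bounded_above[of V "\<lambda>u. card {z \<in> S. f z = u}"] v(2) by simp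
  finally show thesis using that v(1) by blast
qed

lemma sum_fun_apply: "(\<Sum>i\<in>I. f i) j = (\<Sum>i\<in>I. f i j)" for f :: "'i \<Rightarrow> 'j \<Rightarrow> 'a :: comm_monoid_add"
  by (induction I rule: infinite_finite_induct) (auto simp: zero_fun_def)

lemma moment_point_sum_eq_iff:
  "(\<Sum>i\<in>I. moment_point k (x i)) = (\<Sum>i\<in>I. moment_point k (y i))
    \<longleftrightarrow> (\<forall>j\<in>{1..k}. (\<Sum>i\<in>I. x i ^ j) = (\<Sum>i\<in>I. y i ^ j))"
proof -
  have "(\<Sum>i\<in>I. moment_point k (z i)) j = (if j \<in> {1..k} then \<Sum>i\<in>I. z i ^ j else 0)" for z j
    unfolding sum_fun_apply moment_point_def by (cases "j \<in> {1..k}") (simp_all only: if_True if_False sum.neutral_const)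
  then have "(\<Sum>i\<in>I. moment_point k (x i)) = (\<Sum>i\<in>I. moment_point k (y i)) \<longleftrightarrow>
      (\<forall>j. (if j \<in> {1..k} then \<Sum>i\<in>I. x i ^ j else 0) = (if j \<in> {1..k} then \<Sum>i\<in>I. y i ^ j else 0))"
    unfolding fun_eq_iff by (simp only:)
  then show ?thesis by meson
qed

lemma vinogradov_J_alt:
  "vinogradov_J d k A = card {(p, q) \<in> ({1..d} \<rightarrow>\<^sub>E A) \<times> ({1..d} \<rightarrow>\<^sub>E A).
     (\<Sum>i=1..d. moment_point k (p i)) = (\<Sum>i=1..d. moment_point k (q i))}"
  unfolding vinogradov_J_def vinogradov_solutions_def moment_point_sum_eq_iff
  by (intro arg_cong[of _ _ card]) auto

text \<open>Some choice of the last s - 2d variables on both sides accounts for at least the average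
  number of solutions. These inject into quadruples of d-tuples, and \<open>c\<close> is the
  difference of the two fixed contributions.\<close>

lemma vinogradov_J_le_quadruples:
  assumes fin: "finite A" and ne: "A \<noteq> {}" and s: "2 * d \<le> s"
  obtains c :: "nat \<Rightarrow> real" where
    "vinogradov_J s k A \<le> card A ^ (2 * (s - 2 * d)) *
       card {(x, y) \<in> (({1..d} \<rightarrow>\<^sub>E A) \<times> ({1..d} \<rightarrow>\<^sub>E A)) \<times> (({1..d} \<rightarrow>\<^sub>E A) \<times> ({1..d} \<rightarrow>\<^sub>E A)).
         (\<Sum>i=1..d. moment_point k (fst x i)) + (\<Sum>i=1..d. moment_point k (snd x i))
       = (\<Sum>i=1..d. moment_point k (fst y i)) + (\<Sum>i=1..d. moment_point k (snd y i)) + c}"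
proof -
  define P where "P = ({1..d} \<rightarrow>\<^sub>E A)"
  define \<sigma> where "\<sigma> p = (\<Sum>i=1..d. moment_point k (p i))" for p
  define V where "V = ({2 * d + 1..s} \<rightarrow>\<^sub>E A)"
  have finP: "finite P" unfolding P_def using fin by (intro finite_PiE) auto
  have finV: "finite V" unfolding V_def using fin by (intro finite_PiE) auto
  have Vne: "V \<noteq> {}" unfolding V_def using ne by (simp add: PiE_eq_empty_iff)
  have cV: "card V = card A ^ (s - 2 * d)" unfolding V_def by (simp add: card_PiE)
  define sol where "sol = vinogradov_solutions s k A"
  have finsol: "finite sol"
    by (rule finite_subset[of _ "({1..s} \<rightarrow>\<^sub>E A) \<times> ({1..s} \<rightarrow>\<^sub>E A)"]) (use fin in \<open>auto simp: sol_def vinogradov_solutions_def intro!: finite_PiE\<close>)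
  define rest where "rest z = (restrict (fst z) {2 * d + 1..s}, restrict (snd z) {2 * d + 1..s})"
    for z :: "(nat \<Rightarrow> real) \<times> (nat \<Rightarrow> real)"
  have restV: "rest ` sol \<subseteq> V \<times> V"
    using s unfolding rest_def sol_def vinogradov_solutions_def V_def by (auto simp: PiE_iff)
  obtain v where v: "v \<in> V \<times> V" "card sol \<le> card (V \<times> V) * card {z \<in> sol. rest z = v}"
    by (rule exists_large_fibre[OF finsol _ _ restV]) (use finV Vne in auto)
  define \<gamma>rest where "\<gamma>rest x = (\<Sum>i=2*d+1..s. moment_point k (x i))" for x
  define c where "c = \<gamma>rest (snd v) - \<gamma>rest (fst v)"
  define first where "first x = restrict x {1..d}" for x :: "nat \<Rightarrow> real"
  define second where "second x = restrict (\<lambda>i. x (i + d)) {1..d}" for x :: "nat \<Rightarrow> real"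
  define h where "h z = ((first (fst z), second (fst z)), (first (snd z), second (snd z)))" for z
  define Q where "Q = {(x, y) \<in> (P \<times> P) \<times> (P \<times> P). \<sigma> (fst x) + \<sigma> (snd x) = \<sigma> (fst y) + \<sigma> (snd y) + c}"
  have finQ: "finite Q" by (rule finite_subset[of _ "(P \<times> P) \<times> (P \<times> P)"]) (use finP in \<open>auto simp: Q_def\<close>)
  have split: "(\<Sum>i=1..s. moment_point k (x i)) = \<sigma> (first x) + \<sigma> (second x) + \<gamma>rest (restrict x {2 * d + 1..s})" for x
  proof -
    have "{1..s} = {1..2*d} \<union> {2*d+1..s}" using s by auto
    then have "(\<Sum>i=1..s. moment_point k (x i)) = (\<Sum>i=1..2*d. moment_point k (x i)) + (\<Sum>i=2*d+1..s. moment_point k (x i))"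
      by (simp only:) (rule sum.union_disjoint; force)
    also have "{1..2*d} = {1..d} \<union> {d+1..d+d}" by auto
    then have "(\<Sum>i=1..2*d. moment_point k (x i)) = (\<Sum>i=1..d. moment_point k (x i)) + (\<Sum>i=d+1..d+d. moment_point k (x i))"
      by (simp only:) (rule sum.union_disjoint; force)
    also have "(\<Sum>i=d+1..d+d. moment_point k (x i)) = (\<Sum>i=1..d. moment_point k (x (i + d)))"
      by (rule sum.reindex_bij_witness[of _ "\<lambda>i. i + d" "\<lambda>i. i - d"]) auto
    also have "(\<Sum>i=1..d. moment_point k (x i)) = \<sigma> (first x)"
      unfolding \<sigma>_def first_def by (intro sum.cong refl) auto
    also have "(\<Sum>i=1..d. moment_point k (x (i + d))) = \<sigma> (second x)"
      unfolding \<sigma>_def second_def by (intro sum.cong refl) auto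
    also have "(\<Sum>i=2*d+1..s. moment_point k (x i)) = \<gamma>rest (restrict x {2 * d + 1..s})"
      unfolding \<gamma>rest_def by (intro sum.cong refl) auto
    finally show ?thesis .
  qed
  have "card {z \<in> sol. rest z = v} \<le> card Q"
  proof (rule card_inj_on_le[OF _ _ finQ])
    show "h ` {z \<in> sol. rest z = v} \<subseteq> Q"
    proof
      fix w assume "w \<in> h ` {z \<in> sol. rest z = v}"
      then obtain z where z: "z \<in> sol" "rest z = v" "w = h z" by auto
      have x: "fst z \<in> {1..s} \<rightarrow>\<^sub>E A" "snd z \<in> {1..s} \<rightarrow>\<^sub>E A"
        and eq: "(\<Sum>i=1..s. moment_point k (fst z i)) = (\<Sum>i=1..s. moment_point k (snd z i))"
        using z(1) unfolding sol_def vinogradov_solutions_def moment_point_sum_eq_iff by auto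
      have inP: "first y \<in> P" "second y \<in> P" if "y \<in> {1..s} \<rightarrow>\<^sub>E A" for y
        using that s unfolding P_def first_def second_def by (auto simp: PiE_iff)
      have "\<sigma> (first (fst z)) + \<sigma> (second (fst z)) + \<gamma>rest (fst v)
          = \<sigma> (first (snd z)) + \<sigma> (second (snd z)) + \<gamma>rest (snd v)"
        using eq z(2) unfolding split rest_def by auto
      then have "\<sigma> (first (fst z)) + \<sigma> (second (fst z)) = \<sigma> (first (snd z)) + \<sigma> (second (snd z)) + c"
        unfolding c_def by (simp add: algebra_simps eq_diff_eq)
      then show "w \<in> Q" unfolding Q_def z(3) h_def using inP x by simp
    qed
    show "inj_on h {z \<in> sol. rest z = v}"
    proof (rule inj_onI)
      fix z z' assume z: "z \<in> {z \<in> sol. rest z = v}" "z' \<in> {z \<in> sol. rest z = v}" and hz: "h z = h z'"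
      have same: "x = x'" if x: "x \<in> {1..s} \<rightarrow>\<^sub>E A" "x' \<in> {1..s} \<rightarrow>\<^sub>E A" and "first x = first x'" "second x = second x'"
          "restrict x {2 * d + 1..s} = restrict x' {2 * d + 1..s}" for x x'
      proof (rule PiE_ext[OF x])
        fix i assume i: "i \<in> {1..s}"
        consider "i \<in> {1..d}" | "i - d \<in> {1..d}" "i - d + d = i" | "i \<in> {2 * d + 1..s}"
          using i by (cases "i \<le> d"; cases "i \<le> 2 * d") auto
        then show "x i = x' i"
        proof cases
          case 1
          then show ?thesis using fun_cong[OF that(3), of i] unfolding first_def by simp
        next
          case 2
          then show ?thesis using fun_cong[OF that(4), of "i - d"] unfolding second_def by simp
        next
          case 3
          then show ?thesis using fun_cong[OF that(5), of i] by simp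
        qed
      qed
      have r: "rest z = rest z'" using z by simp
      have x: "fst z \<in> {1..s} \<rightarrow>\<^sub>E A" "snd z \<in> {1..s} \<rightarrow>\<^sub>E A" "fst z' \<in> {1..s} \<rightarrow>\<^sub>E A" "snd z' \<in> {1..s} \<rightarrow>\<^sub>E A"
        using z unfolding sol_def vinogradov_solutions_def by auto
      have "fst z = fst z'" using hz r unfolding h_def rest_def by (intro same[OF x(1,3)]) simp_all
      moreover have "snd z = snd z'" using hz r unfolding h_def rest_def by (intro same[OF x(2,4)]) simp_all
      ultimately show "z = z'" by (rule prod_eqI)
    qed
  qed
  then have "card sol \<le> card (V \<times> V) * card Q" using v(2) by (meson le_trans mult_le_mono2)
  also have "card (V \<times> V) = card A ^ (2 * (s - 2 * d))"
    unfolding card_cartesian_product cV by (simp add: mult_2 power_add)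
  finally show thesis
    unfolding sol_def Q_def P_def \<sigma>_def vinogradov_J_def[symmetric] by (rule that)
qed

lemma card_fold_sumset_translate:
  fixes B B' :: "'a::ab_group_add set"
  assumes "finite B'" "\<And>b. b \<in> B \<Longrightarrow> b + w \<in> B'"
  shows "card (fold_sumset l B) \<le> card (fold_sumset l B')"
proof (rule card_inj_on_le[OF _ _ finite_fold_sumset[OF assms(1)]])
  show "inj_on (\<lambda>v. v + (\<Sum>i=1..l. w)) (fold_sumset l B)" by (simp add: inj_on_def)
  show "(\<lambda>v. v + (\<Sum>i=1..l. w)) ` fold_sumset l B \<subseteq> fold_sumset l B'"
  proof
    fix u assume "u \<in> (\<lambda>v. v + (\<Sum>i=1..l. w)) ` fold_sumset l B"
    then obtain b where b: "u = (\<Sum>i=1..l. b i) + (\<Sum>i=1..l. w)" "\<forall>i\<in>{1..l}. b i \<in> B"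
      unfolding fold_sumset_def by auto
    then have "u = (\<Sum>i=1..l. b i + w)" by (simp only: sum.distrib)
    moreover have "\<forall>i\<in>{1..l}. b i + w \<in> B'" using b assms by auto
    ultimately show "u \<in> fold_sumset l B'" unfolding fold_sumset_def by (auto intro!: exI[of _ "\<lambda>i. b i + w"])
  qed
qed

text \<open>In a largest fibre over the last d - 1 coordinates a tuple is determined by its first
  entry, so the fibre is a copy of a subset of A; \<open>w\<close> is the common contribution of the
  fixed coordinates.\<close>

lemma exists_section:
  fixes A :: "real set"
  assumes fin: "finite A" and ne: "A \<noteq> {}" and d: "d \<ge> 1" and A'': "A'' \<subseteq> {1..d} \<rightarrow>\<^sub>E A"
  obtains A' w where "A' \<subseteq> A" "card A'' \<le> card A ^ (d - 1) * card A'"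
    "\<And>a. a \<in> A' \<Longrightarrow> moment_point k a + w \<in> (\<lambda>p. \<Sum>i=1..d. moment_point k (p i)) ` A''"
proof -
  define V where "V = ({2..d} \<rightarrow>\<^sub>E A)"
  have finV: "finite V" unfolding V_def using fin by (intro finite_PiE) auto
  have Vne: "V \<noteq> {}" unfolding V_def using ne by (simp add: PiE_eq_empty_iff)
  have cV: "card V = card A ^ (d - 1)" unfolding V_def by (simp add: card_PiE)
  have finA'': "finite A''"
    by (rule finite_subset[OF A'']) (use fin in \<open>auto intro!: finite_PiE\<close>)
  have img: "(\<lambda>p. restrict p {2..d}) ` A'' \<subseteq> V"
    using A'' unfolding V_def by (auto simp: PiE_iff subset_iff)
  obtain v where v: "v \<in> V" "card A'' \<le> card V * card {p \<in> A''. restrict p {2..d} = v}"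
    by (rule exists_large_fibre[OF finA'' finV Vne img])
  define Fb where "Fb = {p \<in> A''. restrict p {2..d} = v}"
  define w where "w = (\<Sum>i=2..d. moment_point k (v i))"
  have inj: "inj_on (\<lambda>p. p 1) Fb"
  proof (rule inj_onI)
    fix p q assume pq: "p \<in> Fb" "q \<in> Fb" "p 1 = q 1"
    have P: "p \<in> {1..d} \<rightarrow>\<^sub>E A" "q \<in> {1..d} \<rightarrow>\<^sub>E A" using pq A'' unfolding Fb_def by auto
    have r: "restrict p {2..d} = restrict q {2..d}" using pq unfolding Fb_def by simp
    show "p = q"
    proof (rule PiE_ext[OF P])
      fix i assume i: "i \<in> {1..d}"
      show "p i = q i"
      proof (cases "i = 1")
        case False
        then have "i \<in> {2..d}" using i by simp
        then show ?thesis using fun_cong[OF r, of i] by simp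
      qed (use pq in simp)
    qed
  qed
  show thesis
  proof (rule that[of "(\<lambda>p. p 1) ` Fb" w])
    show "(\<lambda>p. p 1) ` Fb \<subseteq> A" using A'' d unfolding Fb_def by (auto simp: PiE_iff subset_iff)
    show "card A'' \<le> card A ^ (d - 1) * card ((\<lambda>p. p 1) ` Fb)"
      using v(2) unfolding Fb_def[symmetric] cV card_image[OF inj] .
    fix a assume "a \<in> (\<lambda>p. p 1) ` Fb"
    then obtain p where p: "p \<in> Fb" "a = p 1" by auto
    have "(\<Sum>i=1..d. moment_point k (p i)) = moment_point k (p 1) + (\<Sum>i=2..d. moment_point k (p i))"
      using d by (simp add: sum.atLeast_Suc_atMost numeral_2_eq_2)
    also have "(\<Sum>i=2..d. moment_point k (p i)) = w"
      unfolding w_def using p(1) unfolding Fb_def by (intro sum.cong refl) (auto simp: restrict_def)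
    finally show "moment_point k a + w \<in> (\<lambda>p. \<Sum>i=1..d. moment_point k (p i)) ` A''"
      using p unfolding Fb_def by (intro image_eqI[of _ _ p]) auto
  qed
qed

section \<open>Structure of sets with many solutions\<close>

text \<open>For k = 0 the curve degenerates to the single point 0, so A itself serves as the
  subset.\<close>

lemma structured_subset_degree_zero:
  fixes \<alpha> \<epsilon> :: real
  assumes "A \<noteq> {}" "finite A" "0 < \<alpha>" "\<alpha> \<le> 1" "\<epsilon> > 0"
  shows "real (card A) \<ge> \<alpha> powr (\<epsilon> / 4) * real (card A) powr 1"
    and "real (card (fold_sumset l (moment_point 0 ` A)))
      \<le> \<alpha> powr (- (1 + 2 * \<epsilon> * real l)) * real (card A) powr 0"
proof -
  have cA: "real (card A) > 0" using assms by (simp add: card_gt_0_iff)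
  have "\<alpha> powr (\<epsilon> / 4) \<le> 1" using assms by (intro powr_le1) auto
  then have "\<alpha> powr (\<epsilon> / 4) * real (card A) \<le> 1 * real (card A)" by (intro mult_right_mono) auto
  then show "real (card A) \<ge> \<alpha> powr (\<epsilon> / 4) * real (card A) powr 1" using cA by simp
  have mp: "moment_point 0 a = 0" for a unfolding moment_point_def by (auto simp: zero_fun_def)
  have "fold_sumset l (moment_point 0 ` A) \<subseteq> {0}"
  proof
    fix v assume "v \<in> fold_sumset l (moment_point 0 ` A)"
    then obtain b where b: "v = (\<Sum>i=1..l. b i)" "\<forall>i\<in>{1..l}. b i \<in> moment_point 0 ` A"
      unfolding fold_sumset_def by auto
    have "(\<Sum>i=1..l. b i) = 0" using b(2) mp by (intro sum.neutral) auto
    then show "v \<in> {0}" using b by simp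
  qed
  then have "card (fold_sumset l (moment_point 0 ` A)) \<le> card {0 :: nat \<Rightarrow> real}" by (intro card_mono) auto
  then have "real (card (fold_sumset l (moment_point 0 ` A))) \<le> 1" by simp
  also have "1 \<le> \<alpha> powr (- (1 + 2 * \<epsilon> * real l))"
  proof -
    have "0 \<le> 2 * \<epsilon> * real l" using assms by simp
    then have "- (1 + 2 * \<epsilon> * real l) \<le> 0" by linarith
    then have "\<alpha> powr 0 \<le> \<alpha> powr (- (1 + 2 * \<epsilon> * real l))" by (rule powr_mono') (use assms in simp_all)
    then show ?thesis using assms by simp
  qed
  finally show "real (card (fold_sumset l (moment_point 0 ` A)))
      \<le> \<alpha> powr (- (1 + 2 * \<epsilon> * real l)) * real (card A) powr 0" using cA by simp
qed

text \<open>The conclusion is free of \<alpha>: the logarithmic hypothesis makes 1 / \<alpha> a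
  small power of |A|, so it can be treated like the loss in the mean value and only cardinalities
  remain.\<close>

lemma structured_subset:
  fixes \<epsilon> m :: real
  assumes k: "k \<ge> 1" and s: "s \<ge> k * (k + 1)" and \<epsilon>: "\<epsilon> > 0" and m: "m \<ge> 1"
  shows "\<exists>N::nat. \<forall>A \<alpha>. well_spaced A \<and> card A \<ge> N \<and> real_diam A \<le> real (card A) powr m \<and>
      0 < \<alpha> \<and> \<alpha> \<le> 1 \<and>
      ln (1 / \<alpha>) \<le> \<epsilon> * real (moment_degree k) / 21600 * ln (real (card A)) \<and>
      real (vinogradov_J s k A) = \<alpha> * real (card A) powr (2 * real s - real (moment_degree k)) \<longrightarrow>
    card A > 1 \<and> (\<exists>A'\<subseteq>A. real (card A') \<ge> real (card A) powr (1 - \<epsilon> * real (moment_degree k) / 450) \<and>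
      (\<forall>l. real (card (fold_sumset l (moment_point k ` A')))
        \<le> real (card A) powr (real (moment_degree k) + \<epsilon> * real (moment_degree k) / 450 * real l)))"
proof -
  define d where "d = moment_degree k"
  have d: "d \<ge> 1" unfolding d_def by (rule moment_degree_pos[OF k])
  have ds: "2 * d \<le> s" using s unfolding d_def moment_degree_double .
  define \<delta> where "\<delta> = \<epsilon> * real d / 21600"
  have \<delta>: "\<delta> > 0" unfolding \<delta>_def using \<epsilon> d by simp
  obtain N1 :: nat where N1: "\<And>A. well_spaced A \<Longrightarrow> card A \<ge> N1 \<Longrightarrow> real_diam A \<le> real (card A) powr m \<Longrightarrow>
      real (vinogradov_J d k A) \<le> real (card A) powr (real d + \<delta>)"
    using vinogradov_mean_value_well_spaced[OF k \<delta> m] unfolding d_def by blast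
  define C0 :: real where "C0 = 429496729600"
  \<comment> \<open>For |A| beyond this threshold |A|^(24 \<delta>) swallows the numerical constant
    \<open>C0\<close>; the twelfth power of \<rho> L costs another 24 \<delta>.\<close>
  obtain N2 :: nat where N2: "C0 powr (1 / (24 * \<delta>)) < real N2" using reals_Archimedean2 by blast
  define N where "N = max 2 (max N1 N2)"
  have "card A > 1 \<and> (\<exists>A'\<subseteq>A. real (card A') \<ge> real (card A) powr (1 - 48 * \<delta>) \<and>
      (\<forall>l. real (card (fold_sumset l (moment_point k ` A'))) \<le> real (card A) powr (real d + 48 * \<delta> * real l)))"
    if ws: "well_spaced A" and cN: "card A \<ge> N" and diam: "real_diam A \<le> real (card A) powr m"
      and \<alpha>: "0 < \<alpha>" "\<alpha> \<le> 1" and ln\<alpha>: "ln (1 / \<alpha>) \<le> \<delta> * ln (real (card A))"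
      and Js: "real (vinogradov_J s k A) = \<alpha> * real (card A) powr (2 * real s - real d)" for A \<alpha>
  proof -
    define X where "X = real (card A)"
    have X2: "X \<ge> 2" using cN unfolding X_def N_def by simp
    then have X0: "X > 0" by simp
    have fin: "finite A" using ws unfolding well_spaced_def by simp
    have ne: "A \<noteq> {}" using X2 unfolding X_def by auto
    have XN2: "X \<ge> real N2" using cN unfolding X_def N_def by simp
    define L where "L = 1 / \<alpha>"
    have L1: "L \<ge> 1" unfolding L_def using \<alpha> by simp
    have LX: "L \<le> X powr \<delta>"
    proof -
      have "ln L \<le> \<delta> * ln X" using ln\<alpha> unfolding L_def X_def .
      then have "exp (ln L) \<le> exp (\<delta> * ln X)" by simp
      then show ?thesis using L1 X0 by (simp add: powr_def)
    qed
    define \<rho> where "\<rho> = X powr \<delta>"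
    have \<rho>1: "\<rho> \<ge> 1" unfolding \<rho>_def using X2 \<delta> by (intro ge_one_powr_ge_zero) auto
    have C0X: "C0 \<le> X powr (24 * \<delta>)"
    proof -
      have "C0 = (C0 powr (1 / (24 * \<delta>))) powr (24 * \<delta>)" using \<delta> by (simp add: powr_powr C0_def)
      also have "\<dots> \<le> X powr (24 * \<delta>)" using N2 XN2 \<delta> by (intro powr_mono2) auto
      finally show ?thesis .
    qed
    define P where "P = ({1..d} \<rightarrow>\<^sub>E A)"
    define \<sigma> where "\<sigma> p = (\<Sum>i=1..d. moment_point k (p i))" for p
    have finP: "finite P" unfolding P_def using fin by (intro finite_PiE) auto
    have neP: "P \<noteq> {}" unfolding P_def using ne by (simp add: PiE_eq_empty_iff)
    have cP: "real (card P) = X ^ d" unfolding P_def X_def by (simp add: card_PiE)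
    have cP': "real (card P) = X powr real d" unfolding cP using X0 by (simp add: powr_realpow)
    have J: "real (card {(p, q) \<in> P \<times> P. \<sigma> p = \<sigma> q}) \<le> \<rho> * real (card P)"
    proof -
      have "real (vinogradov_J d k A) \<le> X powr (real d + \<delta>)"
        unfolding X_def by (rule N1[OF ws _ diam]) (use cN in \<open>simp add: N_def\<close>)
      also have "\<dots> = \<rho> * real (card P)" unfolding \<rho>_def cP' by (simp add: powr_add)
      finally show ?thesis unfolding vinogradov_J_alt P_def \<sigma>_def .
    qed
    obtain c where c: "vinogradov_J s k A \<le> card A ^ (2 * (s - 2 * d)) *
       card {(x, y) \<in> (P \<times> P) \<times> (P \<times> P). \<sigma> (fst x) + \<sigma> (snd x) = \<sigma> (fst y) + \<sigma> (snd y) + c}"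
      using vinogradov_J_le_quadruples[OF fin ne ds, of k] unfolding P_def \<sigma>_def by blast
    define Q where "Q = real (card {(x, y) \<in> (P \<times> P) \<times> (P \<times> P). \<sigma> (fst x) + \<sigma> (snd x) = \<sigma> (fst y) + \<sigma> (snd y) + c})"
    \<comment> \<open>Dividing \<alpha> |A|^(2s - d) by the |A|^(2s - 4d) choices of fixed variables
      leaves \<alpha> |A|^(3d), which is |P|^3 / L.\<close>
    have energy: "real (card P) ^ 3 \<le> L * Q"
    proof -
      have "real (vinogradov_J s k A) \<le> real (card A ^ (2 * (s - 2 * d)) *
         card {(x, y) \<in> (P \<times> P) \<times> (P \<times> P). \<sigma> (fst x) + \<sigma> (snd x) = \<sigma> (fst y) + \<sigma> (snd y) + c})"
        using c by (simp only: of_nat_le_iff)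
      then have "\<alpha> * X powr (2 * real s - real d) \<le> X ^ (2 * (s - 2 * d)) * Q"
        unfolding Js X_def Q_def by simp
      also have "X ^ (2 * (s - 2 * d)) = X powr (2 * real s - 4 * real d)"
        using X0 ds by (simp add: of_nat_diff algebra_simps flip: powr_realpow)
      finally have "L * (\<alpha> * X powr (2 * real s - real d)) \<le> L * (X powr (2 * real s - 4 * real d) * Q)"
        using L1 by (intro mult_left_mono) auto
      moreover have "L * (\<alpha> * X powr (2 * real s - real d)) = X powr (2 * real s - 4 * real d) * X powr (3 * real d)"
        unfolding L_def powr_add[symmetric] using \<alpha> by simp
      ultimately have "X powr (2 * real s - 4 * real d) * X powr (3 * real d) \<le> X powr (2 * real s - 4 * real d) * (L * Q)"
        by (simp add: mult.left_commute)
      then have "X powr (3 * real d) \<le> L * Q" using X0 by (simp add: mult_le_cancel_left_pos)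
      moreover have "real (card P) ^ 3 = X powr (3 * real d)"
        unfolding cP' using X0 by (simp add: powr_powr mult.commute flip: powr_realpow)
      ultimately show ?thesis by simp
    qed
    obtain A'' where A'': "A'' \<subseteq> P" "real (card P) \<le> 32 * \<rho> * L * real (card A'')"
      and fold: "\<And>l. real (card (fold_sumset l (\<sigma> ` A''))) \<le> (C0 * \<rho> ^ 12 * L ^ 12) ^ l * real (card P)"
      using balog_szemeredi_gowers[OF finP neP L1 \<rho>1 J energy[unfolded Q_def]] unfolding C0_def by blast
    have finA'': "finite A''" using A'' finP finite_subset by blast
    obtain A' w where A': "A' \<subseteq> A" "card A'' \<le> card A ^ (d - 1) * card A'"
      and w: "\<And>a. a \<in> A' \<Longrightarrow> moment_point k a + w \<in> \<sigma> ` A''"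
      using exists_section[OF fin ne d A''(1)[unfolded P_def], of k] unfolding \<sigma>_def by blast
    have \<rho>L: "\<rho> * L \<le> X powr (2 * \<delta>)"
    proof -
      have "\<rho> * L \<le> X powr \<delta> * X powr \<delta>" unfolding \<rho>_def using LX by (intro mult_left_mono) auto
      also have "\<dots> = X powr (2 * \<delta>)" by (simp add: powr_add[symmetric])
      finally show ?thesis .
    qed
    have K1: "C0 * \<rho> ^ 12 * L ^ 12 \<le> X powr (48 * \<delta>)"
    proof -
      have "C0 * \<rho> ^ 12 * L ^ 12 = C0 * (\<rho> * L) ^ 12" by (simp add: power_mult_distrib)
      also have "\<dots> \<le> X powr (24 * \<delta>) * (X powr (2 * \<delta>)) ^ 12"
        using C0X \<rho>L \<rho>1 L1 by (intro mult_mono power_mono) (auto simp: C0_def)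
      also have "(X powr (2 * \<delta>)) ^ 12 = X powr (24 * \<delta>)"
        using X0 by (simp add: powr_powr flip: powr_realpow)
      also have "X powr (24 * \<delta>) * X powr (24 * \<delta>) = X powr (48 * \<delta>)" by (simp add: powr_add[symmetric])
      finally show ?thesis .
    qed
    have K2: "32 * \<rho> * L \<le> X powr (48 * \<delta>)"
    proof -
      have \<rho>L1: "1 \<le> \<rho> * L" using mult_mono[of 1 \<rho> 1 L] \<rho>1 L1 by simp
      have "32 * (\<rho> * L) ^ 1 \<le> C0 * (\<rho> * L) ^ 12"
        using \<rho>L1 by (intro mult_mono power_increasing) (auto simp: C0_def)
      then have "32 * \<rho> * L \<le> C0 * \<rho> ^ 12 * L ^ 12" by (simp add: power_mult_distrib mult.assoc)
      then show ?thesis using K1 by linarith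
    qed
    \<comment> \<open>\<open>A''\<close> has at least |A|^(d - 48 \<delta>) elements, and passing to
      a section divides this by |A|^(d - 1).\<close>
    have cA': "X powr (1 - 48 * \<delta>) \<le> real (card A')"
    proof -
      have "real (card A'') \<le> real (card A ^ (d - 1) * card A')" using A'(2) by (simp only: of_nat_le_iff)
      then have a2: "real (card A'') \<le> X ^ (d - 1) * real (card A')" unfolding X_def by simp
      have "X ^ (d - 1) * X = X ^ d" using d by (cases d) auto
      then have "X ^ (d - 1) * X \<le> 32 * \<rho> * L * real (card A'')" using A''(2) cP by simp
      also have "\<dots> \<le> X powr (48 * \<delta>) * (X ^ (d - 1) * real (card A'))"
        using K2 a2 by (intro mult_mono) auto
      finally have "X ^ (d - 1) * X \<le> X ^ (d - 1) * (X powr (48 * \<delta>) * real (card A'))"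
        by (simp add: mult.left_commute)
      then have "X \<le> X powr (48 * \<delta>) * real (card A')" using X0 by (simp add: mult_le_cancel_left_pos)
      then show ?thesis using X0 by (simp add: powr_diff pos_divide_le_eq mult.commute)
    qed
    have "real (card (fold_sumset l (moment_point k ` A'))) \<le> X powr (real d + 48 * \<delta> * real l)" for l
    proof -
      have "card (fold_sumset l (moment_point k ` A')) \<le> card (fold_sumset l (\<sigma> ` A''))"
        using finA'' w by (intro card_fold_sumset_translate[where w = w]) auto
      then have "real (card (fold_sumset l (moment_point k ` A'))) \<le> (C0 * \<rho> ^ 12 * L ^ 12) ^ l * real (card P)"
        using fold[of l] by linarith
      also have "\<dots> \<le> (X powr (48 * \<delta>)) ^ l * real (card P)"
        using K1 \<rho>1 L1 by (intro mult_right_mono power_mono) (auto simp: C0_def)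
      also have "\<dots> = X powr (real d + 48 * \<delta> * real l)"
        unfolding cP' using X0 by (simp add: powr_powr powr_add mult.commute flip: powr_realpow)
      finally show ?thesis .
    qed
    moreover have "card A > 1" using X2 unfolding X_def by linarith
    ultimately show ?thesis using A'(1) cA' unfolding X_def by blast
  qed
  moreover have "48 * \<delta> = \<epsilon> * real d / 450" unfolding \<delta>_def by simp
  ultimately show ?thesis unfolding d_def[symmetric] \<delta>_def by (intro exI[of _ N]) auto
qed

theorem theorem1p1:
  fixes s k :: nat
  assumes "s \<ge> k * (k + 1)"
  shows "\<exists>\<epsilon>\<^sub>0::real. \<epsilon>\<^sub>0 > 0 \<and>
    (\<forall>\<epsilon>::real. 0 < \<epsilon> \<and> \<epsilon> < \<epsilon>\<^sub>0 \<longrightarrow>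
      (\<forall>m::real. m \<ge> 1 \<longrightarrow>
        (\<exists>N::nat. \<forall>A::real set. \<forall>\<alpha>::real.
           finite A \<and> well_spaced A \<and> card A \<ge> N \<and> real_diam A \<le> real (card A) powr m \<and>
           0 < \<alpha> \<and> \<alpha> \<le> 1 \<and>
           ln (1 / \<alpha>) \<le> \<epsilon> * real k * (real k + 1) / 43200 * ln (real (card A)) \<and>
           real (vinogradov_J s k A)
             = \<alpha> * real (card A) powr (2 * real s - real k * (real k + 1) / 2)
           \<longrightarrow>
           (\<exists>A'. A' \<subseteq> A \<and>
              real (card A') \<ge> \<alpha> powr (\<epsilon> / 4) * real (card A) powr (1 - \<epsilon> * (real k)\<^sup>2) \<and>
              (\<forall>l::nat.
                 real (card (fold_sumset l (moment_point k ` A')))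
                   \<le> \<alpha> powr (- (1 + 2 * \<epsilon> * (real l + (real k)\<^sup>2)))
                     * real (card A') powr
                         (real k * (real k + 1) / 2 * (1 + \<epsilon> * (real l + (real k)\<^sup>2))))))))"
proof (cases "k = 0")
  case True
  show ?thesis
  proof (rule exI[of _ 1], intro conjI allI impI)
    fix \<epsilon> m :: real assume \<epsilon>: "0 < \<epsilon> \<and> \<epsilon> < 1"
    show "\<exists>N::nat. \<forall>A::real set. \<forall>\<alpha>::real.
           finite A \<and> well_spaced A \<and> card A \<ge> N \<and> real_diam A \<le> real (card A) powr m \<and>
           0 < \<alpha> \<and> \<alpha> \<le> 1 \<and>
           ln (1 / \<alpha>) \<le> \<epsilon> * real k * (real k + 1) / 43200 * ln (real (card A)) \<and>
           real (vinogradov_J s k A)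
             = \<alpha> * real (card A) powr (2 * real s - real k * (real k + 1) / 2)
           \<longrightarrow>
           (\<exists>A'. A' \<subseteq> A \<and>
              real (card A') \<ge> \<alpha> powr (\<epsilon> / 4) * real (card A) powr (1 - \<epsilon> * (real k)\<^sup>2) \<and>
              (\<forall>l::nat.
                 real (card (fold_sumset l (moment_point k ` A')))
                   \<le> \<alpha> powr (- (1 + 2 * \<epsilon> * (real l + (real k)\<^sup>2)))
                     * real (card A') powr
                         (real k * (real k + 1) / 2 * (1 + \<epsilon> * (real l + (real k)\<^sup>2)))))"
    proof (intro exI[of _ "1::nat"] allI impI, elim conjE)
      fix A :: "real set" and \<alpha> :: real
      assume A: "finite A" "card A \<ge> 1" and \<alpha>: "0 < \<alpha>" "\<alpha> \<le> 1"
      have ne: "A \<noteq> {}" using A by auto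
      note zero = structured_subset_degree_zero[OF ne A(1) \<alpha>, of \<epsilon>]
      show "\<exists>A'. A' \<subseteq> A \<and>
              real (card A') \<ge> \<alpha> powr (\<epsilon> / 4) * real (card A) powr (1 - \<epsilon> * (real k)\<^sup>2) \<and>
              (\<forall>l::nat.
                 real (card (fold_sumset l (moment_point k ` A')))
                   \<le> \<alpha> powr (- (1 + 2 * \<epsilon> * (real l + (real k)\<^sup>2)))
                     * real (card A') powr
                         (real k * (real k + 1) / 2 * (1 + \<epsilon> * (real l + (real k)\<^sup>2))))"
        unfolding True by (rule exI[of _ A]) (use zero \<epsilon> in simp)
    qed
  qed simp
next
  case False
  then have k: "k \<ge> 1" by simp
  define D where "D = real (moment_degree k)"
  have D2: "real k * (real k + 1) = 2 * D"
    using arg_cong[OF moment_degree_double[of k], of real] unfolding D_def by (simp add: algebra_simps)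
  have D1: "D \<ge> 1" unfolding D_def using moment_degree_pos[OF k] by simp
  have Dk: "D \<le> (real k)\<^sup>2"
  proof -
    have "real k * (real k + 1) \<le> real k * (2 * real k)" using k by (intro mult_left_mono) auto
    then show ?thesis unfolding D2 by (simp add: power2_eq_square)
  qed
  show ?thesis
  \<comment> \<open>Below 1 / D the product \<epsilon> D is at most 1, hence \<theta> \<le> 1 / 450;
    this controls the second-order term in the comparison of exponents.\<close>
  proof (rule exI[of _ "1 / D"], intro conjI allI impI)
    show "0 < 1 / D" using D1 by simp
    fix \<epsilon> m :: real assume \<epsilon>: "0 < \<epsilon> \<and> \<epsilon> < 1 / D" and m: "1 \<le> m"
    have \<epsilon>D: "\<epsilon> * D \<le> 1" using \<epsilon> D1 by (simp add: pos_less_divide_eq)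
    define \<theta> where "\<theta> = \<epsilon> * D / 450"
    have \<theta>: "\<theta> > 0" "\<theta> \<le> 1 / 450" unfolding \<theta>_def using \<epsilon> D1 \<epsilon>D by auto
    obtain N where N: "\<And>A \<alpha>. well_spaced A \<Longrightarrow> card A \<ge> N \<Longrightarrow> real_diam A \<le> real (card A) powr m \<Longrightarrow>
      0 < \<alpha> \<Longrightarrow> \<alpha> \<le> 1 \<Longrightarrow> ln (1 / \<alpha>) \<le> \<epsilon> * D / 21600 * ln (real (card A)) \<Longrightarrow>
      real (vinogradov_J s k A) = \<alpha> * real (card A) powr (2 * real s - D) \<Longrightarrow>
      card A > 1 \<and> (\<exists>A'\<subseteq>A. real (card A') \<ge> real (card A) powr (1 - \<theta>) \<and>
        (\<forall>l. real (card (fold_sumset l (moment_point k ` A'))) \<le> real (card A) powr (D + \<theta> * real l)))"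
      using structured_subset[OF k assms _ m, of \<epsilon>] \<epsilon> unfolding D_def \<theta>_def by blast
    show "\<exists>N::nat. \<forall>A::real set. \<forall>\<alpha>::real.
           finite A \<and> well_spaced A \<and> card A \<ge> N \<and> real_diam A \<le> real (card A) powr m \<and>
           0 < \<alpha> \<and> \<alpha> \<le> 1 \<and>
           ln (1 / \<alpha>) \<le> \<epsilon> * real k * (real k + 1) / 43200 * ln (real (card A)) \<and>
           real (vinogradov_J s k A)
             = \<alpha> * real (card A) powr (2 * real s - real k * (real k + 1) / 2)
           \<longrightarrow>
           (\<exists>A'. A' \<subseteq> A \<and>
              real (card A') \<ge> \<alpha> powr (\<epsilon> / 4) * real (card A) powr (1 - \<epsilon> * (real k)\<^sup>2) \<and>
              (\<forall>l::nat.
                 real (card (fold_sumset l (moment_point k ` A')))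
                   \<le> \<alpha> powr (- (1 + 2 * \<epsilon> * (real l + (real k)\<^sup>2)))
                     * real (card A') powr
                         (real k * (real k + 1) / 2 * (1 + \<epsilon> * (real l + (real k)\<^sup>2)))))"
    proof (intro exI[of _ N] allI impI, elim conjE)
      fix A :: "real set" and \<alpha> :: real
      assume ws: "well_spaced A" and cN: "card A \<ge> N" and diam: "real_diam A \<le> real (card A) powr m"
        and \<alpha>: "0 < \<alpha>" "\<alpha> \<le> 1"
        and ln\<alpha>: "ln (1 / \<alpha>) \<le> \<epsilon> * real k * (real k + 1) / 43200 * ln (real (card A))"
        and J: "real (vinogradov_J s k A) = \<alpha> * real (card A) powr (2 * real s - real k * (real k + 1) / 2)"
      have "\<epsilon> * real k * (real k + 1) / 43200 = \<epsilon> * D / 21600" using D2 by (simp add: mult.assoc)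
      then have ln\<alpha>': "ln (1 / \<alpha>) \<le> \<epsilon> * D / 21600 * ln (real (card A))" using ln\<alpha> by (simp only:)
      have J': "real (vinogradov_J s k A) = \<alpha> * real (card A) powr (2 * real s - D)" using J unfolding D2 by simp
      obtain A' where A': "A' \<subseteq> A" "real (card A') \<ge> real (card A) powr (1 - \<theta>)"
        "\<And>l. real (card (fold_sumset l (moment_point k ` A'))) \<le> real (card A) powr (D + \<theta> * real l)"
        and X1: "real (card A) > 1"
        using N[OF ws cN diam \<alpha> ln\<alpha>' J'] by auto
      have "\<alpha> powr (\<epsilon> / 4) * real (card A) powr (1 - \<epsilon> * (real k)\<^sup>2) \<le> 1 * real (card A) powr (1 - \<theta>)"
      proof (intro mult_mono)
        show "\<alpha> powr (\<epsilon> / 4) \<le> 1" using \<alpha> \<epsilon> by (intro powr_le1) auto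
        have "\<theta> \<le> \<epsilon> * D" unfolding \<theta>_def using \<epsilon> D1 by simp
        also have "\<dots> \<le> \<epsilon> * (real k)\<^sup>2" using Dk \<epsilon> by (intro mult_left_mono) auto
        finally show "real (card A) powr (1 - \<epsilon> * (real k)\<^sup>2) \<le> real (card A) powr (1 - \<theta>)"
          using X1 by (intro powr_mono) auto
      qed auto
      then have c1: "real (card A') \<ge> \<alpha> powr (\<epsilon> / 4) * real (card A) powr (1 - \<epsilon> * (real k)\<^sup>2)"
        using A'(2) by linarith
      have c2: "real (card (fold_sumset l (moment_point k ` A')))
                   \<le> \<alpha> powr (- (1 + 2 * \<epsilon> * (real l + (real k)\<^sup>2)))
                     * real (card A') powr (real k * (real k + 1) / 2 * (1 + \<epsilon> * (real l + (real k)\<^sup>2)))" for l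
      proof -
        define y where "y = real l + (real k)\<^sup>2"
        have y: "y \<ge> 0" "real l \<le> y" "D \<le> y" unfolding y_def using Dk by (auto intro: order_trans)
        \<comment> \<open>Replacing |A| by |A'| costs the factor 1 - \<theta> in the exponent. The
          error terms \<theta> l, \<theta> D and \<theta> \<epsilon> D y are each at most \<epsilon>
          D y / 450, because l \<le> y and D \<le> k^2 \<le> y, while \<epsilon> D y is
          available.\<close>
        have exponent: "D + \<theta> * real l \<le> (1 - \<theta>) * (D * (1 + \<epsilon> * y))"
        proof -
          have "\<theta> * real l \<le> \<theta> * y" "\<theta> * D \<le> \<theta> * y" using \<theta> y by (intro mult_left_mono; simp)+
          moreover have "\<theta> * (\<epsilon> * D * y) \<le> 1 / 450 * (\<epsilon> * D * y)"
            using \<theta> \<epsilon> D1 y by (intro mult_right_mono) auto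
          moreover have "\<theta> * y = \<epsilon> * D * y / 450" unfolding \<theta>_def by simp
          moreover have "0 \<le> \<epsilon> * D * y" using \<epsilon> D1 y by simp
          ultimately have "\<theta> * real l + \<theta> * D + \<theta> * (\<epsilon> * D * y) \<le> \<epsilon> * D * y" by linarith
          then show ?thesis by (simp add: algebra_simps)
        qed
        have "real (card (fold_sumset l (moment_point k ` A'))) \<le> real (card A) powr (D + \<theta> * real l)"
          by (rule A'(3))
        also have "\<dots> \<le> real (card A) powr ((1 - \<theta>) * (D * (1 + \<epsilon> * y)))"
          using exponent X1 by (intro powr_mono) auto
        also have "\<dots> = (real (card A) powr (1 - \<theta>)) powr (D * (1 + \<epsilon> * y))" by (simp add: powr_powr)
        also have "\<dots> \<le> real (card A') powr (D * (1 + \<epsilon> * y))"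
          using A'(2) D1 \<epsilon> y by (intro powr_mono2) auto
        \<comment> \<open>A negative power of \<alpha> \<le> 1 is at least 1.\<close>
        also have "\<dots> \<le> \<alpha> powr (- (1 + 2 * \<epsilon> * y)) * real (card A') powr (D * (1 + \<epsilon> * y))"
        proof -
          have "0 \<le> 2 * \<epsilon> * y" using \<epsilon> y by simp
          then have "- (1 + 2 * \<epsilon> * y) \<le> 0" by linarith
          then have "\<alpha> powr 0 \<le> \<alpha> powr (- (1 + 2 * \<epsilon> * y))"
            by (rule powr_mono') (use \<alpha> in simp_all)
          then have "1 * real (card A') powr (D * (1 + \<epsilon> * y))
              \<le> \<alpha> powr (- (1 + 2 * \<epsilon> * y)) * real (card A') powr (D * (1 + \<epsilon> * y))"
            using \<alpha> by (intro mult_right_mono) auto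
          then show ?thesis by simp
        qed
        finally show ?thesis unfolding y_def D2 by simp
      qed
      show "\<exists>A'. A' \<subseteq> A \<and>
              real (card A') \<ge> \<alpha> powr (\<epsilon> / 4) * real (card A) powr (1 - \<epsilon> * (real k)\<^sup>2) \<and>
              (\<forall>l::nat.
                 real (card (fold_sumset l (moment_point k ` A')))
                   \<le> \<alpha> powr (- (1 + 2 * \<epsilon> * (real l + (real k)\<^sup>2)))
                     * real (card A') powr
                         (real k * (real k + 1) / 2 * (1 + \<epsilon> * (real l + (real k)\<^sup>2))))"
        using A'(1) c1 c2 by blast
    qed
  qed
qed

end
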